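(* Assume the setting in the context with $\Phi$ a standard Gaussian matrix and $p\ge2$. Let $\theta_1\le\dots\le\theta_k$ be the principal angles between $\mathcal R(Q)$ and $\mathcal R(U_k)$, and $\varphi_1\le\dots\le\varphi_k$ those between $\mathcal R(P)$ and $\mathcal R(V_k)$. Then for $i=1,\dots,k$, $$\mathbb E\sin\theta_i\le\frac{\delta_i^{2q+2}\omega}{\sqrt{1+\delta_i^{4q+4}\omega^2}},\qquad \mathbb E\sin\varphi_i\le\frac{\delta_i^{2q+1}\omega}{\sqrt{1+\delta_i^{4q+2}\omega^2}}.$$
   Context: Let $A\in\mathbb R^{m\times n}$ with $m\ge n$ have full SVD $A=U\Sigma V^T$, with singular values $\sigma_1\ge\sigma_2\ge\dots\ge\sigma_n\ge 0$. Fix an integer $k\ge1$ with $\sigma_k>0$ (the paper regards $A$ as having numerical rank $k$, i.e. $\sigma_k$ well separated from $\sigma_{k+1}$). Write $U=[U_k\ U_\perp]$ with $U_k\in\mathbb R^{m\times k}$ the first $k$ left singular vectors $u_1,\dots,u_k$, $U_\perp\in\mathbb R^{m\times(m-k)}$ the rest; $V=[V_k\ V_\perp]$ with $V_k\in\mathbb R^{n\times k}$ the first $k$ right singular vectors $v_1,\dots,v_k$; $\Sigma_k=\mathrm{diag}(\sigma_1,\dots,\sigma_k)$ and $\Sigma_\perp$ the remaining diagonal block of $\Sigma$ containing $\sigma_{k+1},\dots,\sigma_n$ (so $\|\Sigma_\perp\|_2=\sigma_{k+1}$, $\|\Sigma_\perp\|_F=(\sum_{i>k}\sigma_i^2)^{1/2}$).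 The notation $\|\cdot\|_{2,F}$ means the statement holds for both the spectral and Frobenius norm. Let $p\ge1$ be an oversampling integer, $d=k+p<n$, and $q\ge0$ an integer (power-iteration parameter). RU-QLP (Randomized Unpivoted QLP): given $\Phi\in\mathbb R^{m\times d}$, let $\bar P\in\mathbb R^{n\times d}$ have orthonormal columns spanning the range of $(A^TA)^qA^T\Phi$ (assumed of rank $d$); compute the thin unpivoted QR factorization $A\bar P=QR$ with $Q\in\mathbb R^{m\times d}$ having orthonormal columns and $R\in\mathbb R^{d\times d}$ upper triangular; compute the thin unpivoted QR factorization $R^T=\widetilde P\widetilde R$; set $P=\bar P\widetilde P\in\mathbb R^{n\times d}$ and $L=\widetilde R^T$ (lower triangular), giving $\hat A=QLP^T$. Partition $R=\begin{bmatrix}R_{11}&R_{12}\\0&R_{22}\end{bmatrix}$ and $L=\begin{bmatrix}L_{11}&0\\L_{21}&L_{22}\end{bmatrix}$ with $R_{11},L_{11}\in\mathbb R^{k\times k}$. Define $\widehat\Phi_1=U_k^T\Phi\in\mathbb R^{k\times d}$ and $\widehat\Phi_2=U_\perp^T\Phi\in\mathbb R^{(m-k)\times d}$, assume $\widehat\Phi_1$ has rank $k$, and let $\dagger$ denote the Moore–Penrose inverse. Set $\delta_i=\sigma_{k+1}/\sigma_i$ for $i=1,\dots,k$ and $\gamma=\sigma_n/\sigma_1$. Principal angles between a subspace $\mathcal X$ and a $k$-dimensional subspace $\mathcal Y$ (with $\dim\mathcal X\ge k$) are the $k$ canonical angles $0\le\alpha_1\le\dots\le\alpha_k\le\pi/2$;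 for orthonormal bases $X$, $Y$, the values $\sin\alpha_i$ are the singular values of $(I-XX^T)Y$. Probabilistic setting: $\Phi\in\mathbb R^{m\times d}$ has i.i.d. standard normal entries (so $\widehat\Phi_1,\widehat\Phi_2$ are independent standard Gaussian matrices, and the rank assumptions hold almost surely); $\mathbb E$ denotes expectation over $\Phi$. Define $\omega_1=\sqrt{m-k}+\sqrt{k+p}+7$, $\omega_2=\frac{4e\sqrt{k+p}}{p+1}$, $\omega=\omega_1\omega_2$, and $C=\sqrt{\frac{k}{p-1}}+\frac{e\sqrt{(m-k)(k+p)}}{p}$, where $e$ is Euler's number. *)

theory Defs
  imports "HOL-Probability.Probability" "Jordan_Normal_Form.Matrix" "Jordan_Normal_Form.Char_Poly"
begin

definition col_space :: "real mat \<Rightarrow> real vec set" where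
  "col_space M = {M *\<^sub>v x | x. x \<in> carrier_vec (dim_col M)}"

text \<open>Singular values of M (with dim_row M >= dim_col M), listed in ascending order:
  the square roots of the eigenvalues (with multiplicity) of M^T M, i.e. the
  nonnegative numbers s_j with char_poly (M^T M) = prod_j (X - s_j^2).\<close>
definition sing_vals_asc :: "real mat \<Rightarrow> real list" where
  "sing_vals_asc M = (THE s. length s = dim_col M \<and> sorted s \<and> (\<forall>x\<in>set s. 0 \<le> x) \<and>
      char_poly (transpose_mat M * M) = (\<Prod>x\<leftarrow>s. [:- (x^2), 1:]))"

text \<open>Principal angles between R(X) and the k-dimensional R(Y), for X, Y with orthonormal
  columns (dim R(X) >= k = dim_col Y): alpha_1 <= ... <= alpha_k, where sin alpha_i are the
  singular values of (I - X X^T) Y.\<close>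
definition principal_angles :: "real mat \<Rightarrow> real mat \<Rightarrow> real list" where
  "principal_angles X Y =
     map arcsin (sing_vals_asc ((1\<^sub>m (dim_row X) - X * transpose_mat X) * Y))"

definition first_cols :: "nat \<Rightarrow> real mat \<Rightarrow> real mat" where
  "first_cols k M = mat (dim_row M) k (\<lambda>(i,j). M $$ (i,j))"

definition gaussian_matrix_measure :: "nat \<Rightarrow> nat \<Rightarrow> (nat \<times> nat \<Rightarrow> real) measure" where
  "gaussian_matrix_measure m d =
     PiM ({..<m} \<times> {..<d}) (\<lambda>_. density lborel std_normal_density)"

definition to_mat :: "nat \<Rightarrow> nat \<Rightarrow> (nat \<times> nat \<Rightarrow> real) \<Rightarrow> real mat" where
  "to_mat m d \<Phi> = mat m d (\<lambda>(i,j). \<Phi> (i,j))"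

definition diag_rect :: "nat \<Rightarrow> nat \<Rightarrow> (nat \<Rightarrow> real) \<Rightarrow> real mat" where
  "diag_rect m n \<sigma> = mat m n (\<lambda>(i,j). if i = j then \<sigma> i else 0)"

end

theory Submission
  imports Defs
begin

text \<open>
  Write \<open>\<Phi>\<^sub>1 = U\<^sub>k\<^sup>T \<Phi>\<close> and \<open>\<Phi>\<^sub>2 = U\<^sub>\<bottom>\<^sup>T \<Phi>\<close>. For \<open>y\<close> supported on the first \<open>i\<close> coordinates the range of
  \<open>Q\<close> contains \<open>U\<^sub>k y + h\<close> with \<open>h\<close> orthogonal to \<open>U\<^sub>k y\<close> and \<open>|h| \<le> \<rho> |y|\<close>, where
  \<open>\<rho> = \<delta>\<^sub>i\<^bsup>2q+2\<^esup> x\<close> and \<open>x\<close> is any bound on \<open>\<parallel>\<Phi>\<^sub>2\<parallel> / \<sigma>\<^sub>k(\<Phi>\<^sub>1)\<close>; by the min-max principle the sine of the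
  \<open>i\<close>-th angle is at most \<open>\<rho> / sqrt (1 + \<rho>\<^sup>2)\<close>. The exponent for \<open>P\<close> is \<open>2q+1\<close>. Since this function is
  concave, it remains to find a majorant of \<open>\<parallel>\<Phi>\<^sub>2\<parallel> / \<sigma>\<^sub>k(\<Phi>\<^sub>1)\<close> of mean at most \<open>\<omega>\<close>.

  The arithmetic-geometric mean inequality reduces this to second moments, so the independence of
  \<open>\<Phi>\<^sub>1\<close> and \<open>\<Phi>\<^sub>2\<close> plays no role. The norm of \<open>\<Phi>\<^sub>2\<close> is controlled by a Gaussian average of
  \<open>exp (\<mu> \<xi>\<^sup>T \<Phi>\<^sub>2 y - \<mu>\<^sup>2 |\<xi>|\<^sup>2 |y|\<^sup>2 / 2)\<close> over \<open>\<xi>\<close> and \<open>y\<close>, which has mean one. For \<open>\<sigma>\<^sub>k(\<Phi>\<^sub>1)\<close>, average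
  \<open>(y\<^sup>T (\<Phi>\<^sub>1 \<Phi>\<^sub>1\<^sup>T)\<inverse> y)\<^sup>r\<close> over Gaussian \<open>y\<close> with \<open>r = p div 2\<close>: this dominates the \<open>r\<close>-th power of the largest
  eigenvalue times a Gaussian moment, while for fixed \<open>y\<close> it is \<open>|y|\<^sup>2\<^sup>r\<close> times an inverse moment of a
  chi-square variable with \<open>p + 1\<close> degrees of freedom.
\<close>

text \<open>Both factors of the quotient are bounded by functions affine in a quantity of known
  mean. The squared norm is reached through an exponential average, the inverse square through its
  \<open>r\<close>-th moment; convexity and Bernoulli's inequality then replace a root or logarithm
  by its tangent, which loses nothing in the mean if the moment bound is attained. With s =
  sqrt(m-k) + sqrt(k+p), the two majorants have means at most 2 s^2 and K = 8 e^2 (k+p) / (p+1)^2.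
  The weight in the arithmetic-geometric mean inequality balances them, and sqrt(2 s^2 K) = 4 e s
  sqrt(k+p) / (p+1): this is the origin of the 4 e in the constant. The order
  \<open>r = p div 2\<close> is the largest integer for which a chi-square variable with p+1 degrees
  of freedom has a finite inverse \<open>r\<close>-th moment, namely 2r < p+1; it is positive
  because p is at least 2. Concavity of x / sqrt(1 + x^2) is used through its tangent line, so
  nothing about the majorant beyond its mean enters the final step.\<close>

abbreviation sq_sum :: "'i set \<Rightarrow> ('i \<Rightarrow> real) \<Rightarrow> real" where
  "sq_sum I x \<equiv> \<Sum>i\<in>I. (x i)\<^sup>2"

abbreviation dot :: "'i set \<Rightarrow> ('i \<Rightarrow> real) \<Rightarrow> ('i \<Rightarrow> real) \<Rightarrow> real" where
  "dot I x y \<equiv> \<Sum>i\<in>I. x i * y i"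

section \<open>Gaussian product measures\<close>

definition std_gauss :: "real measure" where
  "std_gauss = density lborel std_normal_density"

abbreviation gauss :: "'i set \<Rightarrow> ('i \<Rightarrow> real) measure" where
  "gauss I \<equiv> PiM I (\<lambda>_. std_gauss)"

lemma prob_space_std_gauss: "prob_space std_gauss"
  unfolding std_gauss_def by (rule prob_space_normal_density) simp

lemma sets_std_gauss [measurable_cong, simp]: "sets std_gauss = sets borel"
  by (simp add: std_gauss_def)

lemma space_std_gauss [simp]: "space std_gauss = UNIV"
  by (simp add: std_gauss_def)

interpretation std_gauss_prob: prob_space std_gauss
  by (rule prob_space_std_gauss)

interpretation gauss_prod: product_sigma_finite "\<lambda>_. std_gauss"
  by (simp add: product_sigma_finite_def std_gauss_prob.sigma_finite_measure_axioms)

lemma prob_space_gauss: "prob_space (gauss I)"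
  by (intro prob_space_PiM prob_space_std_gauss)

lemma emeasure_gauss [simp]: "emeasure (gauss I) (space (gauss I)) = 1"
  by (rule prob_space.emeasure_space_1[OF prob_space_gauss])

lemma sigma_finite_gauss: "sigma_finite_measure (gauss I)"
  using prob_space_gauss[of I] prob_space_imp_sigma_finite by blast

lemma pair_sigma_finite_gauss: "pair_sigma_finite (gauss I) (gauss J)"
  by (simp add: pair_sigma_finite_def sigma_finite_gauss)

lemma nn_integral_std_gauss:
  assumes [measurable]: "f \<in> borel_measurable borel"
  shows "(\<integral>\<^sup>+x. f x \<partial>std_gauss) = (\<integral>\<^sup>+x. ennreal (std_normal_density x) * f x \<partial>lborel)"
  unfolding std_gauss_def by (subst nn_integral_density) auto

lemma nn_integral_std_gauss_shift:
  fixes c :: real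
  assumes [measurable]: "f \<in> borel_measurable borel"
  shows "(\<integral>\<^sup>+x. f (x + c) * ennreal (exp (- c * x - c\<^sup>2 / 2)) \<partial>std_gauss) = (\<integral>\<^sup>+x. f x \<partial>std_gauss)"
proof -
  have "(\<integral>\<^sup>+x. f x \<partial>std_gauss) = (\<integral>\<^sup>+x. ennreal (std_normal_density (c + 1 * x)) * f (c + 1 * x) \<partial>lborel)"
    by (simp only: nn_integral_std_gauss[OF assms], subst nn_integral_real_affine[of _ 1 c]) auto
  also have "\<dots> = (\<integral>\<^sup>+x. ennreal (std_normal_density x) *
      (f (x + c) * ennreal (exp (- c * x - c\<^sup>2 / 2))) \<partial>lborel)"
  proof (rule nn_integral_cong)
    fix x
    have "std_normal_density (c + x) = std_normal_density x * exp (- c * x - c\<^sup>2 / 2)"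
      by (simp add: std_normal_density_def exp_add[symmetric] power2_eq_square field_simps)
    then show "ennreal (std_normal_density (c + 1 * x)) * f (c + 1 * x) =
      ennreal (std_normal_density x) * (f (x + c) * ennreal (exp (- c * x - c\<^sup>2 / 2)))"
      by (simp add: ennreal_mult' ac_simps)
  qed
  also have "\<dots> = (\<integral>\<^sup>+x. f (x + c) * ennreal (exp (- c * x - c\<^sup>2 / 2)) \<partial>std_gauss)"
    by (subst nn_integral_std_gauss) auto
  finally show ?thesis by simp
qed

text \<open>Cameron--Martin formula for a finite product. The density factors over the coordinates,
  so the induction integrates out coordinate \<open>i\<close> first and meets the one-dimensional
  shift. The restricted function keeps the translated point in the extensional space of
  \<open>gauss I\<close>.\<close>

lemma nn_integral_gauss_shift:
  fixes c :: "'i \<Rightarrow> real"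
  assumes "finite I" and "f \<in> borel_measurable (gauss I)"
  shows "(\<integral>\<^sup>+x. f (\<lambda>i\<in>I. x i + c i) * ennreal (exp (- dot I c x - sq_sum I c / 2))
           \<partial>gauss I) = (\<integral>\<^sup>+x. f x \<partial>gauss I)"
  using assms
proof (induction I arbitrary: f)
  case empty
  show ?case
    by (intro nn_integral_cong) (simp add: space_PiM)
next
  case (insert i I)
  note f = insert.prems
  note fin = \<open>finite I\<close>
  have [measurable]: "f \<in> borel_measurable (gauss (insert i I))" by fact
  let ?e = "\<lambda>J x. ennreal (exp (- dot J c x - sq_sum J c / 2))"
  let ?g = "\<lambda>x. f (\<lambda>i\<in>insert i I. x i + c i) * ?e (insert i I) x"
  let ?F = "\<lambda>x. \<integral>\<^sup>+y. f (x(i := y)) \<partial>std_gauss"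
  have [measurable]: "(\<lambda>x. f (\<lambda>i\<in>insert i I. x i + c i)) \<in> borel_measurable (gauss (insert i I))"
  proof -
    have "(\<lambda>x. \<lambda>i\<in>insert i I. x i + c i) \<in> measurable (gauss (insert i I)) (gauss (insert i I))"
      by (intro measurable_restrict) measurable
    from measurable_compose[OF this f] show ?thesis .
  qed
  have [measurable]: "?F \<in> borel_measurable (gauss I)"
    by measurable
  have g: "?g \<in> borel_measurable (gauss (insert i I))"
    using fin by measurable
  have "(\<integral>\<^sup>+x. ?g x \<partial>gauss (insert i I)) = (\<integral>\<^sup>+x. \<integral>\<^sup>+y. ?g (x(i := y)) \<partial>std_gauss \<partial>gauss I)"
    by (rule gauss_prod.product_nn_integral_insert[OF insert.hyps g])
  also have "\<dots> = (\<integral>\<^sup>+x. ?F (\<lambda>i\<in>I. x i + c i) * ?e I x \<partial>gauss I)"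
  proof (rule nn_integral_cong)
    fix x assume x: "x \<in> space (gauss I)"
    let ?T = "\<lambda>i\<in>I. x i + c i"
    have T: "?T \<in> space (gauss I)"
      by (auto simp: space_PiM)
    have mf: "(\<lambda>y. f (?T(i := y))) \<in> borel_measurable borel"
      using T insert.hyps by measurable
    have "?g (x(i := y)) = ?e I x * (f (?T(i := y + c i)) * ennreal (exp (- c i * y - (c i)\<^sup>2 / 2)))" for y
    proof -
      have 1: "(\<lambda>j\<in>insert i I. (x(i := y)) j + c j) = ?T(i := y + c i)"
        using insert.hyps by (auto simp: fun_eq_iff)
      have "(\<Sum>j\<in>insert i I. c j * (x(i := y)) j) = c i * y + dot I c x"
        using insert.hyps by (simp, intro sum.cong) auto
      moreover have "sq_sum (insert i I) c = (c i)\<^sup>2 + sq_sum I c"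
        using insert.hyps by simp
      ultimately have "?e (insert i I) (x(i := y)) = ?e I x * ennreal (exp (- c i * y - (c i)\<^sup>2 / 2))"
        by (simp add: ennreal_mult'[symmetric] exp_add[symmetric] field_simps)
      then show ?thesis
        by (simp only: 1) (simp add: ac_simps)
    qed
    then have "(\<integral>\<^sup>+y. ?g (x(i := y)) \<partial>std_gauss) =
       (\<integral>\<^sup>+y. ?e I x * (f (?T(i := y + c i)) * ennreal (exp (- c i * y - (c i)\<^sup>2 / 2))) \<partial>std_gauss)"
      by simp
    also have "\<dots> = ?e I x * (\<integral>\<^sup>+y. f (?T(i := y + c i)) * ennreal (exp (- c i * y - (c i)\<^sup>2 / 2)) \<partial>std_gauss)"
      using mf by (intro nn_integral_cmult) measurable
    also have "\<dots> = ?e I x * ?F ?T"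
      using nn_integral_std_gauss_shift[OF mf, of "c i"] by simp
    finally show "(\<integral>\<^sup>+y. ?g (x(i := y)) \<partial>std_gauss) = ?F ?T * ?e I x"
      by (simp add: mult.commute)
  qed
  also have "\<dots> = (\<integral>\<^sup>+x. ?F x \<partial>gauss I)"
    by (rule insert.IH) measurable
  also have "\<dots> = (\<integral>\<^sup>+x. f x \<partial>gauss (insert i I))"
    by (rule gauss_prod.product_nn_integral_insert[OF insert.hyps f, symmetric])
  finally show ?case .
qed

lemma nn_integral_std_gauss_uminus:
  assumes [measurable]: "f \<in> borel_measurable borel"
  shows "(\<integral>\<^sup>+x. f (- x) \<partial>std_gauss) = (\<integral>\<^sup>+x. f x \<partial>std_gauss)"
proof -
  have "(\<integral>\<^sup>+x. f x \<partial>std_gauss) = (\<integral>\<^sup>+x. ennreal (std_normal_density (0 + (-1) * x)) * f (0 + (-1) * x) \<partial>lborel)"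
    by (simp only: nn_integral_std_gauss[OF assms], subst nn_integral_real_affine[of _ "-1" 0]) auto
  also have "\<dots> = (\<integral>\<^sup>+x. f (- x) \<partial>std_gauss)"
    by (subst nn_integral_std_gauss) (auto simp: std_normal_density_def)
  finally show ?thesis by simp
qed

lemma nn_integral_std_gauss_abs:
  fixes a s :: real
  assumes [measurable]: "f \<in> borel_measurable borel"
  shows "(\<integral>\<^sup>+x. f (s + \<bar>a\<bar> * x) \<partial>std_gauss) = (\<integral>\<^sup>+x. f (s + a * x) \<partial>std_gauss)"
proof (cases "a \<ge> 0")
  case False
  then show ?thesis
    using nn_integral_std_gauss_uminus[of "\<lambda>x. f (s + a * x)"] by simp
qed simp

lemma nn_integral_std_gauss_affine:
  fixes b s :: real
  assumes [measurable]: "f \<in> borel_measurable borel" and b: "b > 0"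
  shows "(\<integral>\<^sup>+x. f (s + b * x) \<partial>std_gauss) = (\<integral>\<^sup>+u. ennreal (normal_density s b u) * f u \<partial>lborel)"
proof -
  have "(\<integral>\<^sup>+u. ennreal (normal_density s b u) * f u \<partial>lborel) =
     ennreal \<bar>b\<bar> * (\<integral>\<^sup>+x. ennreal (normal_density s b (s + b * x)) * f (s + b * x) \<partial>lborel)"
    using b by (subst nn_integral_real_affine[of _ b s]) auto
  also have "\<dots> = (\<integral>\<^sup>+x. ennreal \<bar>b\<bar> * (ennreal (normal_density s b (s + b * x)) * f (s + b * x)) \<partial>lborel)"
    by (subst nn_integral_cmult) auto
  also have "\<dots> = (\<integral>\<^sup>+x. ennreal (std_normal_density x) * f (s + b * x) \<partial>lborel)"
  proof (rule nn_integral_cong)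
    fix x
    have "\<bar>b\<bar> * normal_density s b (s + b * x) = std_normal_density x"
      using b by (simp add: normal_density_def real_sqrt_mult field_simps)
    then show "ennreal \<bar>b\<bar> * (ennreal (normal_density s b (s + b * x)) * f (s + b * x)) =
       ennreal (std_normal_density x) * f (s + b * x)"
      by (metis abs_ge_zero ennreal_mult' mult.assoc)
  qed
  finally show ?thesis
    by (subst nn_integral_std_gauss) auto
qed

text \<open>Written with densities and after Fubini, the two normal laws convolve. Densities need
  positive deviations, hence the separate degenerate case and the passage to the absolute value of
  \<open>a\<close>.\<close>

lemma nn_integral_std_gauss_add:
  fixes a b s :: real
  assumes [measurable]: "f \<in> borel_measurable borel" and b: "b \<ge> 0"
  shows "(\<integral>\<^sup>+y. \<integral>\<^sup>+x. f (s + a * y + b * x) \<partial>std_gauss \<partial>std_gauss) =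
         (\<integral>\<^sup>+x. f (s + sqrt (a\<^sup>2 + b\<^sup>2) * x) \<partial>std_gauss)"
proof (cases "a = 0 \<or> b = 0")
  case True
  then show ?thesis
    using b by (auto simp: nn_integral_std_gauss_abs std_gauss_prob.emeasure_space_1[simplified])
next
  case False
  with b have ab: "\<bar>a\<bar> > 0" "b > 0" by auto
  define c where "c = sqrt (a\<^sup>2 + b\<^sup>2)"
  have c: "c > 0"
    using ab by (auto simp: c_def sum_power2_gt_zero_iff)
  let ?g = "\<lambda>t. \<integral>\<^sup>+u. ennreal (normal_density (s + t) b u) * f u \<partial>lborel"
  have g: "?g \<in> borel_measurable borel"
    unfolding normal_density_def by measurable
  have "(\<integral>\<^sup>+y. \<integral>\<^sup>+x. f (s + a * y + b * x) \<partial>std_gauss \<partial>std_gauss) = (\<integral>\<^sup>+y. ?g (0 + a * y) \<partial>std_gauss)"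
    by (simp add: nn_integral_std_gauss_affine[OF _ ab(2)])
  also have "\<dots> = (\<integral>\<^sup>+y. ?g (0 + \<bar>a\<bar> * y) \<partial>std_gauss)"
    by (rule nn_integral_std_gauss_abs[OF g, symmetric])
  also have "\<dots> = (\<integral>\<^sup>+t. ennreal (normal_density 0 \<bar>a\<bar> t) * ?g t \<partial>lborel)"
    by (rule nn_integral_std_gauss_affine[OF g ab(1)])
  also have "\<dots> = (\<integral>\<^sup>+t. \<integral>\<^sup>+u. ennreal (normal_density 0 \<bar>a\<bar> t) * (ennreal (normal_density (s + t) b u) * f u) \<partial>lborel \<partial>lborel)"
    by (intro nn_integral_cong nn_integral_cmult[symmetric]) measurable
  also have "\<dots> = (\<integral>\<^sup>+u. \<integral>\<^sup>+t. ennreal (normal_density 0 \<bar>a\<bar> t) * (ennreal (normal_density (s + t) b u) * f u) \<partial>lborel \<partial>lborel)"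
    unfolding normal_density_def by (intro lborel_pair.Fubini') measurable
  also have "\<dots> = (\<integral>\<^sup>+u. \<integral>\<^sup>+t. ennreal (normal_density 0 b (u - s - t) * normal_density 0 \<bar>a\<bar> t) * f u \<partial>lborel \<partial>lborel)"
  proof -
    have "normal_density (s + t) b u = normal_density 0 b (u - s - t)" for t u
      by (simp add: normal_density_def diff_diff_eq)
    then show ?thesis
      by (simp add: ennreal_mult' mult_ac)
  qed
  also have "\<dots> = (\<integral>\<^sup>+u. (\<integral>\<^sup>+t. ennreal (normal_density 0 b (u - s - t) * normal_density 0 \<bar>a\<bar> t) \<partial>lborel) * f u \<partial>lborel)"
    by (intro nn_integral_cong nn_integral_multc) measurable
  also have "\<dots> = (\<integral>\<^sup>+u. ennreal (normal_density s c u) * f u \<partial>lborel)"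
    using fun_cong[OF conv_normal_density_zero_mean[OF ab(2,1)]]
    by (simp add: c_def add.commute) (simp add: normal_density_def)
  also have "\<dots> = (\<integral>\<^sup>+x. f (s + c * x) \<partial>std_gauss)"
    by (subst nn_integral_std_gauss_affine[OF _ c]) auto
  finally show ?thesis
    by (simp add: c_def)
qed

text \<open>A linear form in independent standard normals is normal with variance
  \<open>sq_sum I c\<close>. The offset \<open>s\<close> is arbitrary because the induction moves
  \<open>c i * y\<close> into it.\<close>

lemma nn_integral_gauss_linear:
  fixes c :: "'i \<Rightarrow> real" and s :: real
  assumes "finite I" and f[measurable]: "f \<in> borel_measurable borel"
  shows "(\<integral>\<^sup>+x. f (s + dot I c x) \<partial>gauss I) =
         (\<integral>\<^sup>+t. f (s + sqrt (sq_sum I c) * t) \<partial>std_gauss)"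
  using assms(1)
proof (induction I arbitrary: s)
  case empty
  show ?case
    by (simp add: std_gauss_prob.emeasure_space_1[simplified])
next
  case (insert i I)
  note [simp] = insert.hyps
  let ?b = "sqrt (sq_sum I c)"
  have b: "?b\<^sup>2 = sq_sum I c" by (simp add: sum_nonneg)
  have "(\<integral>\<^sup>+x. f (s + (dot (insert i I) c x)) \<partial>gauss (insert i I)) =
    (\<integral>\<^sup>+y. \<integral>\<^sup>+x. f (s + (\<Sum>j\<in>insert i I. c j * (x(i := y)) j)) \<partial>gauss I \<partial>std_gauss)"
    by (rule gauss_prod.product_nn_integral_insert_rev[OF insert.hyps]) measurable
  also have "\<dots> = (\<integral>\<^sup>+y. \<integral>\<^sup>+x. f ((s + c i * y) + dot I c x) \<partial>gauss I \<partial>std_gauss)"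
  proof (intro nn_integral_cong)
    fix x y
    have "(\<Sum>j\<in>I. c j * (x(i := y)) j) = dot I c x"
      using insert.hyps by (intro sum.cong) auto
    then show "f (s + (\<Sum>j\<in>insert i I. c j * (x(i := y)) j)) = f ((s + c i * y) + dot I c x)"
      by (simp add: add.assoc)
  qed
  also have "\<dots> = (\<integral>\<^sup>+y. \<integral>\<^sup>+x. f (s + c i * y + ?b * x) \<partial>std_gauss \<partial>std_gauss)"
    by (simp only: insert.IH)
  also have "\<dots> = (\<integral>\<^sup>+t. f (s + sqrt ((c i)\<^sup>2 + ?b\<^sup>2) * t) \<partial>std_gauss)"
    by (rule nn_integral_std_gauss_add) (auto simp: sum_nonneg)
  finally show ?case
    by (simp only: b) simp
qed

text \<open>Completing the square: the integrand times the standard density is a constant multiple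
  of the normal density with mean \<open>a / (1 + b)\<close> and variance
  \<open>1 / (1 + b)\<close>.\<close>

lemma nn_integral_std_gauss_exp_quadratic:
  fixes a b :: real
  assumes b: "b > -1"
  shows "(\<integral>\<^sup>+x. ennreal (exp (a * x - b * x\<^sup>2 / 2)) \<partial>std_gauss) =
         ennreal (exp (a\<^sup>2 / (2 * (1 + b))) / sqrt (1 + b))"
proof -
  let ?s = "1 / sqrt (1 + b)"
  have s: "?s > 0" "?s\<^sup>2 = 1 / (1 + b)" using b by (auto simp: power_divide)
  have "std_normal_density x * exp (a * x - b * x\<^sup>2 / 2) =
    exp (a\<^sup>2 / (2 * (1 + b))) / sqrt (1 + b) * normal_density (a / (1 + b)) ?s x" for x
  proof -
    have "- x\<^sup>2 / 2 + (a * x - b * x\<^sup>2 / 2) = a\<^sup>2 / (2 * (1 + b)) + - (x - a / (1 + b))\<^sup>2 / (2 * ?s\<^sup>2)"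
    proof -
      define t where "t = a / (1 + b)"
      have a: "a = t * (1 + b)" using b by (simp add: t_def)
      have 1: "a\<^sup>2 / (2 * (1 + b)) = t\<^sup>2 * (1 + b) / 2"
      proof -
        define c where "c = 1 + b"
        have "c \<noteq> 0" using b by (simp add: c_def)
        then show ?thesis
          unfolding a c_def[symmetric] by (simp add: power_mult_distrib power2_eq_square)
      qed
      have 2: "- (x - t)\<^sup>2 / (2 * ?s\<^sup>2) = - ((x - t)\<^sup>2 * (1 + b)) / 2"
        unfolding s(2) by simp
      show ?thesis
        unfolding t_def[symmetric] 1 2 by (simp add: a power2_eq_square field_simps)
    qed
    moreover have "1 / sqrt (2 * pi) = 1 / sqrt (1 + b) * (1 / sqrt (2 * pi * ?s\<^sup>2))"
      using b by (simp add: s(2) real_sqrt_mult real_sqrt_divide)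
    ultimately show ?thesis
      unfolding normal_density_def
      by (simp add: exp_add[symmetric] mult_ac)
  qed
  note eq = this
  have "(\<integral>\<^sup>+x. ennreal (exp (a * x - b * x\<^sup>2 / 2)) \<partial>std_gauss) =
    (\<integral>\<^sup>+x. ennreal (std_normal_density x * exp (a * x - b * x\<^sup>2 / 2)) \<partial>lborel)"
    by (subst nn_integral_std_gauss) (auto simp: ennreal_mult')
  also have "\<dots> = (\<integral>\<^sup>+x. ennreal (exp (a\<^sup>2 / (2 * (1 + b))) / sqrt (1 + b)) *
      ennreal (normal_density (a / (1 + b)) ?s x) \<partial>lborel)"
    unfolding eq using b by (intro nn_integral_cong ennreal_mult') auto
  also have "\<dots> = ennreal (exp (a\<^sup>2 / (2 * (1 + b))) / sqrt (1 + b)) *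
      (\<integral>\<^sup>+x. ennreal (normal_density (a / (1 + b)) ?s x) \<partial>lborel)"
    by (rule nn_integral_cmult) measurable
  also have "(\<integral>\<^sup>+x. ennreal (normal_density (a / (1 + b)) ?s x) \<partial>lborel) = 1"
    using s by (subst nn_integral_eq_integral) auto
  finally show ?thesis by simp
qed

lemma nn_integral_gauss_exp_quadratic:
  fixes a :: "'i \<Rightarrow> real" and b :: real
  assumes I: "finite I" and b: "b > -1"
  shows "(\<integral>\<^sup>+x. ennreal (exp (dot I a x - b * sq_sum I x / 2)) \<partial>gauss I) =
         ennreal (exp (sq_sum I a / (2 * (1 + b))) * (1 / sqrt (1 + b)) ^ card I)"
proof -
  have "dot I a x - b * sq_sum I x / 2 = (\<Sum>i\<in>I. a i * x i - b * (x i)\<^sup>2 / 2)" for x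
    by (simp add: sum_subtractf sum_distrib_left sum_divide_distrib)
  then have "(\<integral>\<^sup>+x. ennreal (exp (dot I a x - b * sq_sum I x / 2)) \<partial>gauss I) =
    (\<integral>\<^sup>+x. (\<Prod>i\<in>I. ennreal (exp (a i * x i - b * (x i)\<^sup>2 / 2))) \<partial>gauss I)"
    using I by (simp add: exp_sum prod_ennreal)
  also have "\<dots> = (\<Prod>i\<in>I. \<integral>\<^sup>+x. ennreal (exp (a i * x - b * x\<^sup>2 / 2)) \<partial>std_gauss)"
    using I by (intro gauss_prod.product_nn_integral_prod) auto
  also have "\<dots> = (\<Prod>i\<in>I. ennreal (exp ((a i)\<^sup>2 / (2 * (1 + b))) * (1 / sqrt (1 + b))))"
    using nn_integral_std_gauss_exp_quadratic[OF b] by simp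
  also have "\<dots> = ennreal (\<Prod>i\<in>I. exp ((a i)\<^sup>2 / (2 * (1 + b))) * (1 / sqrt (1 + b)))"
    using b by (intro prod_ennreal) auto
  also have "(\<Prod>i\<in>I. exp ((a i)\<^sup>2 / (2 * (1 + b))) * (1 / sqrt (1 + b))) =
    exp (sq_sum I a / (2 * (1 + b))) * (1 / sqrt (1 + b)) ^ card I"
    using I by (simp only: prod.distrib prod_constant sum_divide_distrib exp_sum)
  finally show ?thesis .
qed

lemma nn_integral_gauss_exp_linear:
  fixes c :: "'i \<Rightarrow> real"
  assumes "finite I"
  shows "(\<integral>\<^sup>+x. ennreal (exp (dot I c x)) \<partial>gauss I) = ennreal (exp (sq_sum I c / 2))"
  using nn_integral_gauss_exp_quadratic[OF assms, of 0 c] by simp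

lemma nn_integral_gauss_exp_square:
  fixes s :: real
  assumes "finite I" "s > - 1 / 2"
  shows "(\<integral>\<^sup>+x. ennreal (exp (- s * sq_sum I x)) \<partial>gauss I) = ennreal ((1 / sqrt (1 + 2 * s)) ^ card I)"
  using nn_integral_gauss_exp_quadratic[OF assms(1), of "2 * s" "\<lambda>_. 0"] assms(2) by simp

text \<open>Jensen's inequality after shifting the Gaussian by \<open>w\<close>, read off the closed form.\<close>
lemma nn_integral_gauss_exp_quadratic_ge:
  fixes a w :: "'i \<Rightarrow> real" and b :: real
  assumes I: "finite I" and b: "b \<ge> 0"
  shows "ennreal (exp (dot I a w - (1 + b) * sq_sum I w / 2 - real (card I) * b / 2))
    \<le> (\<integral>\<^sup>+x. ennreal (exp (dot I a x - b * sq_sum I x / 2)) \<partial>gauss I)"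
proof -
  have 1: "a i * w i - (1 + b) * (w i)\<^sup>2 / 2 \<le> (a i)\<^sup>2 / (2 * (1 + b))" for i
  proof -
    have "0 \<le> (a i - (1 + b) * w i)\<^sup>2" by simp
    then have "2 * (1 + b) * (a i * w i) - (1 + b)\<^sup>2 * (w i)\<^sup>2 \<le> (a i)\<^sup>2"
      by (simp add: power2_eq_square algebra_simps)
    then show ?thesis
      using b by (simp add: field_simps power2_eq_square)
  qed
  have "dot I a w - (1 + b) * sq_sum I w / 2 = (\<Sum>i\<in>I. a i * w i - (1 + b) * (w i)\<^sup>2 / 2)"
    by (simp add: sum_subtractf sum_distrib_left sum_divide_distrib)
  also have "\<dots> \<le> (\<Sum>i\<in>I. (a i)\<^sup>2 / (2 * (1 + b)))"
    by (intro sum_mono 1)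
  finally have 2: "dot I a w - (1 + b) * sq_sum I w / 2 \<le> sq_sum I a / (2 * (1 + b))"
    by (simp add: sum_divide_distrib)
  have "exp (- b / 2) \<le> 1 / sqrt (1 + b)"
  proof -
    have "1 + b \<le> exp b" by (rule exp_ge_add_one_self)
    then have "sqrt (1 + b) \<le> sqrt (exp b)" by simp
    also have "sqrt (exp b) = exp (b / 2)"
      by (rule real_sqrt_unique) (auto simp: power2_eq_square exp_add[symmetric])
    finally show ?thesis
      using b by (simp add: exp_minus field_simps)
  qed
  then have "exp (- b / 2) ^ card I \<le> (1 / sqrt (1 + b)) ^ card I"
    by (intro power_mono) auto
  then have 3: "exp (- real (card I) * b / 2) \<le> (1 / sqrt (1 + b)) ^ card I"
    by (simp add: exp_of_nat_mult[symmetric])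
  have "exp (dot I a w - (1 + b) * sq_sum I w / 2 - real (card I) * b / 2) =
    exp (dot I a w - (1 + b) * sq_sum I w / 2) * exp (- real (card I) * b / 2)"
    by (simp add: exp_add[symmetric])
  also have "\<dots> \<le> exp (sq_sum I a / (2 * (1 + b))) * (1 / sqrt (1 + b)) ^ card I"
    using 2 3 by (intro mult_mono) auto
  finally show ?thesis
    using nn_integral_gauss_exp_quadratic[OF I, of b a] b by (simp add: ennreal_leI)
qed

text \<open>The cosine integral is the real part of the characteristic function of the standard
  normal law.\<close>

lemma nn_integral_std_gauss_cos:
  "(\<integral>\<^sup>+t. ennreal (1 + cos (c * t)) \<partial>std_gauss) = ennreal (1 + exp (- c\<^sup>2 / 2))"
proof -
  have int: "integrable std_gauss (\<lambda>t. cos (c * t))"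
    by (rule std_gauss_prob.integrable_const_bound[of _ 1]) auto
  have "integrable std_gauss (\<lambda>x. iexp (c * x))"
    by (rule std_gauss_prob.integrable_iexp) auto
  then have "(\<integral>t. cos (c * t) \<partial>std_gauss) = Re (char std_gauss c)"
    unfolding char_def by (subst integral_Re[symmetric]) (simp_all add: Re_exp)
  also have "\<dots> = exp (- c\<^sup>2 / 2)"
    unfolding std_gauss_def by (simp add: char_std_normal_distribution Re_exp)
  finally have "(\<integral>t. 1 + cos (c * t) \<partial>std_gauss) = 1 + exp (- c\<^sup>2 / 2)"
    using int by (simp add: std_gauss_prob.prob_space[simplified])
  moreover have "1 + cos (c * t) \<ge> 0" for t
    using cos_ge_minus_one[of "c * t"] by linarith
  ultimately show ?thesis
    using int by (subst nn_integral_eq_integral) auto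
qed

lemma sum_square_orthonormal:
  fixes w :: "'j \<Rightarrow> 'i \<Rightarrow> real"
  assumes J: "finite J"
    and orth: "\<And>a b. a \<in> J \<Longrightarrow> b \<in> J \<Longrightarrow> dot I (w a) (w b) = (if a = b then 1 else 0)"
  shows "(\<Sum>i\<in>I. (\<Sum>a\<in>J. h a * w a i)\<^sup>2) = sq_sum J h"
proof -
  have "(\<Sum>i\<in>I. (\<Sum>a\<in>J. h a * w a i)\<^sup>2) = (\<Sum>i\<in>I. \<Sum>a\<in>J. \<Sum>b\<in>J. h a * h b * (w a i * w b i))"
    by (simp add: power2_eq_square sum_product mult_ac)
  also have "\<dots> = (\<Sum>a\<in>J. \<Sum>i\<in>I. \<Sum>b\<in>J. h a * h b * (w a i * w b i))"
    by (rule sum.swap)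
  also have "\<dots> = (\<Sum>a\<in>J. \<Sum>b\<in>J. h a * h b * dot I (w a) (w b))"
    unfolding sum_distrib_left by (intro sum.cong refl sum.swap)
  also have "\<dots> = (\<Sum>a\<in>J. \<Sum>b\<in>J. if a = b then h a * h b else 0)"
    using orth by (intro sum.cong refl) auto
  also have "\<dots> = sq_sum J h"
    using J by (simp add: sum.delta power2_eq_square)
  finally show ?thesis .
qed

text \<open>The exponential is linearised by writing \<open>exp (- a\<^sup>2 / 2)\<close> as the mean of \<open>cos (a * h)\<close> for a
  standard normal \<open>h\<close>; adding \<open>1\<close> keeps every integrand nonnegative.\<close>
lemma nn_integral_gauss_exp_square_orthonormal:
  fixes w :: "'j \<Rightarrow> 'i \<Rightarrow> real"
  assumes I: "finite I" and J: "finite J" and s: "s \<ge> 0"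
    and orth: "\<And>a b. a \<in> J \<Longrightarrow> b \<in> J \<Longrightarrow> dot I (w a) (w b) = (if a = b then 1 else 0)"
  shows "(\<integral>\<^sup>+g. ennreal (exp (- s * (\<Sum>a\<in>J. (dot I (w a) g)\<^sup>2))) \<partial>gauss I) =
     ennreal ((1 / sqrt (1 + 2 * s)) ^ card J)"
proof -
  let ?r = "sqrt (2 * s)"
  have r: "?r\<^sup>2 = 2 * s" using s by simp
  let ?G = "\<lambda>g. ennreal (exp (- s * (\<Sum>a\<in>J. (dot I (w a) g)\<^sup>2)))"
  let ?H = "\<lambda>h. ennreal (exp (- s * sq_sum J h))"
  interpret P: pair_sigma_finite "gauss J" "gauss I" by (rule pair_sigma_finite_gauss)
  have cosI: "(\<integral>\<^sup>+x. ennreal (1 + cos (dot K c x)) \<partial>gauss K) = 1 + ennreal (exp (- sq_sum K c / 2))"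
    if "finite K" for K :: "'k set" and c
  proof -
    have "(\<integral>\<^sup>+x. ennreal (1 + cos (dot K c x)) \<partial>gauss K) =
      (\<integral>\<^sup>+t. ennreal (1 + cos (sqrt (sq_sum K c) * t)) \<partial>std_gauss)"
      using nn_integral_gauss_linear[OF that, of "\<lambda>x. ennreal (1 + cos x)" 0 c] by simp
    also have "\<dots> = 1 + ennreal (exp (- sq_sum K c / 2))"
      by (simp add: nn_integral_std_gauss_cos sum_nonneg)
    finally show ?thesis .
  qed
  have r2: "- (\<Sum>a\<in>K. (?r * X a)\<^sup>2) / 2 = - s * sq_sum K X" for K :: "'k set" and X
    by (simp only: power_mult_distrib r sum_distrib_left[symmetric])
  have "1 + (\<integral>\<^sup>+g. ?G g \<partial>gauss I) = (\<integral>\<^sup>+g. 1 + ?G g \<partial>gauss I)"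
    by (subst nn_integral_add) auto
  also have "\<dots> = (\<integral>\<^sup>+g. \<integral>\<^sup>+h. ennreal (1 + cos (\<Sum>a\<in>J. (?r * dot I (w a) g) * h a)) \<partial>gauss J \<partial>gauss I)"
    by (simp only: cosI[OF J] r2)
  also have "\<dots> = (\<integral>\<^sup>+h. \<integral>\<^sup>+g. ennreal (1 + cos (\<Sum>a\<in>J. (?r * dot I (w a) g) * h a)) \<partial>gauss I \<partial>gauss J)"
    by (rule P.Fubini') measurable
  also have "\<dots> = (\<integral>\<^sup>+h. \<integral>\<^sup>+g. ennreal (1 + cos (\<Sum>i\<in>I. (?r * (\<Sum>a\<in>J. h a * w a i)) * g i)) \<partial>gauss I \<partial>gauss J)"
  proof (intro nn_integral_cong arg_cong[where f = ennreal] arg_cong[where f = cos] arg_cong2[where f = "(+)"] refl)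
    fix h g
    have "(\<Sum>a\<in>J. (?r * dot I (w a) g) * h a) = (\<Sum>a\<in>J. \<Sum>i\<in>I. ?r * (h a * w a i) * g i)"
      by (simp add: sum_distrib_left sum_distrib_right mult_ac)
    also have "\<dots> = (\<Sum>i\<in>I. \<Sum>a\<in>J. ?r * (h a * w a i) * g i)"
      by (rule sum.swap)
    also have "\<dots> = (\<Sum>i\<in>I. (?r * (\<Sum>a\<in>J. h a * w a i)) * g i)"
      by (simp add: sum_distrib_left sum_distrib_right)
    finally show "(\<Sum>a\<in>J. (?r * dot I (w a) g) * h a) = (\<Sum>i\<in>I. (?r * (\<Sum>a\<in>J. h a * w a i)) * g i)" .
  qed
  \<comment> \<open>As a linear form in \<open>g\<close>, the argument of the cosine has a
    coefficient vector of squared norm \<open>2 * s * sq_sum J h\<close>; this is the only place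
    where orthonormality enters.\<close>
  also have "\<dots> = (\<integral>\<^sup>+h. 1 + ?H h \<partial>gauss J)"
    by (simp only: cosI[OF I] r2 sum_square_orthonormal[OF J orth])
  also have "\<dots> = 1 + (\<integral>\<^sup>+h. ?H h \<partial>gauss J)"
    by (subst nn_integral_add) auto
  also have "(\<integral>\<^sup>+h. ?H h \<partial>gauss J) = ennreal ((1 / sqrt (1 + 2 * s)) ^ card J)"
    using s by (intro nn_integral_gauss_exp_square[OF J]) auto
  finally show ?thesis
    by (simp add: ennreal_add_left_cancel)
qed

section \<open>Inverse moments of Gaussian quadratic forms\<close>

text \<open>A Gamma integral, read off from the total mass of the Erlang density.\<close>

lemma nn_integral_power_exp:
  fixes c :: real
  assumes c: "c > 0"
  shows "(\<integral>\<^sup>+s. ennreal (indicator {0..} s * s ^ n * exp (- s * c) / fact n) \<partial>lborel) = ennreal (1 / c ^ Suc n)"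
proof -
  have "(\<integral>\<^sup>+s. ennreal (indicator {0..} s * s ^ n * exp (- s * c) / fact n) \<partial>lborel) =
    (\<integral>\<^sup>+s. ennreal (1 / c ^ Suc n) * ennreal (erlang_density n c s) \<partial>lborel)"
    using c by (intro nn_integral_cong)
      (auto simp: erlang_density_def indicator_def ennreal_mult'[symmetric] mult_ac)
  also have "\<dots> = ennreal (1 / c ^ Suc n) * (\<integral>\<^sup>+s. ennreal (erlang_density n c s) \<partial>lborel)"
    by (rule nn_integral_cmult) measurable
  also have "(\<integral>\<^sup>+s. ennreal (erlang_density n c s) \<partial>lborel) = 1"
    using c nn_integral_erlang_ith_moment[of c n 0] by simp
  finally show ?thesis by simp
qed

text \<open>Writes an inverse power as a mixture of exponentials, whose Gaussian means are explicit.
  It must also hold at \<open>c = 0\<close>, where both sides are infinite.\<close>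

lemma inverse_power_le_nn_integral:
  fixes c :: real
  assumes c: "c \<ge> 0"
  shows "inverse (ennreal c ^ Suc n) \<le>
    (\<integral>\<^sup>+s. ennreal (indicator {0..} s * s ^ n * exp (- s * c) / fact n) \<partial>lborel)" (is "_ \<le> ?K c")
proof (cases "c = 0")
  case False
  with c have c: "c > 0" by simp
  then have "inverse (ennreal c ^ Suc n) = ennreal (1 / c ^ Suc n)"
    by (simp add: ennreal_power inverse_ennreal inverse_eq_divide del: power_Suc)
  then show ?thesis
    using nn_integral_power_exp[OF c] by simp
next
  \<comment> \<open>The integral at \<open>0\<close> dominates the one at every
    \<open>e > 0\<close>, which equals \<open>1 / e ^ Suc n\<close> and is unbounded in
    \<open>e\<close>.\<close>
  case True
  have "ennreal (1 / e ^ Suc n) \<le> ?K 0" if e: "e > 0" for e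
  proof -
    have "?K e \<le> ?K 0"
      using e by (intro nn_integral_mono ennreal_leI) (auto simp: indicator_def divide_right_mono mult_left_le)
    then show ?thesis
      using nn_integral_power_exp[OF e, of n] by simp
  qed
  note * = this
  have "ennreal x \<le> ?K 0" if "x > 1" for x
  proof -
    have "ennreal x \<le> ennreal (1 / (1 / x) ^ Suc n)"
      using that by (intro ennreal_leI) (simp add: power_divide self_le_power del: power_Suc)
    also have "\<dots> \<le> ?K 0"
      using that by (intro *) simp
    finally show ?thesis .
  qed
  note ** = this
  have "?K 0 = \<infinity>"
  proof (rule ccontr)
    assume "?K 0 \<noteq> \<infinity>"
    then obtain x where x: "x \<ge> 0" "?K 0 = ennreal x"
      by (cases "?K 0") auto
    from **[of "x + 2"] have "ennreal (x + 2) \<le> ennreal x"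
      using x by simp
    then show False
      using x by simp
  qed
  then show ?thesis
    using True by simp
qed

text \<open>The antiderivative is \<open>- 1 / sqrt (1 + 2 * s)\<close>. The exponent 3 is what
  remains of the power \<open>2 * n + 3\<close> below after \<open>2 * n\<close> factors have
  absorbed \<open>s ^ n\<close>.\<close>

lemma nn_integral_inverse_power_three_halves:
  "(\<integral>\<^sup>+s. ennreal (indicator {0..} s * (1 / sqrt (1 + 2 * s)) ^ 3) \<partial>lborel) = 1"
proof -
  have "(\<integral>\<^sup>+s. ennreal ((1 / sqrt (1 + 2 * s)) ^ 3) * indicator {0..} s \<partial>lborel) =
      ennreal (0 - (- 1 / sqrt (1 + 2 * 0)))"
  proof (rule nn_integral_FTC_atLeast)
    show "((\<lambda>s. - 1 / sqrt (1 + 2 * s)) has_real_derivative (1 / sqrt (1 + 2 * x)) ^ 3) (at x)" if "0 \<le> x" for x :: real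
    proof -
      have "sqrt (1 + 2 * x) > 0" using that by simp
      then show ?thesis
        using that
        by (auto intro!: derivative_eq_intros simp: power3_eq_cube field_simps)
    qed
    show "((\<lambda>s. - 1 / sqrt (1 + 2 * s)) \<longlongrightarrow> 0) at_top"
      by real_asymp
  qed auto
  then show ?thesis
    by (simp add: ennreal_mult'[symmetric] mult.commute ennreal_indicator[symmetric] del: ennreal_indicator)
qed

text \<open>An inverse moment of order \<open>Suc n\<close> of a chi-square variable with
  \<open>card J\<close> degrees of freedom: the mixture of exponentials is integrated under the
  Gaussian first, then over \<open>s\<close>.\<close>

lemma nn_integral_gauss_inverse_square_orthonormal:
  fixes w :: "'j \<Rightarrow> 'i \<Rightarrow> real"
  assumes I: "finite I" and J: "finite J" and r: "2 * Suc n < card J"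
    and orth: "\<And>a b. a \<in> J \<Longrightarrow> b \<in> J \<Longrightarrow> dot I (w a) (w b) = (if a = b then 1 else 0)"
  shows "(\<integral>\<^sup>+g. inverse (ennreal (\<Sum>a\<in>J. (dot I (w a) g)\<^sup>2) ^ Suc n) \<partial>gauss I) \<le>
     ennreal (1 / (2 ^ n * fact n))"
proof -
  let ?D = "\<lambda>g. \<Sum>a\<in>J. (dot I (w a) g)\<^sup>2"
  let ?k = "\<lambda>s. indicator {0..} s * s ^ n / fact n :: real"
  interpret P: pair_sigma_finite lborel "gauss I"
    by (simp add: pair_sigma_finite_def sigma_finite_gauss sigma_finite_lborel)
  have k: "?k s \<ge> 0" for s by (auto simp: indicator_def)
  have "(\<integral>\<^sup>+g. inverse (ennreal (?D g) ^ Suc n) \<partial>gauss I) \<le>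
    (\<integral>\<^sup>+g. \<integral>\<^sup>+s. ennreal (indicator {0..} s * s ^ n * exp (- s * ?D g) / fact n) \<partial>lborel \<partial>gauss I)"
    by (intro nn_integral_mono inverse_power_le_nn_integral) (simp add: sum_nonneg)
  also have "\<dots> = (\<integral>\<^sup>+s. \<integral>\<^sup>+g. ennreal (indicator {0..} s * s ^ n * exp (- s * ?D g) / fact n) \<partial>gauss I \<partial>lborel)"
    by (rule P.Fubini') measurable
  also have "\<dots> = (\<integral>\<^sup>+s. \<integral>\<^sup>+g. ennreal (?k s) * ennreal (exp (- s * ?D g)) \<partial>gauss I \<partial>lborel)"
    using k by (intro nn_integral_cong) (simp add: ennreal_mult'[symmetric])
  also have "\<dots> = (\<integral>\<^sup>+s. ennreal (?k s) * (\<integral>\<^sup>+g. ennreal (exp (- s * ?D g)) \<partial>gauss I) \<partial>lborel)"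
    by (intro nn_integral_cong nn_integral_cmult) measurable
  also have "\<dots> \<le> (\<integral>\<^sup>+s. ennreal (1 / (2 ^ n * fact n)) * ennreal (indicator {0..} s * (1 / sqrt (1 + 2 * s)) ^ 3) \<partial>lborel)"
  proof (rule nn_integral_mono)
    fix s :: real
    show "ennreal (?k s) * (\<integral>\<^sup>+g. ennreal (exp (- s * ?D g)) \<partial>gauss I) \<le>
      ennreal (1 / (2 ^ n * fact n)) * ennreal (indicator {0..} s * (1 / sqrt (1 + 2 * s)) ^ 3)"
    proof (cases "s \<ge> 0")
      case True
      let ?q = "1 / sqrt (1 + 2 * s)"
      have q: "0 \<le> ?q" "?q \<le> 1" "?q\<^sup>2 = 1 / (1 + 2 * s)"
        using True by (auto simp: power_divide)
      \<comment> \<open>The factor \<open>s ^ n\<close> is paid for by \<open>2 * n\<close> of the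
        powers of \<open>?q\<close>, at the price \<open>1 / 2 ^ n\<close>. Since
        \<open>card J\<close> is at least \<open>2 * n + 3\<close>, an integrable
        \<open>?q ^ 3\<close> is left over.\<close>
      have "s * ?q\<^sup>2 \<le> 1 / 2"
        using True unfolding q(3) by (simp add: field_simps)
      then have "(s * ?q\<^sup>2) ^ n \<le> (1 / 2) ^ n"
        using True by (intro power_mono) auto
      then have "s ^ n * ?q ^ (2 * n) \<le> 1 / 2 ^ n"
        by (simp only: power_mult_distrib power_mult power_one_over)
      then have 1: "(s ^ n * ?q ^ (2 * n)) * ?q ^ 3 \<le> 1 / 2 ^ n * ?q ^ 3"
        using q by (intro mult_right_mono) auto
      have "?q ^ card J \<le> ?q ^ (2 * n + 3)"
        using q r by (intro power_decreasing) auto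
      then have "s ^ n * ?q ^ card J \<le> s ^ n * ?q ^ (2 * n + 3)"
        using True by (intro mult_left_mono) auto
      also have "\<dots> = (s ^ n * ?q ^ (2 * n)) * ?q ^ 3"
        by (simp add: power_add)
      also note 1
      finally have "s ^ n * ?q ^ card J / fact n \<le> (1 / 2 ^ n * ?q ^ 3) / fact n"
        by (intro divide_right_mono) auto
      then have "s ^ n / fact n * ?q ^ card J \<le> 1 / (2 ^ n * fact n) * ?q ^ 3"
        by (simp only: times_divide_eq_left times_divide_eq_right divide_divide_eq_left mult_1)
      then show ?thesis
        using True nn_integral_gauss_exp_square_orthonormal[OF I J True orth]
        by (simp add: ennreal_mult'[symmetric] ennreal_leI)
    qed simp
  qed
  also have "\<dots> = ennreal (1 / (2 ^ n * fact n))"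
    by (subst nn_integral_cmult) (simp_all add: nn_integral_inverse_power_three_halves)
  finally show ?thesis .
qed

text \<open>Replacing the \<open>u\<close>-component of the columns of a Gaussian matrix by an independent copy
  does not change its law. Householder reflections would give this at once; here it is obtained from
  three Cameron--Martin shifts.\<close>
lemma nn_integral_gauss_resample:
  fixes u :: "'s \<Rightarrow> real" and F :: "('s \<times> 't \<Rightarrow> real) \<Rightarrow> ennreal"
  assumes S: "finite S" and T: "finite T" and u: "sq_sum S u = 1"
    and F: "F \<in> borel_measurable (gauss (S \<times> T))"
  shows "(\<integral>\<^sup>+X. F X \<partial>gauss (S \<times> T)) =
    (\<integral>\<^sup>+X. \<integral>\<^sup>+g. F (\<lambda>(i, j)\<in>S \<times> T. X (i, j) - u i * (g j + (\<Sum>l\<in>S. u l * X (l, j)))) \<partial>gauss T \<partial>gauss (S \<times> T))"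
proof -
  let ?G = "gauss (S \<times> T)" and ?H = "gauss T"
  interpret P: pair_sigma_finite ?G ?H by (rule pair_sigma_finite_gauss)
  define v where "v X j = (\<Sum>l\<in>S. u l * X (l, j))" for X :: "'s \<times> 't \<Rightarrow> real" and j
  define A where "A X h = (\<lambda>(i, j)\<in>S \<times> T. X (i, j) - u i * h j)" for X :: "'s \<times> 't \<Rightarrow> real" and h
  define ip where "ip X h = dot T (v X) h" for X :: "'s \<times> 't \<Rightarrow> real" and h
  define sq where "sq h = sq_sum T h" for h :: "'t \<Rightarrow> real"
  have v[measurable]: "(\<lambda>X. v X j) \<in> borel_measurable ?G" if "j \<in> T" for j
    unfolding v_def
  proof (intro borel_measurable_sum borel_measurable_times borel_measurable_const)
    fix l assume "l \<in> S"
    then have "(l, j) \<in> S \<times> T" using that by simp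
    then show "(\<lambda>X. X (l, j)) \<in> borel_measurable ?G"
      by measurable
  qed
  have v2[measurable]: "(\<lambda>(X, h). v X j) \<in> borel_measurable (?G \<Otimes>\<^sub>M ?H)" if "j \<in> T" for j
    using measurable_compose[OF measurable_fst v[OF that]] by (simp add: case_prod_beta')
  have ip[measurable]: "(\<lambda>(X, h). ip X h) \<in> borel_measurable (?G \<Otimes>\<^sub>M ?H)"
    unfolding ip_def v_def by measurable
  have A[measurable]: "(\<lambda>(X, h). A X h) \<in> measurable (?G \<Otimes>\<^sub>M ?H) ?G"
    unfolding A_def by (measurable, auto simp: case_prod_beta')
  have FA[measurable]: "(\<lambda>(X, h). F (A X h)) \<in> borel_measurable (?G \<Otimes>\<^sub>M ?H)"
    using measurable_compose[OF A F] by (simp add: case_prod_beta')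
  have sq1[measurable]: "(\<lambda>X. sq (v X)) \<in> borel_measurable ?G"
    unfolding sq_def by measurable
  have vA: "v (A X h) j = v X j - h j" if "j \<in> T" for X h j
  proof -
    have "v (A X h) j = (\<Sum>l\<in>S. u l * X (l, j) - (u l)\<^sup>2 * h j)"
      unfolding v_def A_def using that by (intro sum.cong) (auto simp: power2_eq_square algebra_simps)
    also have "\<dots> = v X j - h j"
      by (simp add: sum_subtractf sum_distrib_right[symmetric] u v_def)
    finally show ?thesis .
  qed
  have ipA: "ip (A X h) h = ip X h - sq h" for X h
    unfolding ip_def sq_def by (simp add: vA algebra_simps sum_subtractf power2_eq_square)
  have sqA: "sq (v (A X h)) = sq (v X) - 2 * ip X h + sq h" for X h
    unfolding ip_def sq_def
    by (simp add: vA power2_diff sum_subtractf sum.distrib sum_distrib_left mult_ac)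
  have prod: "(\<Sum>x\<in>S \<times> T. f x) = (\<Sum>i\<in>S. \<Sum>j\<in>T. f (i, j))" for f :: "'s \<times> 't \<Rightarrow> real"
    by (simp add: sum.cartesian_product)
  \<comment> \<open>First shift: the factor 1 is written as the integral over \<open>h\<close> of
    the Cameron--Martin density for the translation by \<open>v X\<close>.\<close>
  have "(\<integral>\<^sup>+X. F X \<partial>?G) = (\<integral>\<^sup>+X. F X * (\<integral>\<^sup>+h. ennreal (exp (- ip X h - sq (v X) / 2)) \<partial>?H) \<partial>?G)"
  proof (intro nn_integral_cong)
    fix X
    show "F X = F X * (\<integral>\<^sup>+h. ennreal (exp (- ip X h - sq (v X) / 2)) \<partial>?H)"
      using nn_integral_gauss_shift[OF T, of "\<lambda>_. 1" "v X"]
      by (simp add: ip_def sq_def)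
  qed
  also have "\<dots> = (\<integral>\<^sup>+X. \<integral>\<^sup>+h. F X * ennreal (exp (- ip X h - sq (v X) / 2)) \<partial>?H \<partial>?G)"
    by (intro nn_integral_cong nn_integral_cmult[symmetric]) (simp add: ip_def)
  also have "\<dots> = (\<integral>\<^sup>+h. \<integral>\<^sup>+X. F X * ennreal (exp (- ip X h - sq (v X) / 2)) \<partial>?G \<partial>?H)"
  proof (rule P.Fubini'[symmetric])
    have "(\<lambda>x. F (fst x)) \<in> borel_measurable (?G \<Otimes>\<^sub>M ?H)"
      using measurable_compose[OF measurable_fst F] .
    moreover have "(\<lambda>x. sq (v (fst x))) \<in> borel_measurable (?G \<Otimes>\<^sub>M ?H)"
      using measurable_compose[OF measurable_fst sq1] .
    moreover have "(\<lambda>x. ip (fst x) (snd x)) \<in> borel_measurable (?G \<Otimes>\<^sub>M ?H)"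
      using ip by (simp add: case_prod_beta')
    ultimately have "(\<lambda>x. F (fst x)) \<in> borel_measurable (?G \<Otimes>\<^sub>M ?H)"
      and "(\<lambda>x. - ip (fst x) (snd x) - sq (v (fst x)) / 2) \<in> borel_measurable (?G \<Otimes>\<^sub>M ?H)"
      by (simp_all add: borel_measurable_diff borel_measurable_divide borel_measurable_uminus)
    moreover from measurable_compose[OF this(2), of "\<lambda>t. ennreal (exp t)" borel]
    have "(\<lambda>x. ennreal (exp (- ip (fst x) (snd x) - sq (v (fst x)) / 2))) \<in> borel_measurable (?G \<Otimes>\<^sub>M ?H)"
      by simp
    ultimately show "(\<lambda>(X, h). F X * ennreal (exp (- ip X h - sq (v X) / 2))) \<in> borel_measurable (?G \<Otimes>\<^sub>M ?H)"
      unfolding case_prod_beta' by (intro borel_measurable_times_ennreal)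
  qed
  \<comment> \<open>Second shift: for fixed \<open>h\<close>, the matrix \<open>X\<close> is
    translated by minus the outer product of \<open>u\<close> and \<open>h\<close>. As
    \<open>u\<close> has norm one, the exponents combine to
    \<open>ip X h - sq (v X) / 2\<close>.\<close>
  also have "\<dots> = (\<integral>\<^sup>+h. \<integral>\<^sup>+X. F (A X h) * ennreal (exp (ip X h - sq (v X) / 2)) \<partial>?G \<partial>?H)"
  proof (rule nn_integral_cong)
    fix h assume h: "h \<in> space ?H"
    let ?c = "\<lambda>(i, j). - u i * h j"
    have m: "(\<lambda>X. F X * ennreal (exp (- ip X h - sq (v X) / 2))) \<in> borel_measurable ?G"
      unfolding ip_def using F by measurable
    have 1: "(\<lambda>x\<in>S \<times> T. X x + ?c x) = A X h" for X
      by (auto simp: A_def fun_eq_iff)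
    have 2: "dot (S \<times> T) ?c X = - ip X h" for X
      unfolding prod ip_def v_def
      by (subst sum.swap) (simp add: sum_distrib_right sum_distrib_left sum_negf mult_ac)
    have 3: "sq_sum (S \<times> T) ?c = sq h"
      unfolding prod by (simp add: power_mult_distrib sum_distrib_left[symmetric] sum_distrib_right[symmetric] u sq_def)
    have "(\<integral>\<^sup>+X. F X * ennreal (exp (- ip X h - sq (v X) / 2)) \<partial>?G) =
      (\<integral>\<^sup>+X. F (A X h) * ennreal (exp (- ip (A X h) h - sq (v (A X h)) / 2)) * ennreal (exp (ip X h - sq h / 2)) \<partial>?G)"
      using nn_integral_gauss_shift[OF finite_cartesian_product[OF S T] m, of ?c]
      by (simp only: 1 2 3) simp
    also have "\<dots> = (\<integral>\<^sup>+X. F (A X h) * ennreal (exp (ip X h - sq (v X) / 2)) \<partial>?G)"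
    proof (intro nn_integral_cong)
      fix X
      have "- ip (A X h) h - sq (v (A X h)) / 2 + (ip X h - sq h / 2) = ip X h - sq (v X) / 2"
        unfolding ipA sqA by (simp add: field_simps)
      then have "exp (- ip (A X h) h - sq (v (A X h)) / 2) * exp (ip X h - sq h / 2) = exp (ip X h - sq (v X) / 2)"
        by (simp only: exp_add[symmetric])
      then show "F (A X h) * ennreal (exp (- ip (A X h) h - sq (v (A X h)) / 2)) * ennreal (exp (ip X h - sq h / 2)) =
        F (A X h) * ennreal (exp (ip X h - sq (v X) / 2))"
        by (simp only: mult.assoc ennreal_mult'[symmetric] exp_ge_zero)
    qed
    finally show "(\<integral>\<^sup>+X. F X * ennreal (exp (- ip X h - sq (v X) / 2)) \<partial>?G) =
      (\<integral>\<^sup>+X. F (A X h) * ennreal (exp (ip X h - sq (v X) / 2)) \<partial>?G)" .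
  qed
  also have "\<dots> = (\<integral>\<^sup>+X. \<integral>\<^sup>+h. F (A X h) * ennreal (exp (ip X h - sq (v X) / 2)) \<partial>?H \<partial>?G)"
    by (rule P.Fubini') measurable
  \<comment> \<open>Third shift: for fixed \<open>X\<close>, \<open>h\<close> becomes
    \<open>g + v X\<close>. All exponential factors cancel, and the component of \<open>X\<close>
    along \<open>u\<close> has been exchanged for \<open>- g\<close>.\<close>
  also have "\<dots> = (\<integral>\<^sup>+X. \<integral>\<^sup>+g. F (A X (\<lambda>j\<in>T. g j + v X j)) \<partial>?H \<partial>?G)"
  proof (rule nn_integral_cong)
    fix X assume X: "X \<in> space ?G"
    have m1: "(\<lambda>g. F (A X g)) \<in> borel_measurable ?H"
      using measurable_compose[OF measurable_Pair1'[OF X] FA] by simp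
    have m2: "(\<lambda>g. F (A X g) * ennreal (exp (ip X g - sq (v X) / 2))) \<in> borel_measurable ?H"
      unfolding ip_def using m1 by measurable
    have "(\<integral>\<^sup>+h. F (A X h) * ennreal (exp (ip X h - sq (v X) / 2)) \<partial>?H) =
      (\<integral>\<^sup>+g. F (A X (\<lambda>j\<in>T. g j + v X j)) * ennreal (exp (ip X (\<lambda>j\<in>T. g j + v X j) - sq (v X) / 2)) *
        ennreal (exp (- ip X g - sq (v X) / 2)) \<partial>?H)"
      using nn_integral_gauss_shift[OF T m2, of "v X"] by (simp add: ip_def sq_def)
    also have "\<dots> = (\<integral>\<^sup>+g. F (A X (\<lambda>j\<in>T. g j + v X j)) \<partial>?H)"
    proof (intro nn_integral_cong)
      fix g
      have "ip X (\<lambda>j\<in>T. g j + v X j) = ip X g + sq (v X)"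
        by (simp add: ip_def sq_def algebra_simps sum.distrib power2_eq_square)
      then show "F (A X (\<lambda>j\<in>T. g j + v X j)) * ennreal (exp (ip X (\<lambda>j\<in>T. g j + v X j) - sq (v X) / 2)) *
        ennreal (exp (- ip X g - sq (v X) / 2)) = F (A X (\<lambda>j\<in>T. g j + v X j))"
        by (simp add: mult.assoc ennreal_mult'[symmetric] exp_add[symmetric])
    qed
    finally show "(\<integral>\<^sup>+h. F (A X h) * ennreal (exp (ip X h - sq (v X) / 2)) \<partial>?H) =
      (\<integral>\<^sup>+g. F (A X (\<lambda>j\<in>T. g j + v X j)) \<partial>?H)" .
  qed
  also have "\<dots> = (\<integral>\<^sup>+X. \<integral>\<^sup>+g. F (\<lambda>(i, j)\<in>S \<times> T. X (i, j) - u i * (g j + (\<Sum>l\<in>S. u l * X (l, j)))) \<partial>?H \<partial>?G)"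
    by (intro nn_integral_cong arg_cong[where f = F]) (auto simp: A_def v_def fun_eq_iff)
  finally show ?thesis .
qed

section \<open>Orthonormal systems in finite dimension\<close>

text \<open>Fewer than \<open>d\<close> linear conditions on \<open>d\<close> unknowns: the vectors
  of \<open>F\<close>, padded by zero rows, form a square matrix whose last row vanishes, and a
  kernel vector is normalised.\<close>

lemma ex_orthogonal_unit:
  fixes F :: "(nat \<Rightarrow> real) set"
  assumes F: "finite F" "card F < d"
  shows "\<exists>w. sq_sum {..<d} w = 1 \<and> (\<forall>f\<in>F. (dot {..<d} f w) = 0)"
proof -
  obtain h where h: "bij_betw h {0..<card F} F"
    using ex_bij_betw_nat_finite[OF F(1)] by auto
  define M where "M = mat d d (\<lambda>(i, j). if i < card F then h i j else 0)"
  have M: "M \<in> carrier_mat d d" by (simp add: M_def)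
  have "det M = 0"
  proof -
    have "det (mat\<^sub>r d d (\<lambda>i. if i = d - 1 then 0\<^sub>v d else row M i)) = 0"
      using F(2) M by (intro det_row_0) (auto simp: row_carrier_vec)
    moreover have "mat\<^sub>r d d (\<lambda>i. if i = d - 1 then 0\<^sub>v d else row M i) = M"
      using F(2) by (intro eq_matI) (auto simp: M_def mat_of_rows_def)
    ultimately show ?thesis by simp
  qed
  then obtain v where v: "v \<in> carrier_vec d" "v \<noteq> 0\<^sub>v d" "M *\<^sub>v v = 0\<^sub>v d"
    using det_0_iff_vec_prod_zero[OF M] by auto
  define c where "c = (\<Sum>j<d. (v $ j)\<^sup>2)"
  obtain j0 where j0: "j0 < d" "v $ j0 \<noteq> 0"
    using v(1,2) by (metis carrier_vecD eq_vecI index_zero_vec(1,2))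
  have c: "c > 0"
    unfolding c_def by (rule sum_pos2[of _ j0]) (use j0 in auto)
  define w where "w j = v $ j / sqrt c" for j
  have "sq_sum {..<d} w = (\<Sum>j<d. (v $ j)\<^sup>2) / c"
    using c by (simp add: w_def power_divide sum_divide_distrib)
  then have "sq_sum {..<d} w = 1"
    using c by (simp add: c_def)
  moreover have "dot {..<d} f w = 0" if "f \<in> F" for f
  proof -
    obtain i where i: "i < card F" "h i = f"
      using bij_betw_imp_surj_on[OF h] \<open>f \<in> F\<close> by (metis atLeastLessThan_iff imageE)
    have "(M *\<^sub>v v) $ i = (\<Sum>j<d. f j * v $ j)"
      using i F(2) v(1) by (auto simp: M_def scalar_prod_def lessThan_atLeast0 intro!: sum.cong)
    then have "(\<Sum>j<d. f j * v $ j) = 0"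
      using v(3) i F(2) by simp
    then show ?thesis
      by (simp add: w_def sum_divide_distrib[symmetric])
  qed
  ultimately show ?thesis by blast
qed

lemma ex_orthonormal_orthogonal:
  fixes F :: "(nat \<Rightarrow> real) set"
  assumes F: "finite F" "card F + n \<le> d"
  shows "\<exists>w. (\<forall>a<n. \<forall>b<n. dot {..<d} (w a) (w b) = (if a = b then 1 else 0)) \<and>
    (\<forall>a<n. \<forall>f\<in>F. (dot {..<d} (w a) f) = 0)"
  using assms(2)
proof (induction n)
  case 0
  show ?case by simp
next
  case (Suc n)
  then have "\<exists>w. (\<forall>a<n. \<forall>b<n. dot {..<d} (w a) (w b) = (if a = b then 1 else 0)) \<and>
    (\<forall>a<n. \<forall>f\<in>F. (dot {..<d} (w a) f) = 0)"
    by simp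
  then obtain w where w: "\<And>a b. a < n \<Longrightarrow> b < n \<Longrightarrow> dot {..<d} (w a) (w b) = (if a = b then 1 else 0)"
    "\<And>a f. a < n \<Longrightarrow> f \<in> F \<Longrightarrow> dot {..<d} (w a) f = 0"
    by blast
  have "card (F \<union> w ` {..<n}) \<le> card F + n"
    by (rule order.trans[OF card_Un_le]) (simp add: card_image_le[of "{..<n}" w, simplified])
  then have "card (F \<union> w ` {..<n}) < d"
    using Suc.prems by simp
  then obtain x where x: "sq_sum {..<d} x = 1" "\<And>f. f \<in> F \<union> w ` {..<n} \<Longrightarrow> dot {..<d} f x = 0"
    using ex_orthogonal_unit[of "F \<union> w ` {..<n}" d] F(1) by auto
  let ?w = "w(n := x)"
  have "dot {..<d} (?w a) (?w b) = (if a = b then 1 else 0)" if "a < Suc n" "b < Suc n" for a b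
    using that w(1)[of a b] x(1) x(2)[of "w a"] x(2)[of "w b"]
    by (auto simp: less_Suc_eq power2_eq_square mult.commute)
  moreover have "dot {..<d} (?w a) f = 0" if "a < Suc n" "f \<in> F" for a f
    using that w(2)[of a f] x(2)[of f] by (auto simp: less_Suc_eq mult.commute)
  ultimately show ?case by blast
qed

lemma bessel_inequality:
  fixes w :: "'j \<Rightarrow> 'i \<Rightarrow> real"
  assumes J: "finite J"
    and orth: "\<And>a b. a \<in> J \<Longrightarrow> b \<in> J \<Longrightarrow> dot I (w a) (w b) = (if a = b then 1 else 0)"
  shows "(\<Sum>a\<in>J. (dot I (w a) x)\<^sup>2) \<le> sq_sum I x"
proof -
  let ?h = "\<lambda>a. \<Sum>i\<in>I. w a i * x i"
  have "0 \<le> (\<Sum>i\<in>I. (x i - (\<Sum>a\<in>J. ?h a * w a i))\<^sup>2)"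
    by (simp add: sum_nonneg)
  also have "\<dots> = sq_sum I x + (\<Sum>i\<in>I. (\<Sum>a\<in>J. ?h a * w a i)\<^sup>2)
      - 2 * (\<Sum>i\<in>I. \<Sum>a\<in>J. ?h a * (w a i * x i))"
    by (simp add: power2_diff sum.distrib sum_subtractf sum_distrib_left sum_distrib_right mult_ac)
  also have "(\<Sum>i\<in>I. \<Sum>a\<in>J. ?h a * (w a i * x i)) = sq_sum J ?h"
    by (subst sum.swap) (simp add: sum_distrib_left[symmetric] power2_eq_square)
  also have "(\<Sum>i\<in>I. (\<Sum>a\<in>J. ?h a * w a i)\<^sup>2) = sq_sum J ?h"
    by (rule sum_square_orthonormal[OF J orth])
  finally show ?thesis by simp
qed

section \<open>The norm of a Gaussian matrix\<close>

text \<open>An exponential majorant of the norm of a Gaussian matrix: averaging the normalised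
  exponential of the bilinear form over Gaussian test vectors costs only a factor \<open>sqrt 2\<close>
  compared to the sharp bound on the norm, and needs no net argument.\<close>

abbreviation norm_mgf_integrand ::
    "'s set \<Rightarrow> 't set \<Rightarrow> 'a set \<Rightarrow> ('a \<Rightarrow> 's \<Rightarrow> real) \<Rightarrow> real \<Rightarrow> ('s \<times> 't \<Rightarrow> real) \<Rightarrow>
      ('a \<Rightarrow> real) \<Rightarrow> ('t \<Rightarrow> real) \<Rightarrow> ennreal" where
  "norm_mgf_integrand S T J W \<mu> X \<xi> y \<equiv> ennreal (exp (
     \<mu> * (\<Sum>(i, j)\<in>S \<times> T. (\<Sum>a\<in>J. \<xi> a * W a i) * y j * X (i, j))
     - \<mu>\<^sup>2 * sq_sum J \<xi> * sq_sum T y / 2))"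

definition norm_mgf ::
    "'s set \<Rightarrow> 't set \<Rightarrow> 'a set \<Rightarrow> ('a \<Rightarrow> 's \<Rightarrow> real) \<Rightarrow> real \<Rightarrow> ('s \<times> 't \<Rightarrow> real) \<Rightarrow> ennreal" where
  "norm_mgf S T J W \<mu> X = (\<integral>\<^sup>+\<xi>. \<integral>\<^sup>+y. norm_mgf_integrand S T J W \<mu> X \<xi> y \<partial>gauss T \<partial>gauss J)"

lemma measurable_norm_mgf_integrand:
  assumes "finite S" "finite T" "finite J"
  shows "(\<lambda>((X, \<xi>), y). norm_mgf_integrand S T J W \<mu> X \<xi> y)
    \<in> borel_measurable ((gauss (S \<times> T) \<Otimes>\<^sub>M gauss J) \<Otimes>\<^sub>M gauss T)"
  unfolding sum.cartesian_product[symmetric] unfolding case_prod_beta' by measurable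

lemma measurable_norm_mgf_inner:
  assumes "finite S" "finite T" "finite J"
  shows "(\<lambda>(X, \<xi>). \<integral>\<^sup>+y. norm_mgf_integrand S T J W \<mu> X \<xi> y \<partial>gauss T)
    \<in> borel_measurable (gauss (S \<times> T) \<Otimes>\<^sub>M gauss J)"
proof -
  interpret sigma_finite_measure "gauss T" by (rule sigma_finite_gauss)
  show ?thesis
    using borel_measurable_nn_integral_fst[OF measurable_norm_mgf_integrand[OF assms, of \<mu> W]]
    by (simp add: case_prod_beta')
qed

lemma measurable_norm_mgf:
  assumes "finite S" "finite T" "finite J"
  shows "norm_mgf S T J W \<mu> \<in> borel_measurable (gauss (S \<times> T))"
proof -
  interpret sigma_finite_measure "gauss J" by (rule sigma_finite_gauss)
  show ?thesis
    unfolding norm_mgf_def[abs_def]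
    using borel_measurable_nn_integral_fst[OF measurable_norm_mgf_inner[OF assms, of \<mu> W]]
    by simp
qed

text \<open>For fixed \<open>\<xi>\<close> and \<open>y\<close> the bilinear form is a centred
  Gaussian in \<open>X\<close>. Because the \<open>W a\<close> are orthonormal, its variance is
  exactly what the subtracted term normalises, so the inner integral over \<open>X\<close> is
  1.\<close>

lemma nn_integral_norm_mgf:
  fixes W :: "'a \<Rightarrow> 's \<Rightarrow> real" and S :: "'s set" and T :: "'t set"
  assumes fin: "finite S" "finite T" "finite J"
    and orth: "\<And>a b. a \<in> J \<Longrightarrow> b \<in> J \<Longrightarrow> dot S (W a) (W b) = (if a = b then 1 else 0)"
  shows "(\<integral>\<^sup>+X. norm_mgf S T J W \<mu> X \<partial>gauss (S \<times> T)) = 1"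
proof -
  let ?L = "\<lambda>\<xi> i. \<Sum>a\<in>J. \<xi> a * W a i"
  let ?Q = "\<lambda>\<xi> y. \<mu>\<^sup>2 * sq_sum J \<xi> * sq_sum T y / 2"
  let ?B = "\<lambda>X \<xi> y. \<mu> * (\<Sum>(i, j)\<in>S \<times> T. ?L \<xi> i * y j * X (i, j))"
  let ?f = "\<lambda>X \<xi> y. ennreal (exp (?B X \<xi> y - ?Q \<xi> y))"
  interpret P1: pair_sigma_finite "gauss (S \<times> T)" "gauss J" by (rule pair_sigma_finite_gauss)
  interpret P2: pair_sigma_finite "gauss (S \<times> T)" "gauss T" by (rule pair_sigma_finite_gauss)
  have "(\<integral>\<^sup>+X. norm_mgf S T J W \<mu> X \<partial>gauss (S \<times> T)) =
     (\<integral>\<^sup>+\<xi>. \<integral>\<^sup>+X. \<integral>\<^sup>+y. ?f X \<xi> y \<partial>gauss T \<partial>gauss (S \<times> T) \<partial>gauss J)"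
    unfolding norm_mgf_def by (rule P1.Fubini'[symmetric]) (rule measurable_norm_mgf_inner[OF fin])
  also have "\<dots> = (\<integral>\<^sup>+\<xi>. \<integral>\<^sup>+y. \<integral>\<^sup>+X. ?f X \<xi> y \<partial>gauss (S \<times> T) \<partial>gauss T \<partial>gauss J)"
  proof (rule nn_integral_cong)
    fix \<xi> assume "\<xi> \<in> space (gauss J)"
    show "(\<integral>\<^sup>+X. \<integral>\<^sup>+y. ?f X \<xi> y \<partial>gauss T \<partial>gauss (S \<times> T)) =
      (\<integral>\<^sup>+y. \<integral>\<^sup>+X. ?f X \<xi> y \<partial>gauss (S \<times> T) \<partial>gauss T)"
      by (rule P2.Fubini'[symmetric]) (use fin in \<open>unfold sum.cartesian_product[symmetric], unfold case_prod_beta', measurable\<close>)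
  qed
  also have "\<dots> = (\<integral>\<^sup>+\<xi>. \<integral>\<^sup>+y. 1 \<partial>gauss T \<partial>gauss J)"
  proof (intro nn_integral_cong)
    fix \<xi> :: "'a \<Rightarrow> real" and y :: "'t \<Rightarrow> real"
    let ?c = "\<lambda>(i, j). \<mu> * (?L \<xi> i * y j)"
    have B: "?B X \<xi> y = (dot (S \<times> T) ?c X)" for X
      by (simp add: sum_distrib_left case_prod_beta' mult_ac)
    have "sq_sum (S \<times> T) ?c = (\<Sum>i\<in>S. \<Sum>j\<in>T. \<mu>\<^sup>2 * ((?L \<xi> i)\<^sup>2 * (y j)\<^sup>2))"
      by (simp add: sum.cartesian_product case_prod_beta' power_mult_distrib)
    also have "\<dots> = \<mu>\<^sup>2 * ((\<Sum>i\<in>S. (?L \<xi> i)\<^sup>2) * sq_sum T y)"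
      by (simp only: sum_product) (simp only: sum_distrib_left)
    also have "\<dots> / 2 = ?Q \<xi> y"
      by (simp add: sum_square_orthonormal[OF fin(3) orth] mult.assoc)
    finally have c: "sq_sum (S \<times> T) ?c / 2 = ?Q \<xi> y" .
    have "(\<integral>\<^sup>+X. ?f X \<xi> y \<partial>gauss (S \<times> T)) =
       (\<integral>\<^sup>+X. ennreal (exp (- ?Q \<xi> y)) * ennreal (exp (dot (S \<times> T) ?c X)) \<partial>gauss (S \<times> T))"
      unfolding B by (intro nn_integral_cong) (simp only: ennreal_mult'[symmetric] exp_ge_zero exp_add[symmetric], simp)
    also have "\<dots> = ennreal (exp (- ?Q \<xi> y)) * (\<integral>\<^sup>+X. ennreal (exp (dot (S \<times> T) ?c X)) \<partial>gauss (S \<times> T))"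
      by (rule nn_integral_cmult) measurable
    also have "(\<integral>\<^sup>+X. ennreal (exp (dot (S \<times> T) ?c X)) \<partial>gauss (S \<times> T)) = ennreal (exp (?Q \<xi> y))"
      unfolding c[symmetric] by (rule nn_integral_gauss_exp_linear) (use fin in simp)
    also have "ennreal (exp (- ?Q \<xi> y)) * ennreal (exp (?Q \<xi> y)) = 1"
      by (simp only: ennreal_mult'[symmetric] exp_ge_zero exp_add[symmetric]) simp
    finally show "(\<integral>\<^sup>+X. ?f X \<xi> y \<partial>gauss (S \<times> T)) = 1" .
  qed
  also have "\<dots> = 1"
    by (simp)
  finally show ?thesis .
qed

text \<open>The Jensen bound is applied twice, moving \<open>y\<close> to
  \<open>sqrt \<beta> * v\<close> and then \<open>\<xi>\<close> to \<open>sqrt \<beta> * u\<close>,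
  which replaces the average by an exponential at one point. The exponent is positive once the form
  at \<open>u\<close>, \<open>v\<close> exceeds \<open>2 / \<mu>\<close>, that is,
  \<open>sqrt 2\<close> times the sum of the square roots of the two dimensions.\<close>

lemma norm_mgf_ge:
  fixes W :: "'a \<Rightarrow> 's \<Rightarrow> real" and u :: "'a \<Rightarrow> real" and v :: "'t \<Rightarrow> real"
  assumes fin: "finite S" "finite T" "finite J"
    and ab: "card J > 0" "card T > 0"
    and u: "sq_sum J u = 1" and v: "sq_sum T v = 1"
  defines "\<beta> \<equiv> sqrt (real (card J) * real (card T))"
    and "\<mu> \<equiv> sqrt 2 / (sqrt (real (card J)) + sqrt (real (card T)))"
  shows "ennreal (exp (\<mu> * \<beta> * (\<Sum>(i, j)\<in>S \<times> T. (\<Sum>a\<in>J. u a * W a i) * v j * X (i, j)) - 2 * \<beta>))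
    \<le> norm_mgf S T J W \<mu> X"
proof -
  let ?a = "real (card J)" and ?b = "real (card T)"
  let ?n = "\<lambda>\<xi>. \<Sum>a\<in>J. (\<xi> a)\<^sup>2"
  let ?L = "\<lambda>\<xi> i. \<Sum>a\<in>J. \<xi> a * W a i"
  let ?f = "\<lambda>\<xi> y. exp (\<mu> * (\<Sum>(i, j)\<in>S \<times> T. ?L \<xi> i * y j * X (i, j)) - \<mu>\<^sup>2 * ?n \<xi> * sq_sum T y / 2)"
  let ?A = "\<lambda>\<xi> j. \<mu> * (\<Sum>i\<in>S. ?L \<xi> i * X (i, j))"
  let ?C = "\<lambda>a. \<mu> * sqrt \<beta> * (\<Sum>(i, j)\<in>S \<times> T. W a i * v j * X (i, j))"
  let ?t = "\<Sum>(i, j)\<in>S \<times> T. ?L u i * v j * X (i, j)"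
  let ?B = "\<mu>\<^sup>2 * (\<beta> + ?b)"
  have \<beta>: "\<beta> > 0" using ab by (simp add: \<beta>_def)
  have bil: "\<mu> * (\<Sum>(i, j)\<in>S \<times> T. ?L \<xi> i * y j * X (i, j)) = (\<Sum>j\<in>T. ?A \<xi> j * y j)" for \<xi> y
  proof -
    have "(\<Sum>(i, j)\<in>S \<times> T. ?L \<xi> i * y j * X (i, j)) = (\<Sum>i\<in>S. \<Sum>j\<in>T. ?L \<xi> i * y j * X (i, j))"
      by (simp add: sum.cartesian_product)
    also have "\<dots> = (\<Sum>j\<in>T. \<Sum>i\<in>S. ?L \<xi> i * y j * X (i, j))"
      by (rule sum.swap)
    finally show ?thesis
      by (simp add: sum_distrib_left sum_distrib_right mult_ac)
  qed
  have bil2: "(\<Sum>(i, j)\<in>S \<times> T. ?L \<xi> i * y j * X (i, j)) = (\<Sum>a\<in>J. (\<Sum>(i, j)\<in>S \<times> T. W a i * y j * X (i, j)) * \<xi> a)" for \<xi> y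
    unfolding sum_distrib_right case_prod_beta' by (subst (2) sum.swap) (simp add: sum_distrib_left mult_ac)
  \<comment> \<open>The bound left by the shift in \<open>y\<close> is again the exponential of a
    linear form in \<open>\<xi>\<close> minus a multiple of its squared norm, so the same inequality
    applies a second time.\<close>
  have inner: "ennreal (exp (- \<beta> / 2)) * ennreal (exp (dot J ?C \<xi> - ?B * ?n \<xi> / 2)) \<le>
     (\<integral>\<^sup>+y. ennreal (?f \<xi> y) \<partial>gauss T)" for \<xi>
  proof -
    let ?w = "\<lambda>j. sqrt \<beta> * v j"
    have n0: "0 \<le> \<mu>\<^sup>2 * ?n \<xi>" by (simp add: sum_nonneg)
    have "(\<Sum>j\<in>T. ?A \<xi> j * ?w j) = sqrt \<beta> * (\<Sum>j\<in>T. ?A \<xi> j * v j)"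
      by (simp add: sum_distrib_left mult_ac)
    also have "\<dots> = sqrt \<beta> * (\<mu> * (\<Sum>a\<in>J. (\<Sum>(i, j)\<in>S \<times> T. W a i * v j * X (i, j)) * \<xi> a))"
      unfolding bil[symmetric] bil2 ..
    also have "\<dots> = dot J ?C \<xi>"
      by (simp add: sum_distrib_left mult_ac)
    finally have 1: "(\<Sum>j\<in>T. ?A \<xi> j * ?w j) = dot J ?C \<xi>" .
    have 2: "sq_sum T ?w = \<beta>"
      using \<beta> by (simp add: power_mult_distrib sum_distrib_left[symmetric] v)
    have "ennreal (exp (- \<beta> / 2)) * ennreal (exp (dot J ?C \<xi> - ?B * ?n \<xi> / 2)) =
      ennreal (exp ((\<Sum>j\<in>T. ?A \<xi> j * ?w j) - (1 + \<mu>\<^sup>2 * ?n \<xi>) * sq_sum T ?w / 2 - ?b * (\<mu>\<^sup>2 * ?n \<xi>) / 2))"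
    proof -
      have "- \<beta> / 2 + (dot J ?C \<xi> - ?B * ?n \<xi> / 2) =
        (dot J ?C \<xi>) - (1 + \<mu>\<^sup>2 * ?n \<xi>) * \<beta> / 2 - ?b * (\<mu>\<^sup>2 * ?n \<xi>) / 2"
        by (simp add: algebra_simps add_divide_distrib)
      then show ?thesis
        unfolding 1 2 by (simp only: ennreal_mult'[symmetric] exp_ge_zero exp_add[symmetric])
    qed
    also have "\<dots> \<le> (\<integral>\<^sup>+y. ennreal (exp ((\<Sum>j\<in>T. ?A \<xi> j * y j) - \<mu>\<^sup>2 * ?n \<xi> * sq_sum T y / 2)) \<partial>gauss T)"
      by (rule nn_integral_gauss_exp_quadratic_ge[OF fin(2) n0])
    finally show ?thesis
      unfolding bil .
  qed
  \<comment> \<open>With \<open>?a\<close>, \<open>?b\<close> the two dimensions, the shifts cost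
    \<open>\<beta>\<close> plus half of \<open>\<mu>^2 * (\<beta> + ?a) * (\<beta> + ?b)\<close> in
    the exponent. For \<open>\<beta> = sqrt (?a * ?b)\<close> the product of the brackets is
    \<open>\<beta>\<close> times the square of \<open>sqrt ?a + sqrt ?b\<close>, and
    \<open>\<mu>\<close> makes the second cost equal to the first.\<close>
  have opt: "\<mu>\<^sup>2 * ((\<beta> + ?a) * (\<beta> + ?b)) = 2 * \<beta>"
  proof -
    define x y where "x = sqrt ?a" and "y = sqrt ?b"
    have xy: "x > 0" "y > 0" "?a = x\<^sup>2" "?b = y\<^sup>2" "\<beta> = x * y"
      using ab by (auto simp: x_def y_def \<beta>_def real_sqrt_mult)
    have "\<mu>\<^sup>2 = 2 / (x + y)\<^sup>2"
      by (simp add: \<mu>_def x_def y_def power_divide)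
    moreover have "(\<beta> + ?a) * (\<beta> + ?b) = x * y * (x + y)\<^sup>2"
      unfolding xy by (simp add: power2_eq_square algebra_simps)
    moreover have "x + y \<noteq> 0" using xy by simp
    ultimately show ?thesis
      unfolding xy(5) by simp
  qed
  have B: "?B \<ge> 0" using \<beta> by simp
  let ?w = "\<lambda>a. sqrt \<beta> * u a"
  have 1: "dot J ?C ?w = \<mu> * \<beta> * ?t"
  proof -
    have "dot J ?C ?w = (sqrt \<beta> * sqrt \<beta>) * \<mu> * (\<Sum>a\<in>J. (\<Sum>(i, j)\<in>S \<times> T. W a i * v j * X (i, j)) * u a)"
      unfolding sum_distrib_left[of _ _ J] by (intro sum.cong) (simp_all add: mult_ac)
    then show ?thesis
      unfolding bil2[symmetric] using \<beta> by simp
  qed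
  have 2: "sq_sum J ?w = \<beta>"
    using \<beta> by (simp add: power_mult_distrib sum_distrib_left[symmetric] u)
  have "ennreal (exp (\<mu> * \<beta> * ?t - 2 * \<beta>)) =
    ennreal (exp (- \<beta> / 2)) * ennreal (exp (dot J ?C ?w - (1 + ?B) * sq_sum J ?w / 2 - ?a * ?B / 2))"
  proof -
    have "- \<beta> / 2 + (\<mu> * \<beta> * ?t - (1 + ?B) * \<beta> / 2 - ?a * ?B / 2) = \<mu> * \<beta> * ?t - \<beta> - \<mu>\<^sup>2 * ((\<beta> + ?a) * (\<beta> + ?b)) / 2"
      by (simp add: field_simps)
    then have "- \<beta> / 2 + (\<mu> * \<beta> * ?t - (1 + ?B) * \<beta> / 2 - ?a * ?B / 2) = \<mu> * \<beta> * ?t - 2 * \<beta>"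
      unfolding opt by simp
    then show ?thesis
      unfolding 1 2 by (simp only: ennreal_mult'[symmetric] exp_ge_zero exp_add[symmetric])
  qed
  also have "\<dots> \<le> ennreal (exp (- \<beta> / 2)) *
     (\<integral>\<^sup>+\<xi>. ennreal (exp (dot J ?C \<xi> - ?B * ?n \<xi> / 2)) \<partial>gauss J)"
    by (intro mult_left_mono nn_integral_gauss_exp_quadratic_ge[OF fin(3) B]) auto
  also have "\<dots> = (\<integral>\<^sup>+\<xi>. ennreal (exp (- \<beta> / 2)) * ennreal (exp (dot J ?C \<xi> - ?B * ?n \<xi> / 2)) \<partial>gauss J)"
    by (rule nn_integral_cmult[symmetric]) measurable
  also have "\<dots> \<le> norm_mgf S T J W \<mu> X"
    unfolding norm_mgf_def by (intro nn_integral_mono inner)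
  finally show ?thesis .
qed

section \<open>The least singular value of a Gaussian matrix\<close>

text \<open>Entry \<open>j\<close> of the row vector z^T G, where G consists of the \<open>k\<close>
  rows \<open>W a\<close> multiplied by \<open>X\<close>.\<close>

definition lin_comb :: "'s set \<Rightarrow> nat \<Rightarrow> (nat \<Rightarrow> 's \<Rightarrow> real) \<Rightarrow> ('s \<times> nat \<Rightarrow> real) \<Rightarrow> (nat \<Rightarrow> real) \<Rightarrow> nat \<Rightarrow> real" where
  "lin_comb S k W X z j = (\<Sum>i\<in>S. (\<Sum>a<k. z a * W a i) * X (i, j))"

lemma lin_comb_alt: "lin_comb S k W X z j = (\<Sum>a<k. z a * (\<Sum>i\<in>S. W a i * X (i, j)))"
  unfolding lin_comb_def sum_distrib_right sum_distrib_left
  by (subst sum.swap) (simp add: mult_ac)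

text \<open>Test vectors are rational so that the supremum below is countable, hence measurable.\<close>
definition rat_vec :: "rat list \<Rightarrow> nat \<Rightarrow> real" where
  "rat_vec l a = of_rat (l ! a)"

text \<open>With \<open>G\<close> the \<open>k \<times> d\<close> matrix of entries \<open>\<Sum>i\<in>S. W a i * X (i, j)\<close>, the supremum is the \<open>r\<close>-th power of
  \<open>y\<^sup>T (G G\<^sup>T)\<inverse> y\<close>. For a fixed unit vector \<open>y\<close> that form is the inverse of a chi-square
  variable with \<open>d - k + 1\<close> degrees of freedom, whereas its average over Gaussian \<open>y\<close> controls the
  largest eigenvalue of \<open>(G G\<^sup>T)\<inverse>\<close>.\<close>
definition dual_ratio :: "'s set \<Rightarrow> nat \<Rightarrow> nat \<Rightarrow> (nat \<Rightarrow> 's \<Rightarrow> real) \<Rightarrow> nat \<Rightarrow> ('s \<times> nat \<Rightarrow> real) \<Rightarrow> (nat \<Rightarrow> real) \<Rightarrow> ennreal" where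
  "dual_ratio S d k W r X y = (SUP l. ennreal ((dot {..<k} (rat_vec l) y) ^ (2 * r)) *
     inverse (ennreal (\<Sum>j<d. (lin_comb S k W X (rat_vec l) j)\<^sup>2) ^ r))"

text \<open>Kept in the extended reals because it may be infinite when G is rank deficient;
  finiteness almost everywhere will follow from the bound on its mean.\<close>

definition inv_moment :: "'s set \<Rightarrow> nat \<Rightarrow> nat \<Rightarrow> (nat \<Rightarrow> 's \<Rightarrow> real) \<Rightarrow> nat \<Rightarrow> ('s \<times> nat \<Rightarrow> real) \<Rightarrow> ennreal" where
  "inv_moment S d k W r X = (\<integral>\<^sup>+y. dual_ratio S d k W r X y \<partial>gauss {..<k})"

lemma measurable_inverse_ennreal [measurable]: "(inverse :: ennreal \<Rightarrow> ennreal) \<in> borel_measurable borel"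
  by (intro borel_measurable_continuous_onI continuous_on_inverse_ennreal continuous_on_id)

lemma measurable_lin_comb:
  assumes "finite S" "j < d" and f: "f \<in> measurable M (gauss (S \<times> {..<d}))"
  shows "(\<lambda>x. lin_comb S k W (f x) z j) \<in> borel_measurable M"
  unfolding lin_comb_def
proof (intro borel_measurable_sum borel_measurable_times borel_measurable_const)
  fix i assume "i \<in> S"
  then have "(i, j) \<in> S \<times> {..<d}" using assms by simp
  then have "(\<lambda>X. X (i, j)) \<in> borel_measurable (gauss (S \<times> {..<d}))"
    by measurable
  from measurable_compose[OF f this] show "(\<lambda>x. f x (i, j)) \<in> borel_measurable M" .
qed

lemma measurable_dual_ratio:
  assumes "finite S"
  shows "(\<lambda>(X, y). dual_ratio S d k W r X y) \<in> borel_measurable (gauss (S \<times> {..<d}) \<Otimes>\<^sub>M gauss {..<k})"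
proof -
  have [measurable]: "(\<lambda>x. lin_comb S k W (fst x) z j) \<in> borel_measurable (gauss (S \<times> {..<d}) \<Otimes>\<^sub>M gauss {..<k})"
    if "j \<in> {..<d}" for z j
    using that assms by (intro measurable_lin_comb) auto
  show ?thesis
    unfolding dual_ratio_def case_prod_beta' by measurable
qed

lemma measurable_inv_moment:
  assumes "finite S"
  shows "inv_moment S d k W r \<in> borel_measurable (gauss (S \<times> {..<d}))"
proof -
  interpret sigma_finite_measure "gauss {..<k}" by (rule sigma_finite_gauss)
  show ?thesis
    unfolding inv_moment_def[abs_def]
    using borel_measurable_nn_integral_fst[OF measurable_dual_ratio[OF assms, of d k W r]]
    by simp
qed

lemma nn_integral_std_gauss_even_moment:
  "(\<integral>\<^sup>+t. ennreal ((c * t) ^ (2 * r)) \<partial>std_gauss) = ennreal (c ^ (2 * r) * (fact (2 * r) / (2 ^ r * fact r)))"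
proof -
  have "(\<integral>\<^sup>+t. ennreal ((c * t) ^ (2 * r)) \<partial>std_gauss) =
    (\<integral>\<^sup>+t. ennreal (std_normal_density t * (c * t) ^ (2 * r)) \<partial>lborel)"
    by (subst nn_integral_std_gauss) (auto simp: ennreal_mult')
  also have "\<dots> = ennreal (\<integral>t. std_normal_density t * (c * t) ^ (2 * r) \<partial>lborel)"
    using integrable_std_normal_moment[of "2 * r"]
    by (intro nn_integral_eq_integral)
       (auto simp: power_mult_distrib mult.left_commute[of _ "c ^ (2 * r)"] zero_le_even_power)
  also have "(\<integral>t. std_normal_density t * (c * t) ^ (2 * r) \<partial>lborel) = c ^ (2 * r) * (fact (2 * r) / (2 ^ r * fact r))"
    using integral_std_normal_moment_even[of r]
    by (simp add: power_mult_distrib mult.left_commute[of _ "c ^ (2 * r)"])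
  finally show ?thesis .
qed

text \<open>A single test vector bounds the supremum from below. The form \<open>y\<close> against
  \<open>rat_vec l\<close> is a centred normal variable, and its even moment brings in the double
  factorial \<open>fact (2 * r) / (2 ^ r * fact r)\<close>.\<close>

lemma inv_moment_ge:
  "ennreal ((\<Sum>a<k. (rat_vec l a)\<^sup>2) ^ r * (fact (2 * r) / (2 ^ r * fact r))) *
     inverse (ennreal (\<Sum>j<d. (lin_comb S k W X (rat_vec l) j)\<^sup>2) ^ r) \<le> inv_moment S d k W r X"
proof -
  let ?z = "rat_vec l"
  let ?q = "inverse (ennreal (\<Sum>j<d. (lin_comb S k W X ?z j)\<^sup>2) ^ r)"
  have "(\<integral>\<^sup>+y. ennreal ((dot {..<k} ?z y) ^ (2 * r)) \<partial>gauss {..<k}) =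
    (\<integral>\<^sup>+t. ennreal ((sqrt (sq_sum {..<k} ?z) * t) ^ (2 * r)) \<partial>std_gauss)"
    using nn_integral_gauss_linear[of "{..<k}" "\<lambda>x. ennreal (x ^ (2 * r))" 0 ?z] by simp
  also have "\<dots> = ennreal ((sq_sum {..<k} ?z) ^ r * (fact (2 * r) / (2 ^ r * fact r)))"
    by (simp only: nn_integral_std_gauss_even_moment) (simp add: power_mult sum_nonneg)
  finally have "ennreal ((sq_sum {..<k} ?z) ^ r * (fact (2 * r) / (2 ^ r * fact r))) * ?q =
    (\<integral>\<^sup>+y. ennreal ((dot {..<k} ?z y) ^ (2 * r)) * ?q \<partial>gauss {..<k})"
    by (subst nn_integral_multc) auto
  also have "\<dots> \<le> inv_moment S d k W r X"
    unfolding inv_moment_def dual_ratio_def by (intro nn_integral_mono SUP_upper) simp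
  finally show ?thesis .
qed

text \<open>The images of all \<open>t\<close> orthogonal to \<open>u\<close> span at most
  \<open>k - 1\<close> dimensions, so at least \<open>d - k + 1\<close> orthonormal directions avoid
  them.\<close>

lemma ex_orthonormal_orthogonal_lin_comb:
  fixes W :: "nat \<Rightarrow> 's \<Rightarrow> real"
  assumes u: "sq_sum {..<k} u = 1" and n: "k + n \<le> Suc d"
  shows "\<exists>w. (\<forall>a<n. \<forall>b<n. dot {..<d} (w a) (w b) = (if a = b then 1 else 0)) \<and>
     (\<forall>a<n. \<forall>t. dot {..<k} t u = 0 \<longrightarrow> (\<Sum>j<d. w a j * lin_comb S k W X t j) = 0)"
proof -
  define e where "e a j = (\<Sum>i\<in>S. W a i * X (i, j))" for a j
  have lc: "lin_comb S k W X t j = (\<Sum>a<k. t a * e a j)" for t j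
    by (simp add: lin_comb_alt e_def)
  obtain a0 where a0: "a0 < k" "u a0 \<noteq> 0"
    using u by (metis (mono_tags, lifting) lessThan_iff power_zero_numeral sum.neutral zero_neq_one)
  \<comment> \<open>Images of vectors that generate the orthogonal complement of \<open>u\<close>;
    dividing by the nonzero entry \<open>u a0\<close> is avoided by scaling everything with
    it.\<close>
  define f where "f a = (\<lambda>j. u a0 * e a j - u a * e a0 j)" for a
  let ?F = "f ` ({..<k} - {a0})"
  have "card ?F \<le> card ({..<k} - {a0})"
    by (rule card_image_le) simp
  also have "\<dots> = k - 1" using a0 by simp
  finally have "card ?F + n \<le> d"
    using a0 n by simp
  then obtain w where w: "\<forall>a<n. \<forall>b<n. dot {..<d} (w a) (w b) = (if a = b then 1 else 0)"
      "\<forall>a<n. \<forall>f\<in>?F. (dot {..<d} (w a) f) = 0"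
    using ex_orthonormal_orthogonal[of ?F n d] by blast
  have "(\<Sum>j<d. w b j * lin_comb S k W X t j) = 0" if b: "b < n" and t: "dot {..<k} t u = 0" for b t
  proof -
    have "u a0 * lin_comb S k W X t j = (\<Sum>a\<in>{..<k} - {a0}. t a * f a j)" for j
    proof -
      have t0: "t a0 * u a0 = - (\<Sum>a\<in>{..<k} - {a0}. t a * u a)"
        using t a0(1) by (simp add: sum.remove[of "{..<k}" a0])
      have "u a0 * lin_comb S k W X t j = t a0 * u a0 * e a0 j + (\<Sum>a\<in>{..<k} - {a0}. t a * (u a0 * e a j))"
        unfolding lc using a0(1) by (simp add: sum.remove[of "{..<k}" a0] distrib_left sum_distrib_left mult_ac)
      also have "\<dots> = (\<Sum>a\<in>{..<k} - {a0}. t a * f a j)"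
        unfolding t0 f_def by (simp add: sum_distrib_right sum_distrib_left sum_subtractf algebra_simps)
      finally show ?thesis .
    qed
    then have "(\<Sum>j<d. w b j * (u a0 * lin_comb S k W X t j)) = (\<Sum>j<d. w b j * (\<Sum>a\<in>{..<k} - {a0}. t a * f a j))"
      by simp
    also have "(\<Sum>j<d. w b j * (u a0 * lin_comb S k W X t j)) = u a0 * (\<Sum>j<d. w b j * lin_comb S k W X t j)"
      by (simp add: sum_distrib_left mult.left_commute)
    finally have "u a0 * (\<Sum>j<d. w b j * lin_comb S k W X t j) = (\<Sum>j<d. w b j * (\<Sum>a\<in>{..<k} - {a0}. t a * f a j))" .
    also have "\<dots> = (\<Sum>a\<in>{..<k} - {a0}. t a * dot {..<d} (w b) (f a))"
      unfolding sum_distrib_left by (subst sum.swap) (simp add: mult_ac)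
    also have "\<dots> = 0"
      using w(2) b by simp
    finally show ?thesis using a0(2) by simp
  qed
  with w(1) show ?thesis by blast
qed

lemma ennreal_inverse_antimono:
  fixes a b :: ennreal
  assumes "a \<le> b"
  shows "inverse b \<le> inverse a"
proof (cases "a = 0 \<or> b = \<infinity>")
  case False
  with assms have "a \<noteq> \<infinity>" by (auto simp: top_unique)
  with False obtain x y where xy: "a = ennreal x" "b = ennreal y" "x \<ge> 0" "y \<ge> 0"
    by (cases a; cases b) auto
  with False assms have "0 < x" "x \<le> y" by auto
  then show ?thesis
    by (simp add: xy inverse_ennreal ennreal_leI le_imp_inverse_le)
qed auto

text \<open>Cancels \<open>c\<close> between numerator and denominator. For \<open>c = 0\<close> the
  left side vanishes even if \<open>q = 0\<close>, since zero times infinity is zero in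
  \<open>ennreal\<close>.\<close>

lemma inverse_ennreal_mult_power_le:
  fixes c D q y :: real
  assumes D: "D \<ge> 0" and q: "c\<^sup>2 * D \<le> q"
  shows "ennreal ((y * c) ^ (2 * Suc n)) * inverse (ennreal q ^ Suc n) \<le>
    ennreal (y ^ (2 * Suc n)) * inverse (ennreal D ^ Suc n)"
proof (cases "c = 0")
  case False
  then have c: "c\<^sup>2 > 0" by simp
  have "inverse (ennreal q ^ Suc n) \<le> inverse (ennreal (c\<^sup>2 * D) ^ Suc n)"
    using q D by (intro ennreal_inverse_antimono power_mono ennreal_leI) auto
  also have "\<dots> = inverse (ennreal ((c\<^sup>2) ^ Suc n) * ennreal D ^ Suc n)"
    using c D by (simp add: ennreal_mult power_mult_distrib ennreal_power[symmetric] del: power_Suc)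
  also have "\<dots> = inverse (ennreal ((c\<^sup>2) ^ Suc n)) * inverse (ennreal D ^ Suc n)"
    using D by (intro ennreal_inverse_mult) (simp_all only: ennreal_power ennreal_less_top)
  finally have "ennreal ((y * c) ^ (2 * Suc n)) * inverse (ennreal q ^ Suc n) \<le>
    ennreal ((y * c) ^ (2 * Suc n)) * (inverse (ennreal ((c\<^sup>2) ^ Suc n)) * inverse (ennreal D ^ Suc n))"
    by (rule mult_left_mono) simp
  also have "\<dots> = ennreal ((y * c) ^ (2 * Suc n) * inverse ((c\<^sup>2) ^ Suc n)) * inverse (ennreal D ^ Suc n)"
    using c by (simp only: inverse_ennreal zero_less_power mult.assoc[symmetric]) (simp add: ennreal_mult'' del: power_Suc)
  also have "(y * c) ^ (2 * Suc n) * inverse ((c\<^sup>2) ^ Suc n) = y ^ (2 * Suc n)"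
    using False by (simp add: power_mult_distrib power_mult[symmetric] del: power_Suc)
  finally show ?thesis .
qed simp

text \<open>Once the component of \<open>X\<close> along the image of \<open>u = y / s\<close> has
  been resampled, each denominator in the supremum is at least \<open>c^2\<close> times the same sum
  of squares \<open>?D g\<close>, while the numerator is \<open>(s * c) ^ (2 * ?r)\<close>. So
  \<open>c\<close>, the only trace of the test vector, cancels and the supremum disappears. The
  directions \<open>w\<close> depend on \<open>X\<close> but not on \<open>g\<close>, hence
  \<open>?D g\<close> is chi-square for fixed \<open>X\<close>.\<close>

lemma nn_integral_dual_ratio_le:
  fixes W :: "nat \<Rightarrow> 's \<Rightarrow> real"
  assumes S: "finite S" and n: "k + 2 * Suc n \<le> d"
    and orth: "\<And>a b. a < k \<Longrightarrow> b < k \<Longrightarrow> dot S (W a) (W b) = (if a = b then 1 else 0)"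
    and y: "y \<in> space (gauss {..<k})"
  shows "(\<integral>\<^sup>+X. dual_ratio S d k W (Suc n) X y \<partial>gauss (S \<times> {..<d})) \<le>
    ennreal ((sq_sum {..<k} y) ^ Suc n / (2 ^ n * fact n))"
proof -
  let ?r = "Suc n"
  let ?G = "gauss (S \<times> {..<d})" and ?H = "gauss {..<d}"
  define s where "s = sqrt (sq_sum {..<k} y)"
  have s2: "s\<^sup>2 = sq_sum {..<k} y" by (simp add: s_def sum_nonneg)
  show ?thesis
  proof (cases "s = 0")
    case True
    then have "sq_sum {..<k} y = 0" using s2 by simp
    then have "y a = 0" if "a < k" for a
      using that by (simp add: sum_nonneg_eq_0_iff)
    then have "dual_ratio S d k W ?r X y = 0" for X
      by (simp add: dual_ratio_def)
    then show ?thesis by simp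
  next
    case False
    define u where "u a = y a / s" for a
    have yu: "y a = s * u a" for a using False by (simp add: u_def)
    have u: "sq_sum {..<k} u = 1"
      using False by (simp add: u_def power_divide sum_divide_distrib[symmetric] s2[symmetric])
    define uu where "uu i = (\<Sum>a<k. u a * W a i)" for i
    have uu: "sq_sum S uu = 1"
      unfolding uu_def using sum_square_orthonormal[where J = "{..<k}" and I = S and w = W and h = u] orth u by simp
    have meas: "(\<lambda>X. dual_ratio S d k W ?r X y) \<in> borel_measurable ?G"
      using measurable_compose[OF measurable_Pair2'[OF y] measurable_dual_ratio[OF S]] by simp
    have "(\<integral>\<^sup>+X. dual_ratio S d k W ?r X y \<partial>?G) =
      (\<integral>\<^sup>+X. \<integral>\<^sup>+g. dual_ratio S d k W ?r
         (\<lambda>(i, j)\<in>S \<times> {..<d}. X (i, j) - uu i * (g j + (\<Sum>l\<in>S. uu l * X (l, j)))) y \<partial>?H \<partial>?G)"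
      by (rule nn_integral_gauss_resample[OF S _ uu meas]) simp
    also have "\<dots> \<le> (\<integral>\<^sup>+X. ennreal (s ^ (2 * ?r)) * ennreal (1 / (2 ^ n * fact n)) \<partial>?G)"
    proof (rule nn_integral_mono)
      fix X :: "'s \<times> nat \<Rightarrow> real"
      \<comment> \<open>An inverse moment of order \<open>?r\<close> requires more than
        \<open>2 * ?r\<close> degrees of freedom; the assumption on \<open>d\<close> leaves room for
        exactly one more.\<close>
      let ?N = "2 * ?r + 1"
      have "k + ?N \<le> Suc d" using n by simp
      from ex_orthonormal_orthogonal_lin_comb[OF u this, of S W X]
      obtain w where w: "\<forall>a<?N. \<forall>b<?N. (dot {..<d} (w a) (w b)) = (if a = b then 1 else 0)"
        and w0: "\<forall>a<?N. \<forall>t. dot {..<k} t u = 0 \<longrightarrow> (\<Sum>j<d. w a j * lin_comb S k W X t j) = 0"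
        by blast
      let ?D = "\<lambda>g. \<Sum>a<?N. (dot {..<d} (w a) g)\<^sup>2"
      let ?X = "\<lambda>g. \<lambda>(i, j)\<in>S \<times> {..<d}. X (i, j) - uu i * (g j + (\<Sum>l\<in>S. uu l * X (l, j)))"
      have "(\<integral>\<^sup>+g. dual_ratio S d k W ?r (?X g) y \<partial>?H) \<le>
        (\<integral>\<^sup>+g. ennreal (s ^ (2 * ?r)) * inverse (ennreal (?D g) ^ ?r) \<partial>?H)"
      proof (rule nn_integral_mono)
        fix g :: "nat \<Rightarrow> real"
        show "dual_ratio S d k W ?r (?X g) y \<le> ennreal (s ^ (2 * ?r)) * inverse (ennreal (?D g) ^ ?r)"
          unfolding dual_ratio_def
        proof (rule SUP_least)
          fix l :: "rat list"
          let ?z = "rat_vec l"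
          define c where "c = dot {..<k} ?z u"
          define t where "t a = ?z a - c * u a" for a
          have tu: "dot {..<k} t u = 0"
            using u by (simp add: t_def left_diff_distrib sum_subtractf c_def[symmetric] power2_eq_square
                mult.assoc sum_distrib_left[symmetric])
          have zu: "(\<Sum>i\<in>S. (\<Sum>a<k. ?z a * W a i) * uu i) = c"
          proof -
            have "(\<Sum>i\<in>S. (\<Sum>a<k. ?z a * W a i) * uu i) = (\<Sum>i\<in>S. \<Sum>a<k. \<Sum>b<k. ?z a * u b * (W a i * W b i))"
              unfolding uu_def sum_product by (simp add: mult_ac)
            also have "\<dots> = (\<Sum>a<k. \<Sum>i\<in>S. \<Sum>b<k. ?z a * u b * (W a i * W b i))"
              by (rule sum.swap)
            also have "\<dots> = (\<Sum>a<k. \<Sum>b<k. ?z a * u b * dot S (W a) (W b))"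
              unfolding sum_distrib_left by (intro sum.cong refl sum.swap)
            also have "\<dots> = (\<Sum>a<k. \<Sum>b<k. if a = b then ?z a * u b else 0)"
              using orth by (intro sum.cong refl) auto
            finally show ?thesis
              by (simp add: c_def)
          qed
          \<comment> \<open>The test vector splits as \<open>t + c u\<close>. Resampling does not
            touch the image of \<open>t\<close>, which is orthogonal to \<open>u\<close>, and turns
            the image of \<open>c u\<close> into \<open>- c * g j\<close>.\<close>
          have lc: "lin_comb S k W (?X g) ?z j = lin_comb S k W X t j - c * g j" if j: "j < d" for j
          proof -
            let ?v = "\<Sum>l\<in>S. uu l * X (l, j)"
            have "lin_comb S k W (?X g) ?z j =
              (\<Sum>i\<in>S. (\<Sum>a<k. ?z a * W a i) * X (i, j) - (\<Sum>a<k. ?z a * W a i) * uu i * (g j + ?v))"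
              unfolding lin_comb_def using j by (intro sum.cong) (auto simp: algebra_simps)
            also have "\<dots> = lin_comb S k W X ?z j - c * (g j + ?v)"
              by (simp only: sum_subtractf sum_distrib_right[symmetric] zu lin_comb_def)
            also have "?v = lin_comb S k W X u j"
              by (simp add: lin_comb_def uu_def)
            also have "lin_comb S k W X ?z j - c * (g j + lin_comb S k W X u j) = lin_comb S k W X t j - c * g j"
              by (simp add: lin_comb_alt t_def left_diff_distrib sum_subtractf algebra_simps sum_distrib_left)
            finally show ?thesis .
          qed
          \<comment> \<open>The directions \<open>w a\<close> annihilate the image of
            \<open>t\<close>, so only the fresh Gaussian is seen; Bessel's inequality then discards
            all other directions.\<close>
          have "c\<^sup>2 * ?D g = (\<Sum>a<?N. (\<Sum>j<d. w a j * lin_comb S k W (?X g) ?z j)\<^sup>2)"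
          proof -
            have "(\<Sum>j<d. w a j * lin_comb S k W (?X g) ?z j) = - c * dot {..<d} (w a) g" if "a < ?N" for a
            proof -
              have "(\<Sum>j<d. w a j * lin_comb S k W (?X g) ?z j) = (\<Sum>j<d. w a j * (lin_comb S k W X t j - c * g j))"
                using lc by (intro sum.cong) auto
              also have "\<dots> = - c * dot {..<d} (w a) g"
                using w0 that tu by (simp add: right_diff_distrib sum_subtractf sum_distrib_left sum_negf mult_ac)
              finally show ?thesis .
            qed
            then have "(\<Sum>a<?N. (\<Sum>j<d. w a j * lin_comb S k W (?X g) ?z j)\<^sup>2) = (\<Sum>a<?N. c\<^sup>2 * (dot {..<d} (w a) g)\<^sup>2)"
              by (intro sum.cong) (auto simp: power_mult_distrib)
            then show ?thesis
              by (simp only: sum_distrib_left)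
          qed
          also have "\<dots> \<le> (\<Sum>j<d. (lin_comb S k W (?X g) ?z j)\<^sup>2)"
            using w by (intro bessel_inequality) auto
          finally have "c\<^sup>2 * ?D g \<le> (\<Sum>j<d. (lin_comb S k W (?X g) ?z j)\<^sup>2)" .
          moreover have "dot {..<k} ?z y = s * c"
            by (simp add: yu c_def sum_distrib_left mult_ac)
          ultimately show "ennreal ((dot {..<k} ?z y) ^ (2 * ?r)) *
              inverse (ennreal (\<Sum>j<d. (lin_comb S k W (?X g) ?z j)\<^sup>2) ^ ?r) \<le>
              ennreal (s ^ (2 * ?r)) * inverse (ennreal (?D g) ^ ?r)"
            by (simp only:) (intro inverse_ennreal_mult_power_le, simp_all add: sum_nonneg)
        qed
      qed
      also have "\<dots> = ennreal (s ^ (2 * ?r)) * (\<integral>\<^sup>+g. inverse (ennreal (?D g) ^ ?r) \<partial>?H)"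
        by (rule nn_integral_cmult) measurable
      also have "\<dots> \<le> ennreal (s ^ (2 * ?r)) * ennreal (1 / (2 ^ n * fact n))"
        using w by (intro mult_left_mono nn_integral_gauss_inverse_square_orthonormal) auto
      finally show "(\<integral>\<^sup>+g. dual_ratio S d k W ?r (?X g) y \<partial>?H) \<le> ennreal (s ^ (2 * ?r)) * ennreal (1 / (2 ^ n * fact n))" .
    qed
    also have "\<dots> = ennreal (s ^ (2 * ?r)) * ennreal (1 / (2 ^ n * fact n))"
      by (simp)
    also have "\<dots> = ennreal ((sq_sum {..<k} y) ^ ?r / (2 ^ n * fact n))"
      by (simp only: power_mult s2) (simp add: ennreal_mult'[symmetric] sum_nonneg)
    finally show ?thesis .
  qed
qed

lemma power_le_fact_exp:
  fixes x t :: real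
  assumes x: "x \<ge> 0" and t: "t > 0"
  shows "x ^ r \<le> fact r / t ^ r * exp (t * x)"
proof -
  have "(\<Sum>n\<in>{r}. (t * x) ^ n /\<^sub>R fact n) \<le> (\<Sum>n. (t * x) ^ n /\<^sub>R fact n)"
    using x t exp_converges[of "t * x"] by (intro sum_le_suminf) (auto simp: sums_iff)
  also have "\<dots> = exp (t * x)"
    using exp_converges[of "t * x"] by (simp add: sums_iff)
  finally have "(t * x) ^ r /\<^sub>R fact r \<le> exp (t * x)"
    by simp
  then show ?thesis
    using t by (simp add: field_simps power_mult_distrib)
qed

text \<open>An exponential-moment estimate: the power is bounded by one term of the series of
  \<open>exp (t * x)\<close>, whose Gaussian mean is explicit.\<close>

lemma nn_integral_gauss_norm_power_le:
  assumes k: "k \<ge> 1" and r: "r \<ge> 1"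
  shows "(\<integral>\<^sup>+y. ennreal ((sq_sum {..<k} y) ^ r) \<partial>gauss {..<k}) \<le>
    ennreal (fact r * (exp 1 * real (k + 2 * r) / real r) ^ r)"
proof -
  \<comment> \<open>The minimiser of \<open>(1 / t) ^ r * (1 / sqrt (1 - 2 * t)) ^ k\<close>. It
    gives \<open>1 / (1 - 2 * t) = 1 + 2 * r / k\<close>, and the \<open>k\<close>-th power of the
    root is then at most \<open>exp 1 ^ r\<close>.\<close>
  define t where "t = real r / real (k + 2 * r)"
  have t: "t > 0" "1 - 2 * t = real k / real (k + 2 * r)"
    using k r by (auto simp: t_def field_simps)
  have t2: "1 - 2 * t > 0" using t k by simp
  let ?c = "fact r / t ^ r"
  have c: "?c \<ge> 0" using t by simp
  have "(\<integral>\<^sup>+y. ennreal ((sq_sum {..<k} y) ^ r) \<partial>gauss {..<k}) \<le>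
    (\<integral>\<^sup>+y. ennreal ?c * ennreal (exp (- (- t) * sq_sum {..<k} y)) \<partial>gauss {..<k})"
    using power_le_fact_exp[OF _ t(1)] c
    by (intro nn_integral_mono) (simp add: ennreal_mult'[symmetric] sum_nonneg del: times_divide_eq_left)
  also have "\<dots> = ennreal ?c * (\<integral>\<^sup>+y. ennreal (exp (- (- t) * sq_sum {..<k} y)) \<partial>gauss {..<k})"
    by (rule nn_integral_cmult) measurable
  also have "(\<integral>\<^sup>+y. ennreal (exp (- (- t) * sq_sum {..<k} y)) \<partial>gauss {..<k}) =
     ennreal ((1 / sqrt (1 + 2 * - t)) ^ card {..<k})"
    using t2 by (intro nn_integral_gauss_exp_square) auto
  also have "ennreal ?c * \<dots> = ennreal (?c * (1 / sqrt (1 - 2 * t)) ^ k)"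
    using c by (simp add: ennreal_mult'[symmetric])
  also have "\<dots> \<le> ennreal (?c * exp 1 ^ r)"
  proof (intro ennreal_leI mult_left_mono c)
    have "1 / (1 - 2 * t) = 1 + 2 * (real r / real k)"
      unfolding t(2) using k by (simp add: field_simps)
    also have "\<dots> \<le> (1 + real r / real k)\<^sup>2"
      by (simp add: power2_eq_square algebra_simps)
    also have "\<dots> \<le> (exp (real r / real k))\<^sup>2"
      using exp_ge_add_one_self by (intro power_mono) auto
    finally have "sqrt (1 / (1 - 2 * t)) \<le> exp (real r / real k)"
      by (simp add: real_le_lsqrt)
    then have "(1 / sqrt (1 - 2 * t)) ^ k \<le> exp (real r / real k) ^ k"
      using t2 by (intro power_mono) (auto simp: real_sqrt_divide)
    also have "\<dots> = exp 1 ^ r"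
      using k by (simp add: exp_of_nat_mult[symmetric])
    finally show "(1 / sqrt (1 - 2 * t)) ^ k \<le> exp 1 ^ r" .
  qed
  also have "?c * exp 1 ^ r = fact r * (exp 1 * real (k + 2 * r) / real r) ^ r"
    using r k unfolding t_def by (simp add: power_divide power_mult_distrib)
  finally show ?thesis .
qed

lemma nn_integral_inv_moment_le:
  fixes W :: "nat \<Rightarrow> 's \<Rightarrow> real"
  assumes S: "finite S" and n: "k + 2 * Suc n \<le> d" and k: "k \<ge> 1"
    and orth: "\<And>a b. a < k \<Longrightarrow> b < k \<Longrightarrow> dot S (W a) (W b) = (if a = b then 1 else 0)"
  shows "(\<integral>\<^sup>+X. inv_moment S d k W (Suc n) X \<partial>gauss (S \<times> {..<d})) \<le>
    ennreal (fact (Suc n) * (exp 1 * real (k + 2 * Suc n) / real (Suc n)) ^ Suc n / (2 ^ n * fact n))"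
proof -
  interpret P: pair_sigma_finite "gauss (S \<times> {..<d})" "gauss {..<k}" by (rule pair_sigma_finite_gauss)
  let ?c = "1 / (2 ^ n * fact n) :: real"
  have "(\<integral>\<^sup>+X. inv_moment S d k W (Suc n) X \<partial>gauss (S \<times> {..<d})) =
    (\<integral>\<^sup>+y. \<integral>\<^sup>+X. dual_ratio S d k W (Suc n) X y \<partial>gauss (S \<times> {..<d}) \<partial>gauss {..<k})"
    unfolding inv_moment_def by (rule P.Fubini'[symmetric]) (rule measurable_dual_ratio[OF S])
  also have "\<dots> \<le> (\<integral>\<^sup>+y. ennreal ((sq_sum {..<k} y) ^ Suc n / (2 ^ n * fact n)) \<partial>gauss {..<k})"
    by (intro nn_integral_mono nn_integral_dual_ratio_le S n orth)
  also have "\<dots> = (\<integral>\<^sup>+y. ennreal ?c * ennreal ((sq_sum {..<k} y) ^ Suc n) \<partial>gauss {..<k})"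
    by (intro nn_integral_cong) (simp add: ennreal_mult'[symmetric] del: power_Suc)
  also have "\<dots> = ennreal ?c * (\<integral>\<^sup>+y. ennreal ((sq_sum {..<k} y) ^ Suc n) \<partial>gauss {..<k})"
    by (rule nn_integral_cmult) measurable
  also have "\<dots> \<le> ennreal ?c * ennreal (fact (Suc n) * (exp 1 * real (k + 2 * Suc n) / real (Suc n)) ^ Suc n)"
    by (intro mult_left_mono nn_integral_gauss_norm_power_le k) auto
  also have "\<dots> = ennreal (fact (Suc n) * (exp 1 * real (k + 2 * Suc n) / real (Suc n)) ^ Suc n / (2 ^ n * fact n))"
    by (subst ennreal_mult'[symmetric]) (simp_all del: power_Suc fact_Suc of_nat_Suc of_nat_add)
  finally show ?thesis .
qed

section \<open>Numerical comparison of the moment constants\<close>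

text \<open>A Stirling-type lower bound for the factorial; the induction step is
  \<open>(1 + 1 / r) ^ r \<le> exp 1\<close>.\<close>

lemma power_self_le_fact_exp:
  assumes "r \<ge> 1"
  shows "real r ^ r * exp 1 \<le> fact r * exp 1 ^ r"
  using assms
proof (induction r rule: dec_induct)
  case (step r)
  have "(1 + 1 / real r) ^ r \<le> exp 1"
    using exp_ge_one_plus_x_over_n_power_n[of r 1] step by simp
  then have "real r ^ r * (1 + 1 / real r) ^ r \<le> real r ^ r * exp 1"
    by (intro mult_left_mono) auto
  also have "real r ^ r * (1 + 1 / real r) ^ r = real (Suc r) ^ r"
    using step by (simp add: power_mult_distrib[symmetric] field_simps)
  also note step.IH
  finally have "real (Suc r) * exp 1 * real (Suc r) ^ r \<le> real (Suc r) * exp 1 * (fact r * exp 1 ^ r)"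
    by (intro mult_left_mono) auto
  then show ?case by (simp add: mult_ac)
qed simp

text \<open>The price of passing from \<open>r\<close> to \<open>Suc r\<close> in a denominator,
  needed because \<open>p + 1\<close> is controlled by \<open>2 * Suc r\<close> rather than by
  \<open>2 * r\<close>.\<close>

lemma Suc_power_double_le:
  assumes r: "r \<ge> 1"
  shows "2 * real r * real (Suc r) ^ (2 * r) \<le> 4 ^ r * exp 1 * real r ^ (2 * r)"
proof -
  let ?x = "(1 + 1 / real r) ^ (2 * r)"
  have "2 * real r * ?x \<le> 4 ^ r * exp 1"
  \<comment> \<open>The general argument uses \<open>6 * r \<le> 4 ^ r\<close>, which fails at 1;
    there \<open>2 \<le> exp 1\<close> is enough.\<close>
  proof (cases "r = 1")
    case True
    have "(2::real) \<le> exp 1" using exp_ge_add_one_self[of 1] by simp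
    then show ?thesis using True by simp
  next
    case False
    with r have r2: "r \<ge> 2" by simp
    have "(1 + 1 / real r) ^ r \<le> exp 1"
      using exp_ge_one_plus_x_over_n_power_n[of r 1] r by simp
    then have "((1 + 1 / real r) ^ r)\<^sup>2 \<le> (exp 1)\<^sup>2"
      by (intro power_mono) auto
    then have x: "?x \<le> exp 1 * exp 1"
      by (simp only: power_mult[symmetric] mult.commute[of r] power2_eq_square[of "exp 1"])
    have "6 * real r \<le> 4 ^ r"
      using r2 by (induction r rule: dec_induct) auto
    moreover have "exp 1 \<le> (3::real)" by (rule exp_le)
    then have "2 * real r * exp 1 \<le> 2 * real r * 3" by (intro mult_left_mono) auto
    ultimately have *: "2 * real r * exp 1 \<le> 4 ^ r" by simp
    have "2 * real r * ?x \<le> 2 * real r * (exp 1 * exp 1)"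
      using x by (intro mult_left_mono) auto
    also have "\<dots> = (2 * real r * exp 1) * exp 1" by simp
    also have "\<dots> \<le> 4 ^ r * exp 1" using * by (intro mult_right_mono) auto
    finally show ?thesis .
  qed
  then have "2 * real r * ?x * real r ^ (2 * r) \<le> 4 ^ r * exp 1 * real r ^ (2 * r)"
    by (intro mult_right_mono) auto
  moreover have "(1 + 1 / real r) * real r = real (Suc r)"
    using r by (simp add: field_simps)
  then have "?x * real r ^ (2 * r) = real (Suc r) ^ (2 * r)"
    by (simp only: power_mult_distrib[symmetric])
  ultimately show ?thesis by (simp only: mult.assoc)
qed

text \<open>In other words, the double factorial (2r-1)!! is at least r!, which lets the Gaussian
  moment of \<open>inv_moment_ge\<close> absorb a factorial.\<close>

lemma fact_square_le_fact_double: "2 ^ r * fact r * fact r \<le> (fact (2 * r) :: real)"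
proof (induction r)
  case (Suc r)
  have "2 ^ Suc r * fact (Suc r) * fact (Suc r) = (2 * (1 + real r)\<^sup>2) * (2 ^ r * fact r * fact r :: real)"
    by (simp add: power2_eq_square algebra_simps)
  also have "\<dots> \<le> ((2 + 2 * real r) * (1 + 2 * real r)) * fact (2 * r)"
  proof (rule mult_mono[OF _ Suc])
    have "(2 + 2 * real r) * (1 + 2 * real r) = 2 * (1 + real r)\<^sup>2 + 2 * real r * (1 + real r)"
      by (simp add: power2_eq_square algebra_simps)
    then show "2 * (1 + real r)\<^sup>2 \<le> (2 + 2 * real r) * (1 + 2 * real r)" by simp
  qed auto
  also have "\<dots> = fact (2 * Suc r)"
    by (simp add: algebra_simps)
  finally show ?case .
qed simp

text \<open>Brings the mean of the inverse moment into the shape (2r-1)!! times an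
  \<open>r\<close>-th power. The first factor cancels against \<open>inv_moment_ge\<close>, and the
  base of the second is the bound for the inverse square of the least singular value.\<close>

lemma inv_moment_constant_le:
  fixes k p :: nat
  assumes p: "p \<ge> 2" and k: "k \<ge> 1"
  defines "r \<equiv> p div 2"
  defines "n \<equiv> r - 1"
  shows "fact r * (exp 1 * real (k + 2 * r) / real r) ^ r / (2 ^ n * fact n)
    \<le> (fact (2 * r) / (2 ^ r * fact r)) * (8 * (exp 1)\<^sup>2 * real (k + p) / (real p + 1)\<^sup>2) ^ r"
proof -
  \<comment> \<open>Rounding in \<open>p div 2\<close> is harmless in both directions:
    \<open>2 * r \<le> p\<close> is used in the numerator and \<open>p + 1 \<le> 2 * Suc r\<close>
    in the denominator, where it contributes the factor 4 in 8.\<close>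
  have r: "r \<ge> 1" "2 * r \<le> p" "real p + 1 \<le> 2 * real (Suc r)" "r = Suc n"
    using p by (auto simp: r_def n_def)
  let ?e = "exp 1 :: real"
  have fr: "fact r = real r * fact n" by (simp add: r(4))
  have 1: "2 * real r * real (Suc r) ^ (2 * r) \<le> 4 ^ r * ?e * real r ^ (2 * r)"
    by (rule Suc_power_double_le[OF r(1)])
  have "4 ^ r * ?e * real r ^ (2 * r) = 4 ^ r * (real r ^ r * ?e) * real r ^ r"
    by (simp add: mult_2 power_add)
  with 1 have "2 * real r * real (Suc r) ^ (2 * r) \<le> 4 ^ r * (real r ^ r * ?e) * real r ^ r"
    by simp
  also have "\<dots> \<le> 4 ^ r * (fact r * ?e ^ r) * real r ^ r"
    using power_self_le_fact_exp[OF r(1)] by (intro mult_right_mono mult_left_mono) auto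
  also have "\<dots> = real r * (4 ^ r * ?e ^ r * fact n * real r ^ r)"
    by (simp add: fr)
  finally have "real r * (2 * real (Suc r) ^ (2 * r)) \<le> real r * (4 ^ r * ?e ^ r * fact n * real r ^ r)"
    by (simp only: mult.assoc mult.left_commute[of 2])
  then have "2 * real (Suc r) ^ (2 * r) \<le> 4 ^ r * ?e ^ r * fact n * real r ^ r"
    using r(1) by (subst (asm) mult_le_cancel_left_pos) auto
  also have "(4::real) ^ r = 2 * 2 ^ n * 2 ^ r"
    by (simp add: r(4) power_mult_distrib[symmetric])
  finally have 2: "real (Suc r) ^ (2 * r) \<le> (2 ^ n * fact n * real r ^ r) * (2 ^ r * ?e ^ r)"
    by (simp only: mult.assoc mult_le_cancel_left_pos[of 2] zero_less_numeral) (simp only: mult_ac)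
  have "(?e * real (k + 2 * r) / real r) ^ r / (2 ^ n * fact n) \<le> (?e * real (k + p) / real r) ^ r / (2 ^ n * fact n)"
    using r by (intro divide_right_mono power_mono mult_left_mono) auto
  also have "\<dots> \<le> (2 * ?e\<^sup>2 * real (k + p) / (real (Suc r))\<^sup>2) ^ r"
  proof -
    let ?D = "2 ^ n * fact n * real r ^ r" and ?S = "real (Suc r) ^ (2 * r)"
    have D: "?D > 0" "?S > 0" using r(1) by auto
    have "1 / ?D \<le> (2 ^ r * ?e ^ r) / ?S"
      using 2 D by (simp only: divide_le_eq pos_le_divide_eq mult_1 mult.commute times_divide_eq_left times_divide_eq_right if_True)
    then have "(?e ^ r * real (k + p) ^ r) * (1 / ?D) \<le> (?e ^ r * real (k + p) ^ r) * ((2 ^ r * ?e ^ r) / ?S)"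
      by (intro mult_left_mono) auto
    also have "(?e ^ r * real (k + p) ^ r) * (1 / ?D) = (?e * real (k + p) / real r) ^ r / (2 ^ n * fact n)"
      by (simp add: power_divide power_mult_distrib)
    also have "(?e ^ r * real (k + p) ^ r) * ((2 ^ r * ?e ^ r) / ?S) = (2 * ?e\<^sup>2 * real (k + p) / (real (Suc r))\<^sup>2) ^ r"
    proof -
      have "(?e\<^sup>2) ^ r = ?e ^ r * ?e ^ r" by (simp only: power2_eq_square power_mult_distrib)
      moreover have "((real (Suc r))\<^sup>2) ^ r = ?S" by (simp only: power_mult)
      ultimately show ?thesis by (simp only: power_divide power_mult_distrib) (simp only: mult_ac times_divide_eq_right times_divide_eq_left)
    qed
    finally show ?thesis .
  qed
  also have "\<dots> \<le> (8 * ?e\<^sup>2 * real (k + p) / (real p + 1)\<^sup>2) ^ r"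
  proof (intro power_mono)
    have "(real p + 1)\<^sup>2 \<le> (2 * real (Suc r))\<^sup>2"
      using r by (intro power_mono) auto
    then have "8 * ?e\<^sup>2 * real (k + p) / (2 * real (Suc r))\<^sup>2 \<le> 8 * ?e\<^sup>2 * real (k + p) / (real p + 1)\<^sup>2"
      by (intro divide_left_mono) (auto simp del: of_nat_Suc)
    then show "2 * ?e\<^sup>2 * real (k + p) / (real (Suc r))\<^sup>2 \<le> 8 * ?e\<^sup>2 * real (k + p) / (real p + 1)\<^sup>2"
      by (simp add: power_mult_distrib mult_ac del: of_nat_Suc)
  qed auto
  finally have 3: "(?e * real (k + 2 * r) / real r) ^ r / (2 ^ n * fact n) \<le> (8 * ?e\<^sup>2 * real (k + p) / (real p + 1)\<^sup>2) ^ r" .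
  have 4: "fact r \<le> fact (2 * r) / (2 ^ r * fact r :: real)"
    using fact_square_le_fact_double[of r] by (simp add: field_simps)
  have "fact r * ((?e * real (k + 2 * r) / real r) ^ r / (2 ^ n * fact n)) \<le>
     fact (2 * r) / (2 ^ r * fact r) * (8 * ?e\<^sup>2 * real (k + p) / (real p + 1)\<^sup>2) ^ r"
    using 3 4 by (intro mult_mono) auto
  then show ?thesis by simp
qed

section \<open>From moments to pointwise bounds and an integrable majorant\<close>

lemma enn2real_integral_bound:
  fixes f :: "'a \<Rightarrow> ennreal"
  assumes f: "f \<in> borel_measurable M" and le: "(\<integral>\<^sup>+x. f x \<partial>M) \<le> ennreal c" and c: "c \<ge> 0"
  shows "AE x in M. f x \<noteq> \<infinity>" "integrable M (\<lambda>x. enn2real (f x))" "(\<integral>x. enn2real (f x) \<partial>M) \<le> c"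
proof -
  have fin: "(\<integral>\<^sup>+x. f x \<partial>M) \<noteq> \<infinity>"
    using le by (auto simp: top_unique)
  show AE: "AE x in M. f x \<noteq> \<infinity>"
    by (rule nn_integral_PInf_AE[OF f fin])
  have eq: "(\<integral>\<^sup>+x. ennreal (enn2real (f x)) \<partial>M) = (\<integral>\<^sup>+x. f x \<partial>M)"
    using AE by (intro nn_integral_cong_AE) (auto simp: less_top)
  show int: "integrable M (\<lambda>x. enn2real (f x))"
    using f fin eq by (intro integrableI_nonneg) (auto simp: less_top)
  have "ennreal (\<integral>x. enn2real (f x) \<partial>M) \<le> ennreal c"
    using nn_integral_eq_integral[OF int] le eq by simp
  then show "(\<integral>x. enn2real (f x) \<partial>M) \<le> c"
    using c by (simp add: ennreal_le_iff)
qed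

lemma rat_vec_dense:
  fixes z :: "nat \<Rightarrow> real"
  assumes "e > 0"
  shows "\<exists>l. \<forall>a<k. \<bar>rat_vec l a - z a\<bar> < e"
proof -
  have "\<exists>q. \<bar>real_of_rat q - z a\<bar> < e" for a
  proof -
    obtain q where "z a < of_rat q" "of_rat q < z a + e"
      using of_rat_dense[of "z a" "z a + e"] assms by auto
    then show ?thesis by (intro exI[of _ q]) auto
  qed
  then obtain c where c: "\<And>a. \<bar>real_of_rat (c a) - z a\<bar> < e" by metis
  show ?thesis
    by (intro exI[of _ "map c [0..<k]"]) (simp add: rat_vec_def c)
qed

text \<open>The moment bounds the \<open>r\<close>-th power of the ratio of squared norms.
  Bernoulli's inequality replaces the \<open>r\<close>-th root by its tangent at
  \<open>g * K ^ r\<close>, so that \<open>c\<close> is affine in the moment and has mean at most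
  \<open>K\<close> as soon as the moment has mean at most \<open>g * K ^ r\<close>.\<close>

lemma norm_square_le_inv_moment:
  fixes W :: "nat \<Rightarrow> 's \<Rightarrow> real" and X :: "'s \<times> nat \<Rightarrow> real"
  assumes fin: "inv_moment S d k W r X \<noteq> \<infinity>" and r: "r \<ge> 1" and K: "K > 0"
  defines "g \<equiv> fact (2 * r) / (2 ^ r * fact r)"
  defines "c \<equiv> K * (1 + (enn2real (inv_moment S d k W r X) / (g * K ^ r) - 1) / real r)"
  shows "sq_sum {..<k} z \<le> c * (\<Sum>j<d. (lin_comb S k W X z j)\<^sup>2)"
proof -
  let ?q = "\<lambda>z. \<Sum>j<d. (lin_comb S k W X z j)\<^sup>2"
  define y where "y = enn2real (inv_moment S d k W r X)"
  have Y: "inv_moment S d k W r X = ennreal y" "y \<ge> 0"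
    using fin by (auto simp: y_def less_top)
  have g: "g > 0" by (simp add: g_def)
  define x where "x = y / (g * K ^ r)"
  have x: "x \<ge> 0" using Y g K by (simp add: x_def)
  have c: "c = K * (1 + (x - 1) / real r)" by (simp add: c_def x_def y_def)
  have x1: "(x - 1) / real r \<ge> - 1"
    using x r by (simp add: field_simps)
  then have c0: "c \<ge> 0" using K unfolding c by simp
  have cr: "y / g \<le> c ^ r"
  proof -
    have "x \<le> (1 + (x - 1) / real r) ^ r"
      using Bernoulli_inequality[OF x1, of r] r by simp
    then have "K ^ r * x \<le> c ^ r"
      unfolding c power_mult_distrib using K by (intro mult_left_mono) auto
    then show ?thesis
      using K g by (simp add: x_def)
  qed
  have rat: "(\<Sum>a<k. (rat_vec l a)\<^sup>2) \<le> c * ?q (rat_vec l)" for l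
  proof -
    define s where "s = (\<Sum>a<k. (rat_vec l a)\<^sup>2)"
    define q where "q = ?q (rat_vec l)"
    have s: "s \<ge> 0" and q: "q \<ge> 0" by (simp_all add: s_def q_def sum_nonneg)
    have le: "ennreal (s ^ r * g) * inverse (ennreal q ^ r) \<le> ennreal y"
      using inv_moment_ge[where k = k and l = l and r = r and S = S and W = W and X = X and d = d]
      unfolding s_def q_def g_def Y(1) .
    have "s ^ r \<le> (c * q) ^ r"
    proof (cases "q = 0")
      \<comment> \<open>A vanishing denominator has inverse infinity, so finiteness of the moment
        forces the numerator to vanish too.\<close>
      case True
      have "s ^ r * g = 0"
      proof (rule ccontr)
        assume "s ^ r * g \<noteq> 0"
        then have "ennreal (s ^ r * g) * inverse (ennreal q ^ r) = \<infinity>"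
          using True r s g by (simp add: ennreal_mult_top zero_power)
        with le show False by (simp add: top_unique)
      qed
      with g have "s ^ r = 0" by simp
      then show ?thesis using c0 q by simp
    next
      case False
      with q have q0: "q > 0" by simp
      then have "ennreal (s ^ r * g * inverse (q ^ r)) \<le> ennreal y"
        using le s g by (simp add: ennreal_power inverse_ennreal ennreal_mult'[symmetric])
      then have "s ^ r * g * inverse (q ^ r) \<le> y"
        using Y by (simp add: ennreal_le_iff)
      then have "s ^ r \<le> (y / g) * q ^ r"
        using q0 g by (simp add: field_simps)
      also have "\<dots> \<le> c ^ r * q ^ r"
        using cr q by (intro mult_right_mono) auto
      finally show ?thesis by (simp add: power_mult_distrib)
    qed
    then show ?thesis
      using r c0 q power_le_imp_le_base[of s "r - 1" "c * q"] by (simp add: s_def q_def)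
  qed
  \<comment> \<open>Both sides are continuous in the test vector, so rational vectors
    suffice.\<close>
  have "\<exists>l. \<forall>a<k. \<bar>rat_vec l a - z a\<bar> < 1 / real (Suc n)" for n
    by (rule rat_vec_dense) simp
  then obtain L where L: "\<And>n a. a < k \<Longrightarrow> \<bar>rat_vec (L n) a - z a\<bar> < 1 / real (Suc n)" by metis
  have lim: "(\<lambda>n. rat_vec (L n) a) \<longlonglongrightarrow> z a" if "a < k" for a
  proof (rule LIM_zero_cancel, rule tendsto_rabs_zero_cancel)
    show "(\<lambda>n. \<bar>rat_vec (L n) a - z a\<bar>) \<longlonglongrightarrow> 0"
      by (rule tendsto_sandwich[OF _ _ tendsto_const LIMSEQ_inverse_real_of_nat])
         (use L[OF that] in \<open>auto intro!: always_eventually less_imp_le simp: inverse_eq_divide\<close>)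
  qed
  show ?thesis
  proof (rule LIMSEQ_le)
    show "(\<lambda>n. \<Sum>a<k. (rat_vec (L n) a)\<^sup>2) \<longlonglongrightarrow> (sq_sum {..<k} z)"
      by (intro tendsto_sum tendsto_power lim) auto
    show "(\<lambda>n. c * ?q (rat_vec (L n))) \<longlonglongrightarrow> c * ?q z"
      unfolding lin_comb_def
      by (intro tendsto_sum tendsto_power tendsto_mult tendsto_const lim) auto
  qed (use rat in auto)
qed

text \<open>The majorant is affine in \<open>norm_mgf\<close>, which has mean 1 for orthonormal
  rows; its mean is then \<open>4 / \<mu>\<^sup>2\<close> times \<open>sq_sum T v\<close>.\<close>

lemma norm_square_le_norm_mgf:
  fixes W :: "'a \<Rightarrow> 's \<Rightarrow> real" and v :: "'t \<Rightarrow> real"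
  assumes fin: "finite S" "finite T" "finite J"
    and ab: "card J > 0" "card T > 0"
  defines "\<beta> \<equiv> sqrt (real (card J) * real (card T))"
    and "\<mu> \<equiv> sqrt 2 / (sqrt (real (card J)) + sqrt (real (card T)))"
  assumes Z: "norm_mgf S T J W \<mu> X \<noteq> \<infinity>"
  shows "(\<Sum>a\<in>J. (\<Sum>i\<in>S. W a i * (\<Sum>j\<in>T. X (i, j) * v j))\<^sup>2) \<le>
     4 / \<mu>\<^sup>2 * (1 + (enn2real (norm_mgf S T J W \<mu> X) - 1) / \<beta>) * sq_sum T v"
proof -
  define z where "z = enn2real (norm_mgf S T J W \<mu> X)"
  have z: "norm_mgf S T J W \<mu> X = ennreal z" "z \<ge> 0"
    using Z by (auto simp: z_def less_top)
  let ?h = "\<lambda>a. \<Sum>i\<in>S. W a i * (\<Sum>j\<in>T. X (i, j) * v j)"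
  have ab1: "real (card J) * real (card T) \<ge> 1"
  proof -
    have "1 \<le> card J * card T" using ab by simp
    then have "real 1 \<le> real (card J * card T)" by (rule of_nat_mono)
    then show ?thesis by simp
  qed
  then have \<beta>: "\<beta> \<ge> 1" by (simp add: \<beta>_def)
  have \<mu>: "\<mu> > 0" using ab by (simp add: \<mu>_def add_pos_pos)
  define hn where "hn = sqrt (sq_sum J ?h)"
  define vn where "vn = sqrt (sq_sum T v)"
  have hn: "hn\<^sup>2 = sq_sum J ?h" "hn \<ge> 0" and vn: "vn\<^sup>2 = sq_sum T v" "vn \<ge> 0"
    by (simp_all add: hn_def vn_def sum_nonneg)
  have nn: "0 \<le> 4 / \<mu>\<^sup>2 * (1 + (z - 1) / \<beta>)"
    using \<beta> z(2) by (simp add: field_simps)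
  show ?thesis
  proof (cases "hn = 0 \<or> vn = 0")
    case True
    have "hn = 0"
    proof (cases "vn = 0")
      case True
      then have "v j = 0" if "j \<in> T" for j
        using vn(1) that fin(2) by (simp add: sum_nonneg_eq_0_iff)
      then show ?thesis by (simp add: hn_def)
    qed (use True in simp)
    then have "sq_sum J ?h = 0" using hn(1) by simp
    moreover have "0 \<le> 4 / \<mu>\<^sup>2 * (1 + (z - 1) / \<beta>) * sq_sum T v"
      by (intro mult_nonneg_nonneg nn sum_nonneg) auto
    ultimately show ?thesis
      unfolding z_def by simp
  next
    case False
    with hn(2) vn(2) have pos: "hn > 0" "vn > 0" by auto
    \<comment> \<open>Testing with the normalised image and the normalised argument makes the
      bilinear form equal to the ratio of norms.\<close>
    define u where "u a = ?h a / hn" for a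
    define w where "w j = v j / vn" for j
    have u: "sq_sum J u = 1" and w: "sq_sum T w = 1"
      using pos by (simp_all add: u_def w_def power_divide sum_divide_distrib[symmetric] hn(1)[symmetric] vn(1)[symmetric])
    have "(\<Sum>(i, j)\<in>S \<times> T. (\<Sum>a\<in>J. u a * W a i) * w j * X (i, j)) = hn / vn"
    proof -
      have "(\<Sum>(i, j)\<in>S \<times> T. (\<Sum>a\<in>J. u a * W a i) * w j * X (i, j)) =
        (\<Sum>i\<in>S. \<Sum>j\<in>T. (\<Sum>a\<in>J. u a * W a i) * w j * X (i, j))"
        by (simp add: sum.cartesian_product)
      also have "\<dots> = (\<Sum>i\<in>S. (\<Sum>a\<in>J. u a * W a i) * (\<Sum>j\<in>T. X (i, j) * w j))"
        by (simp add: sum_distrib_left mult_ac)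
      also have "\<dots> = (\<Sum>i\<in>S. \<Sum>a\<in>J. u a * (W a i * (\<Sum>j\<in>T. X (i, j) * w j)))"
        by (simp add: sum_distrib_right mult.assoc)
      also have "\<dots> = (\<Sum>a\<in>J. u a * (\<Sum>i\<in>S. W a i * (\<Sum>j\<in>T. X (i, j) * w j)))"
        by (subst sum.swap) (simp add: sum_distrib_left)
      also have "\<dots> = (\<Sum>a\<in>J. u a * (?h a / vn))"
      proof -
        have "(\<Sum>j\<in>T. X (i, j) * w j) = (\<Sum>j\<in>T. X (i, j) * v j) / vn" for i
          by (simp add: w_def sum_divide_distrib)
        then show ?thesis
          by (simp only: times_divide_eq_right sum_divide_distrib[symmetric])
      qed
      also have "\<dots> = sq_sum J ?h / (hn * vn)"
        unfolding u_def sum_divide_distrib[of "\<lambda>a. (?h a)\<^sup>2"] by (simp add: power2_eq_square)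
      also have "\<dots> = hn / vn"
        unfolding hn(1)[symmetric] using pos by (simp add: power2_eq_square)
      finally show ?thesis .
    qed
    with norm_mgf_ge[OF fin ab u w, of W X] have "ennreal (exp (\<mu> * \<beta> * (hn / vn) - 2 * \<beta>)) \<le> ennreal z"
      unfolding z(1)[symmetric] \<beta>_def \<mu>_def by simp
    then have le: "exp (\<mu> * \<beta> * (hn / vn) - 2 * \<beta>) \<le> z"
      using z by (simp add: ennreal_le_iff)
    define x where "x = \<mu> * (hn / vn) / 2"
    have x: "x \<ge> 0" using \<mu> pos by (simp add: x_def)
    \<comment> \<open>The scaled ratio \<open>x\<close> is 1 at the threshold
      \<open>2 / \<mu>\<close>. Squaring \<open>x \<le> exp (x - 1)\<close> and then using convexity
      of \<open>exp\<close> with weights \<open>1 - 1 / \<beta>\<close> and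
      \<open>1 / \<beta>\<close> (legitimate as \<open>\<beta> \<ge> 1\<close>) reaches the exponent
      supplied by \<open>norm_mgf_ge\<close>.\<close>
    have "x \<le> exp (x - 1)" using exp_ge_add_one_self[of "x - 1"] by simp
    then have "x\<^sup>2 \<le> (exp (x - 1))\<^sup>2" using x by (intro power_mono) auto
    also have "(exp (x - 1))\<^sup>2 = exp (2 * (x - 1))"
      by (simp add: power2_eq_square exp_add[symmetric])
    also have "\<dots> \<le> (1 - 1 / \<beta>) * exp 0 + (1 / \<beta>) * exp (\<beta> * (2 * (x - 1)))"
    proof -
      have "exp ((1 - 1 / \<beta>) *\<^sub>R 0 + (1 / \<beta>) *\<^sub>R (\<beta> * (2 * (x - 1)))) \<le>
        (1 - 1 / \<beta>) * exp 0 + (1 / \<beta>) * exp (\<beta> * (2 * (x - 1)))"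
        using \<beta> by (intro convex_onD[OF exp_convex]) auto
      then show ?thesis using \<beta> by simp
    qed
    also have "\<beta> * (2 * (x - 1)) = \<mu> * \<beta> * (hn / vn) - 2 * \<beta>"
      by (simp add: x_def algebra_simps)
    also have "(1 - 1 / \<beta>) * exp 0 + (1 / \<beta>) * exp (\<mu> * \<beta> * (hn / vn) - 2 * \<beta>) \<le>
      (1 - 1 / \<beta>) * exp 0 + (1 / \<beta>) * z"
      using le \<beta> by (intro add_left_mono mult_left_mono) auto
    also have "\<dots> = 1 + (z - 1) / \<beta>" by (simp add: diff_divide_distrib)
    finally have x2: "x\<^sup>2 \<le> 1 + (z - 1) / \<beta>" .
    have "hn\<^sup>2 = 4 / \<mu>\<^sup>2 * x\<^sup>2 * vn\<^sup>2"
      using \<mu> pos by (simp add: x_def power_mult_distrib power_divide)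
    also have "\<dots> \<le> 4 / \<mu>\<^sup>2 * (1 + (z - 1) / \<beta>) * vn\<^sup>2"
      using x2 by (intro mult_right_mono mult_left_mono) auto
    finally show ?thesis
      unfolding hn(1) vn(1) z_def .
  qed
qed

text \<open>With the columns of the left singular matrix as rows \<open>W a\<close>,
  \<open>N\<close> bounds the squared norm of the second block of the sketch and \<open>Y\<close>
  the inverse square of the least singular value of the first. The inequality with \<open>Y\<close>
  is written without division, so it entails full rank.\<close>

definition sketch_bounds :: "nat \<Rightarrow> nat \<Rightarrow> nat \<Rightarrow> (nat \<Rightarrow> nat \<Rightarrow> real) \<Rightarrow> (nat \<times> nat \<Rightarrow> real) \<Rightarrow> real \<Rightarrow> real \<Rightarrow> bool" where
  "sketch_bounds m k d W X N Y \<longleftrightarrow> N \<ge> 0 \<and> Y \<ge> 0 \<and>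
     (\<forall>z. sq_sum {..<k} z \<le> Y * (\<Sum>j<d. (lin_comb {..<m} k W X z j)\<^sup>2)) \<and>
     (\<forall>v. (\<Sum>a\<in>{k..<m}. (\<Sum>i<m. W a i * (\<Sum>j<d. X (i, j) * v j))\<^sup>2) \<le> N * sq_sum {..<d} v)"

lemma gaussian_majorant:
  fixes W :: "nat \<Rightarrow> nat \<Rightarrow> real" and k p m :: nat
  assumes k: "k \<ge> 1" and p: "p \<ge> 2" and m: "k + p < m"
    and orth: "\<And>a b. a < m \<Longrightarrow> b < m \<Longrightarrow> dot {..<m} (W a) (W b) = (if a = b then 1 else 0)"
  defines "G \<equiv> gauss ({..<m} \<times> {..<k + p})"
  defines "\<omega> \<equiv> (sqrt (real (m - k)) + sqrt (real (k + p))) * (4 * exp 1 * sqrt (real (k + p)) / (real p + 1))"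
  shows "\<exists>H. integrable G H \<and> (\<integral>X. H X \<partial>G) \<le> \<omega> \<and> (AE X in G. \<exists>N Y. sqrt (N * Y) \<le> H X \<and> sketch_bounds m k (k + p) W X N Y)"
proof -
  let ?S = "{..<m}" and ?T = "{..<k + p}" and ?J = "{k..<m}"
  define r where "r = p div 2"
  define n where "n = r - 1"
  have r: "r \<ge> 1" "r = Suc n" "2 * r \<le> p" using p by (auto simp: r_def n_def)
  define K where "K = 8 * (exp 1)\<^sup>2 * real (k + p) / (real p + 1)\<^sup>2"
  have K: "K > 0" using k by (simp add: K_def)
  define g where "g = fact (2 * r) / (2 ^ r * fact r :: real)"
  have g: "g > 0" by (simp add: g_def)
  define \<beta> where "\<beta> = sqrt (real (card ?J) * real (card ?T))"
  define \<mu> where "\<mu> = sqrt 2 / (sqrt (real (card ?J)) + sqrt (real (card ?T)))"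
  have fin: "finite ?S" "finite ?T" "finite ?J" and ab: "card ?J > 0" "card ?T > 0"
    using k m by auto
  define Z where "Z = norm_mgf ?S ?T ?J W \<mu>"
  define Y where "Y = inv_moment ?S (k + p) k W r"
  define s where "s = sqrt (real (m - k)) + sqrt (real (k + p))"
  have s: "s > 0" using k by (simp add: s_def add_nonneg_pos)
  have \<mu>s: "4 / \<mu>\<^sup>2 = 2 * s\<^sup>2"
    by (simp add: \<mu>_def s_def power_divide)
  have Zm: "Z \<in> borel_measurable G" unfolding Z_def G_def by (rule measurable_norm_mgf[OF fin])
  have Ym: "Y \<in> borel_measurable G" unfolding Y_def G_def by (rule measurable_inv_moment[OF fin(1)])
  have ZE: "(\<integral>\<^sup>+X. Z X \<partial>G) \<le> ennreal 1"
    unfolding Z_def G_def using nn_integral_norm_mgf[OF fin, of W \<mu>] orth by simp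
  have YE: "(\<integral>\<^sup>+X. Y X \<partial>G) \<le> ennreal (g * K ^ r)"
  proof -
    have "(\<integral>\<^sup>+X. Y X \<partial>G) \<le> ennreal (fact r * (exp 1 * real (k + 2 * r) / real r) ^ r / (2 ^ n * fact n))"
      unfolding Y_def G_def r(2) using r orth m
      by (intro nn_integral_inv_moment_le fin(1) k) auto
    also have "\<dots> \<le> ennreal (g * K ^ r)"
      unfolding g_def K_def using inv_moment_constant_le[OF p k] by (intro ennreal_leI) (simp only: r_def n_def)
    finally show ?thesis .
  qed
  note Zi = enn2real_integral_bound[OF Zm ZE zero_le_one]
  have "g * K ^ r \<ge> 0" using g K by simp
  note Yi = enn2real_integral_bound[OF Ym YE this]
  interpret prob_space G unfolding G_def by (rule prob_space_gauss)
  define N' where "N' X = 4 / \<mu>\<^sup>2 * (1 + (enn2real (Z X) - 1) / \<beta>)" for X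
  define Y' where "Y' X = K * (1 + (enn2real (Y X) / (g * K ^ r) - 1) / real r)" for X
  \<comment> \<open>The weight that equalises the two bounds:
    \<open>\<alpha> * (2 * s\<^sup>2)\<close> and \<open>K / \<alpha>\<close> are both
    \<open>sqrt 2 * s * sqrt K\<close>, so the weighted mean attains the geometric mean of the
    bounds.\<close>
  define \<alpha> where "\<alpha> = sqrt K / (sqrt 2 * s)"
  have \<alpha>: "\<alpha> > 0" using K s by (simp add: \<alpha>_def)
  define H where "H X = (\<alpha> * N' X + Y' X / \<alpha>) / 2" for X
  have \<beta>: "\<beta> \<ge> 1"
  proof -
    have "1 \<le> card ?J * card ?T" using ab by (simp only: Suc_le_eq nat_0_less_mult_iff One_nat_def)
    then have "real 1 \<le> real (card ?J * card ?T)" by (rule of_nat_mono)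
    then show ?thesis by (simp only: \<beta>_def of_nat_mult[symmetric] real_sqrt_ge_1_iff of_nat_1)
  qed
  have N'i: "integrable G N'" "(\<integral>X. N' X \<partial>G) \<le> 2 * s\<^sup>2"
  proof -
    show "integrable G N'" unfolding N'_def using Zi(2) by auto
    have "(\<integral>X. N' X \<partial>G) = 4 / \<mu>\<^sup>2 * (1 + ((\<integral>X. enn2real (Z X) \<partial>G) - 1) / \<beta>)"
      unfolding N'_def using Zi(2) by (simp add: prob_space)
    also have "\<dots> \<le> 4 / \<mu>\<^sup>2 * 1"
      using Zi(3) \<beta> by (intro mult_left_mono) (auto simp: divide_nonpos_nonneg)
    finally show "(\<integral>X. N' X \<partial>G) \<le> 2 * s\<^sup>2" by (simp add: \<mu>s)
  qed
  have Y'i: "integrable G Y'" "(\<integral>X. Y' X \<partial>G) \<le> K"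
  proof -
    show "integrable G Y'" unfolding Y'_def using Yi(2) by auto
    have "(\<integral>X. Y' X \<partial>G) = K * (1 + ((\<integral>X. enn2real (Y X) \<partial>G) / (g * K ^ r) - 1) / real r)"
      unfolding Y'_def using Yi(2) by (simp add: prob_space)
    also have "\<dots> \<le> K * 1"
      using Yi(3) K g by (intro mult_left_mono) (auto simp: divide_nonpos_nonneg)
    finally show "(\<integral>X. Y' X \<partial>G) \<le> K" by simp
  qed
  have "integrable G H"
    unfolding H_def using N'i(1) Y'i(1) by auto
  moreover have "(\<integral>X. H X \<partial>G) \<le> \<omega>"
  proof -
    have "(\<integral>X. H X \<partial>G) = (\<alpha> * (\<integral>X. N' X \<partial>G) + (\<integral>X. Y' X \<partial>G) / \<alpha>) / 2"
      unfolding H_def using N'i(1) Y'i(1) by simp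
    also have "\<dots> \<le> (\<alpha> * (2 * s\<^sup>2) + K / \<alpha>) / 2"
      using N'i(2) Y'i(2) \<alpha> by (intro divide_right_mono add_mono mult_left_mono) auto
    also have "\<dots> = sqrt 2 * s * sqrt K"
    proof -
      have "\<alpha> * (2 * s\<^sup>2) = sqrt 2 * s * sqrt K"
        using s by (simp add: \<alpha>_def power2_eq_square field_simps)
      moreover have "K / \<alpha> = sqrt 2 * s * sqrt K"
        using s K by (simp add: \<alpha>_def field_simps real_sqrt_mult_self)
      ultimately show ?thesis by simp
    qed
    also have "\<dots> = \<omega>"
    proof -
      have "sqrt K = sqrt 8 * exp 1 * sqrt (real (k + p)) / (real p + 1)"
        unfolding K_def by (simp add: real_sqrt_mult real_sqrt_divide)
      moreover have "sqrt 2 * sqrt 8 = (4::real)"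
        by (simp add: real_sqrt_mult[symmetric] real_sqrt_unique)
      ultimately show ?thesis
        unfolding \<omega>_def s_def[symmetric] by simp
    qed
    finally show ?thesis .
  qed
  moreover have "AE X in G. \<exists>N Y. sqrt (N * Y) \<le> H X \<and> sketch_bounds m k (k + p) W X N Y"
    using Zi(1) Yi(1)
  proof eventually_elim
    case (elim X)
    have N0: "N' X \<ge> 0"
    proof -
      define z where "z = enn2real (Z X)"
      have "z \<ge> 0" by (simp add: z_def)
      then have "0 \<le> 1 + (z - 1) / \<beta>" using \<beta> by (simp add: field_simps)
      then show ?thesis unfolding N'_def z_def[symmetric] by (intro mult_nonneg_nonneg) auto
    qed
    have Y0: "Y' X \<ge> 0"
    proof -
      have "enn2real (Y X) / (g * K ^ r) \<ge> 0" using g K by simp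
      then have "1 + (enn2real (Y X) / (g * K ^ r) - 1) / real r \<ge> 0"
        using r(1) by (simp add: field_simps)
      then show ?thesis unfolding Y'_def using K by simp
    qed
    have "sqrt (N' X * Y' X) \<le> H X"
    proof -
      have "N' X * Y' X = (\<alpha> * N' X) * (Y' X / \<alpha>)" using \<alpha> by simp
      also have "sqrt \<dots> \<le> (\<alpha> * N' X + Y' X / \<alpha>) / 2"
        using N0 Y0 \<alpha> by (intro arith_geo_mean_sqrt) auto
      finally show ?thesis by (simp add: H_def)
    qed
    moreover have "sq_sum {..<k} z \<le> Y' X * (\<Sum>j<k + p. (lin_comb {..<m} k W X z j)\<^sup>2)" for z
      using norm_square_le_inv_moment[OF elim(2)[unfolded Y_def] r(1) K, of z]
      by (simp only: Y'_def Y_def g_def)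
    moreover have "(\<Sum>a\<in>{k..<m}. (\<Sum>i<m. W a i * (\<Sum>j<k + p. X (i, j) * v j))\<^sup>2) \<le> N' X * sq_sum {..<k + p} v" for v
      using norm_square_le_norm_mgf[OF fin ab elim(1)[unfolded Z_def \<mu>_def], of v]
      by (simp only: N'_def Z_def \<mu>_def \<beta>_def)
    ultimately show ?case
      using N0 Y0 unfolding sketch_bounds_def by blast
  qed
  ultimately show ?thesis by blast
qed

section \<open>Spectral decomposition and singular values\<close>

text \<open>The characteristic polynomial has a complex root; symmetry makes it real, and then the
  real or the imaginary part of the complex eigenvector serves.\<close>

lemma ex_unit_eigenvector:
  fixes N :: "nat \<Rightarrow> nat \<Rightarrow> real"
  assumes n: "n > 0" and sym: "\<And>i j. i < n \<Longrightarrow> j < n \<Longrightarrow> N i j = N j i"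
  shows "\<exists>c l. sq_sum {..<n} c = 1 \<and> (\<forall>i<n. dot {..<n} (N i) c = l * c i)"
proof -
  define M where "M = mat n n (\<lambda>(i, j). complex_of_real (N i j))"
  have M: "M \<in> carrier_mat n n" by (simp add: M_def)
  have "degree (char_poly M) = n"
    using degree_monic_char_poly[OF M] by simp
  then have "\<not> constant (poly (char_poly M))"
    using n by (simp add: constant_degree)
  then obtain z where "poly (char_poly M) z = 0"
    using fundamental_theorem_of_algebra by blast
  then have "eigenvalue M z"
    using eigenvalue_root_char_poly[OF M] by simp
  then obtain v where v: "v \<in> carrier_vec n" "v \<noteq> 0\<^sub>v n" "M *\<^sub>v v = z \<cdot>\<^sub>v v"
    using M by (auto simp: eigenvalue_def eigenvector_def)
  define a b x y where "a i = Re (v $ i)" and "b i = Im (v $ i)" and "x = Re z" and "y = Im z" for i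
  have eq: "(\<Sum>j<n. complex_of_real (N i j) * v $ j) = z * v $ i" if "i < n" for i
  proof -
    have "(M *\<^sub>v v) $ i = (\<Sum>j<n. complex_of_real (N i j) * v $ j)"
      using that v(1) by (auto simp: M_def scalar_prod_def lessThan_atLeast0 intro!: sum.cong)
    then show ?thesis using v(1,3) that by simp
  qed
  have ea: "dot {..<n} (N i) a = x * a i - y * b i" if "i < n" for i
    using arg_cong[OF eq[OF that], of Re] by (simp add: a_def b_def x_def y_def)
  have eb: "dot {..<n} (N i) b = x * b i + y * a i" if "i < n" for i
    using arg_cong[OF eq[OF that], of Im] by (simp add: a_def b_def x_def y_def)
  obtain i0 where i0: "i0 < n" "v $ i0 \<noteq> 0"
    using v(1,2) by (metis carrier_vecD eq_vecI index_zero_vec(1,2))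
  have pos: "sq_sum {..<n} a + sq_sum {..<n} b > 0"
  proof -
    have "(\<Sum>i<n. (a i)\<^sup>2 + (b i)\<^sup>2) > 0"
      by (rule sum_pos2[of _ i0]) (use i0 in \<open>auto simp: a_def b_def sum_power2_gt_zero_iff complex_eq_iff\<close>)
    then show ?thesis by (simp add: sum.distrib)
  qed
  \<comment> \<open>Symmetry of \<open>N\<close>, applied to the real part \<open>a\<close> and the
    imaginary part \<open>b\<close>, yields \<open>y * (|a|^2 + |b|^2) = 0\<close>.\<close>
  have "(\<Sum>i<n. b i * dot {..<n} (N i) a) = (\<Sum>j<n. a j * dot {..<n} (N j) b)"
    unfolding sum_distrib_left by (subst sum.swap) (intro sum.cong refl, simp add: sym mult_ac)
  then have "(\<Sum>i<n. b i * (x * a i - y * b i)) = (\<Sum>i<n. a i * (x * b i + y * a i))"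
    by (simp add: ea eb)
  then have "y * (sq_sum {..<n} a + sq_sum {..<n} b) = 0"
    by (simp add: algebra_simps sum.distrib sum_subtractf sum_distrib_left power2_eq_square)
  with pos have y: "y = 0" by simp
  have fin: ?thesis if e: "\<And>i. i < n \<Longrightarrow> dot {..<n} (N i) c = x * c i" and c: "sq_sum {..<n} c > 0" for c
  proof (intro exI[of _ "\<lambda>i. c i / sqrt (sq_sum {..<n} c)"] exI[of _ x] conjI allI impI)
    show "(\<Sum>i<n. (c i / sqrt (sq_sum {..<n} c))\<^sup>2) = 1"
      using c by (simp add: power_divide sum_divide_distrib[symmetric])
    show "(\<Sum>j<n. N i j * (c j / sqrt (sq_sum {..<n} c))) = x * (c i / sqrt (sq_sum {..<n} c))" if "i < n" for i
      using e[OF that] by (simp add: sum_divide_distrib[symmetric])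
  qed
  show ?thesis
  proof (cases "sq_sum {..<n} a > 0")
    case True
    then show ?thesis using fin[of a] ea y by simp
  next
    case False
    then show ?thesis using fin[of b] eb y pos by simp
  qed
qed

lemma orthonormal_complete:
  fixes w :: "nat \<Rightarrow> nat \<Rightarrow> real"
  assumes orth: "\<And>a b. a < n \<Longrightarrow> b < n \<Longrightarrow> dot {..<n} (w a) (w b) = (if a = b then 1 else 0)"
    and i: "i < n" "j < n"
  shows "(\<Sum>a<n. w a i * w a j) = (if i = j then 1 else 0)"
proof -
  define M where "M = mat n n (\<lambda>(a, i). w a i)"
  have M: "M \<in> carrier_mat n n" by (simp add: M_def)
  have "M * transpose_mat M = 1\<^sub>m n"
    by (rule eq_matI) (auto simp: M_def scalar_prod_def orth[symmetric] lessThan_atLeast0)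
  then have "transpose_mat M * M = 1\<^sub>m n"
    using M by (intro mat_mult_left_right_inverse[of M]) auto
  then have "(transpose_mat M * M) $$ (i, j) = 1\<^sub>m n $$ (i, j)" by simp
  then show ?thesis
    using i by (simp add: M_def scalar_prod_def lessThan_atLeast0)
qed

lemma orthonormal_expansion:
  fixes w :: "nat \<Rightarrow> nat \<Rightarrow> real"
  assumes orth: "\<And>a b. a < n \<Longrightarrow> b < n \<Longrightarrow> dot {..<n} (w a) (w b) = (if a = b then 1 else 0)"
    and i: "i < n"
  shows "(\<Sum>a<n. dot {..<n} (w a) x * w a i) = x i"
proof -
  have "(\<Sum>a<n. dot {..<n} (w a) x * w a i) = (\<Sum>j<n. x j * (\<Sum>a<n. w a j * w a i))"
    unfolding sum_distrib_left sum_distrib_right by (subst sum.swap) (simp add: mult_ac)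
  also have "\<dots> = (\<Sum>j<n. if j = i then x j else 0)"
    using orthonormal_complete[OF orth _ i] by (intro sum.cong refl) auto
  finally show ?thesis using i by simp
qed

text \<open>One more eigenvector is found in the orthogonal complement of those already constructed
  by compressing \<open>N\<close> to that complement.\<close>
lemma ex_orthonormal_eigenvectors:
  fixes N :: "nat \<Rightarrow> nat \<Rightarrow> real"
  assumes sym: "\<And>i j. i < n \<Longrightarrow> j < n \<Longrightarrow> N i j = N j i" and "m \<le> n"
  shows "\<exists>v l. (\<forall>a<m. \<forall>b<m. dot {..<n} (v a) (v b) = (if a = b then 1 else 0)) \<and>
    (\<forall>a<m. \<forall>i<n. dot {..<n} (N i) (v a) = l a * v a i)"
  using assms(2)
proof (induction m)
  case 0
  show ?case by simp
next
  case (Suc m)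
  then have "\<exists>v l. (\<forall>a<m. \<forall>b<m. dot {..<n} (v a) (v b) = (if a = b then 1 else 0)) \<and>
    (\<forall>a<m. \<forall>i<n. dot {..<n} (N i) (v a) = l a * v a i)" by simp
  then obtain v l where v: "\<forall>a<m. \<forall>b<m. dot {..<n} (v a) (v b) = (if a = b then 1 else 0)"
    and l: "\<forall>a<m. \<forall>i<n. dot {..<n} (N i) (v a) = l a * v a i" by blast
  define r where "r = n - m"
  have r: "r > 0" "m + r = n" using Suc.prems by (auto simp: r_def)
  have "card (v ` {..<m}) + r \<le> n"
    using card_image_le[of "{..<m}" v] r by simp
  from ex_orthonormal_orthogonal[OF _ this] obtain w
    where w: "\<forall>a<r. \<forall>b<r. dot {..<n} (w a) (w b) = (if a = b then 1 else 0)"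
      and wv: "\<forall>a<r. \<forall>f\<in>v ` {..<m}. (dot {..<n} (w a) f) = 0" by auto
  have wv: "dot {..<n} (w a) (v b) = 0" if "a < r" "b < m" for a b
    using wv that by blast
  have Nsym: "(\<Sum>i<n. x i * dot {..<n} (N i) y) = (\<Sum>i<n. y i * dot {..<n} (N i) x)" for x y
    unfolding sum_distrib_left by (subst sum.swap) (intro sum.cong refl, simp add: sym mult_ac)
  define N' where "N' a b = (\<Sum>i<n. w a i * dot {..<n} (N i) (w b))" for a b
  have "N' a b = N' b a" for a b unfolding N'_def by (rule Nsym)
  then obtain c \<nu> where c: "sq_sum {..<r} c = 1" and e: "\<forall>a<r. (\<Sum>b<r. N' a b * c b) = \<nu> * c a"
    using ex_unit_eigenvector[OF r(1), of N'] by blast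
  define x where "x i = (\<Sum>a<r. c a * w a i)" for i
  have xx: "sq_sum {..<n} x = 1"
    unfolding x_def using sum_square_orthonormal[where J = "{..<r}" and I = "{..<n}" and w = w and h = c] w c by simp
  have wx: "dot {..<n} (w a) x = c a" if "a < r" for a
  proof -
    have "dot {..<n} (w a) x = (\<Sum>b<r. c b * dot {..<n} (w a) (w b))"
      unfolding x_def sum_distrib_left by (subst sum.swap) (simp add: mult_ac)
    also have "\<dots> = (\<Sum>b<r. if a = b then c b else 0)"
      using w that by (intro sum.cong refl) auto
    finally show ?thesis using that by simp
  qed
  have vx: "dot {..<n} (v b) x = 0" if "b < m" for b
  proof -
    have "dot {..<n} (v b) x = (\<Sum>a<r. c a * dot {..<n} (w a) (v b))"
      unfolding x_def sum_distrib_left by (subst sum.swap) (simp add: mult_ac)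
    then show ?thesis using wv that by simp
  qed
  \<comment> \<open>The residual of the eigenvalue equation. It is orthogonal to each
    \<open>w a\<close> by the choice of \<open>c\<close> and to each \<open>v b\<close> because
    \<open>N\<close> is symmetric; these vectors together are an orthonormal basis, so it
    vanishes.\<close>
  define y where "y i = dot {..<n} (N i) x - \<nu> * x i" for i
  have wy: "dot {..<n} (w a) y = 0" if "a < r" for a
  proof -
    have "dot {..<n} (N i) x = (\<Sum>b<r. c b * dot {..<n} (N i) (w b))" for i
      unfolding x_def sum_distrib_left by (subst sum.swap) (simp add: mult_ac)
    then have "(\<Sum>i<n. w a i * dot {..<n} (N i) x) = (\<Sum>i<n. \<Sum>b<r. c b * (w a i * dot {..<n} (N i) (w b)))"
      by (simp add: sum_distrib_left mult.left_commute)
    also have "\<dots> = (\<Sum>b<r. N' a b * c b)"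
      unfolding N'_def by (subst sum.swap) (simp add: sum_distrib_left[symmetric] mult.commute)
    also have "\<dots> = \<nu> * c a" using e that by simp
    finally show ?thesis
      using wx[OF that] by (simp add: y_def right_diff_distrib sum_subtractf mult.left_commute[of _ \<nu>] sum_distrib_left[symmetric])
  qed
  have vy: "dot {..<n} (v b) y = 0" if b: "b < m" for b
  proof -
    have "(\<Sum>i<n. v b i * dot {..<n} (N i) x) = (\<Sum>i<n. x i * (l b * v b i))"
      using l b by (subst Nsym) simp
    also have "\<dots> = l b * dot {..<n} (v b) x"
      by (simp add: sum_distrib_left mult_ac)
    finally show ?thesis
      using vx[OF b] by (simp add: y_def right_diff_distrib sum_subtractf mult.left_commute[of _ \<nu>] sum_distrib_left[symmetric])
  qed
  let ?b = "\<lambda>a. if a < m then v a else w (a - m)"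
  have "dot {..<n} (?b a) (?b b) = (if a = b then 1 else 0)" if "a < n" "b < n" for a b
    using that v w wv[of "a - m" b] wv[of "b - m" a] r by (auto simp: mult.commute)
  note b = this
  have y0: "y i = 0" if "i < n" for i
  proof -
    have "dot {..<n} (?b a) y = 0" if "a < n" for a
      using that wy[of "a - m"] vy[of a] r by auto
    then show ?thesis
      using orthonormal_expansion[of n ?b i y, OF b that] by simp
  qed
  let ?v = "v(m := x)" and ?l = "l(m := \<nu>)"
  have "dot {..<n} (?v a) (?v b) = (if a = b then 1 else 0)" if "a < Suc m" "b < Suc m" for a b
    using that v vx[of a] vx[of b] xx by (auto simp: less_Suc_eq power2_eq_square mult.commute)
  moreover have "dot {..<n} (N i) (?v a) = ?l a * ?v a i" if "a < Suc m" "i < n" for a i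
    using that l y0[OF that(2)] by (auto simp: less_Suc_eq y_def)
  ultimately show ?case by blast
qed

section \<open>Ascending singular values and a one-sided min-max principle\<close>

text \<open>Unique factorisation into linear factors; it makes the list described in
  \<open>sing_vals_asc\<close> unique.\<close>

lemma prod_list_linear_factors_eq_iff:
  fixes xs ys :: "'a :: idom list"
  shows "(\<Prod>x\<leftarrow>xs. [:- x, 1:]) = (\<Prod>x\<leftarrow>ys. [:- x, 1:]) \<longleftrightarrow> mset xs = mset ys"
proof
  have p: "proots (\<Prod>x\<leftarrow>xs. [:- x, 1:]) = mset xs" for xs :: "'a list"
  proof (induction xs)
    case (Cons x xs)
    have "(\<Prod>x\<leftarrow>xs. [:- x, 1:]) \<noteq> 0"
      by (auto simp: prod_list_zero_iff)
    then show ?case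
      using Cons by (simp add: proots_mult del: mult_pCons_left)
  qed simp
  assume "(\<Prod>x\<leftarrow>xs. [:- x, 1:]) = (\<Prod>x\<leftarrow>ys. [:- x, 1:])"
  then show "mset xs = mset ys" by (metis p)
next
  assume "mset xs = mset ys"
  then have "mset (map (\<lambda>x. [:- x, 1:]) xs) = mset (map (\<lambda>x. [:- x, 1:]) ys)" by simp
  then show "(\<Prod>x\<leftarrow>xs. [:- x, 1:]) = (\<Prod>x\<leftarrow>ys. [:- x, 1:])"
    by (metis prod_mset_prod_list)
qed

lemma sorted_nth_le:
  fixes s :: "real list"
  assumes s: "sorted s" and i: "i < length (filter (\<lambda>x. x \<le> c) s)"
  shows "s ! i \<le> c"
proof (rule ccontr)
  assume "\<not> s ! i \<le> c"
  then have "\<not> s ! j \<le> c" if "j < length s" "\<not> j < i" for j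
    using that s by (meson dual_order.trans leI sorted_nth_mono)
  then have "{j. j < length s \<and> s ! j \<le> c} \<subseteq> {..<i}" by auto
  then have "card {j. j < length s \<and> s ! j \<le> c} \<le> i"
    by (metis card_lessThan card_mono finite_lessThan)
  with i show False by (simp add: length_filter_conv_card)
qed

text \<open>Courant--Fischer with one particular subspace, the vectors supported on coordinates
  \<open>0\<close> to \<open>i\<close>. Its dimension is \<open>i + 1\<close>, so it meets the
  orthogonal complement of any \<open>i\<close> eigenvectors. The proof also shows that the definite
  description is met by the sorted roots of the eigenvalues.\<close>

lemma sing_vals_asc_bounds:
  fixes M :: "real mat"
  assumes M: "M \<in> carrier_mat r n" and i: "i < n" and c: "c \<ge> 0"
    and le: "\<And>y. y \<in> carrier_vec n \<Longrightarrow> (\<And>j. j < n \<Longrightarrow> i < j \<Longrightarrow> y $ j = 0) \<Longrightarrow>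
      (\<Sum>a<r. ((M *\<^sub>v y) $ a)\<^sup>2) \<le> c\<^sup>2 * (\<Sum>j<n. (y $ j)\<^sup>2)"
  shows "length (sing_vals_asc M) = n" "0 \<le> sing_vals_asc M ! i" "sing_vals_asc M ! i \<le> c"
proof -
  define N where "N a b = (\<Sum>t<r. M $$ (t, a) * M $$ (t, b))" for a b
  let ?N = "transpose_mat M * M"
  have N: "?N = mat n n (\<lambda>(a, b). N a b)"
    using M by (intro eq_matI) (auto simp: N_def scalar_prod_def lessThan_atLeast0)
  have "\<exists>v l. (\<forall>a<n. \<forall>b<n. dot {..<n} (v a) (v b) = (if a = b then 1 else 0)) \<and>
    (\<forall>a<n. \<forall>i<n. dot {..<n} (N i) (v a) = l a * v a i)"
    by (rule ex_orthonormal_eigenvectors) (auto simp: N_def mult.commute)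
  then obtain v l where v: "\<And>a b. a < n \<Longrightarrow> b < n \<Longrightarrow> dot {..<n} (v a) (v b) = (if a = b then 1 else 0)"
    and l: "\<And>a i. a < n \<Longrightarrow> i < n \<Longrightarrow> dot {..<n} (N i) (v a) = l a * v a i" by blast
  have My: "(M *\<^sub>v y) $ t = (\<Sum>j<n. M $$ (t, j) * y $ j)" if "t < r" "y \<in> carrier_vec n" for t y
    using that M by (auto simp: scalar_prod_def lessThan_atLeast0 intro!: sum.cong)
  have quad: "(\<Sum>t<r. (\<Sum>j<n. M $$ (t, j) * y j)\<^sup>2) = (\<Sum>a<n. y a * dot {..<n} (N a) y)" for y :: "nat \<Rightarrow> real"
  proof -
    have "(\<Sum>t<r. (\<Sum>j<n. M $$ (t, j) * y j)\<^sup>2) = (\<Sum>t<r. \<Sum>a<n. \<Sum>b<n. y a * (M $$ (t, a) * M $$ (t, b) * y b))"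
      by (simp add: power2_eq_square sum_product mult_ac)
    also have "\<dots> = (\<Sum>a<n. \<Sum>t<r. \<Sum>b<n. y a * (M $$ (t, a) * M $$ (t, b) * y b))"
      by (rule sum.swap)
    also have "\<dots> = (\<Sum>a<n. \<Sum>b<n. \<Sum>t<r. y a * (M $$ (t, a) * M $$ (t, b) * y b))"
      by (intro sum.cong refl sum.swap)
    finally show ?thesis
      by (simp add: N_def sum_distrib_left sum_distrib_right)
  qed
  have l0: "l a \<ge> 0" if "a < n" for a
  proof -
    have "(\<Sum>t<r. (\<Sum>j<n. M $$ (t, j) * v a j)\<^sup>2) = (\<Sum>i<n. v a i * (l a * v a i))"
      unfolding quad using l that by simp
    also have "\<dots> = l a * dot {..<n} (v a) (v a)"
      by (simp add: sum_distrib_left mult_ac)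
    also have "\<dots> = l a" using v[OF that that] by simp
    finally have "l a = (\<Sum>t<r. (\<Sum>j<n. M $$ (t, j) * v a j)\<^sup>2)" by simp
    then show ?thesis by (simp add: sum_nonneg)
  qed
  have cp: "char_poly ?N = (\<Prod>a\<leftarrow>map l [0..<n]. [:- a, 1:])"
  proof -
    define P where "P = mat n n (\<lambda>(i, a). v a i)"
    define B where "B = mat n n (\<lambda>(i, j). if i = j then l i else 0)"
    have P: "P \<in> carrier_mat n n" and B: "B \<in> carrier_mat n n" and Nc: "?N \<in> carrier_mat n n"
      using M by (auto simp: P_def B_def)
    have PP: "transpose_mat P * P = 1\<^sub>m n"
      using v by (intro eq_matI) (auto simp: P_def scalar_prod_def lessThan_atLeast0)
    then have PP': "P * transpose_mat P = 1\<^sub>m n"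
      using P by (intro mat_mult_left_right_inverse[of "transpose_mat P"]) auto
    have "?N * P = P * B"
    proof (rule eq_matI)
      fix i a assume "i < dim_row (P * B)" "a < dim_col (P * B)"
      then have ia: "i < n" "a < n" using P B by auto
      have "(?N * P) $$ (i, a) = dot {..<n} (N i) (v a)"
        using ia unfolding N by (simp add: P_def scalar_prod_def lessThan_atLeast0)
      also have "\<dots> = (\<Sum>j<n. if j = a then v a i * l a else 0)"
        using l[OF ia(2,1)] ia by simp
      also have "\<dots> = (P * B) $$ (i, a)"
        using ia by (simp add: P_def B_def scalar_prod_def lessThan_atLeast0 if_distrib cong: if_cong)
      finally show "(?N * P) $$ (i, a) = (P * B) $$ (i, a)" .
    qed (use P B Nc in auto)
    then have "?N * P * transpose_mat P = P * B * transpose_mat P" by simp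
    then have "?N = P * B * transpose_mat P"
      using PP' P Nc by (simp add: assoc_mult_mat[OF Nc P] right_mult_one_mat[OF Nc])
    then have "similar_mat ?N B"
      using P B Nc PP PP' by (intro similar_matI[of _ _ P "transpose_mat P" n]) auto
    then have "char_poly ?N = char_poly B" by (rule char_poly_similar)
    also have "\<dots> = (\<Prod>a\<leftarrow>diag_mat B. [:- a, 1:])"
      by (rule char_poly_upper_triangular[OF B]) (auto simp: B_def upper_triangular_def)
    also have "diag_mat B = map l [0..<n]"
      by (auto simp: diag_mat_def B_def)
    finally show ?thesis .
  qed
  define s where "s = sort (map (\<lambda>a. sqrt (l a)) [0..<n])"
  have sq: "mset (map (\<lambda>x. x\<^sup>2) s) = mset (map l [0..<n])"
  proof -
    have "mset (map (\<lambda>x. x\<^sup>2) s) = mset (map (\<lambda>a. (sqrt (l a))\<^sup>2) [0..<n])"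
      by (simp add: s_def image_mset.compositionality o_def)
    also have "map (\<lambda>a. (sqrt (l a))\<^sup>2) [0..<n] = map l [0..<n]"
      using l0 by simp
    finally show ?thesis .
  qed
  have s: "length s = dim_col M" "sorted s" "\<forall>x\<in>set s. 0 \<le> x"
    using M l0 by (auto simp: s_def)
  have scp: "char_poly ?N = (\<Prod>x\<leftarrow>s. [:- (x\<^sup>2), 1:])"
  proof -
    have "(\<Prod>x\<leftarrow>map (\<lambda>x. x\<^sup>2) s. [:- x, 1:]) = (\<Prod>a\<leftarrow>map l [0..<n]. [:- a, 1:])"
      using sq by (simp only: prod_list_linear_factors_eq_iff)
    then show ?thesis by (simp add: cp o_def)
  qed
  have S: "sing_vals_asc M = s"
    unfolding sing_vals_asc_def
  proof (rule the_equality)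
    fix t assume t: "length t = dim_col M \<and> sorted t \<and> (\<forall>x\<in>set t. 0 \<le> x) \<and>
      char_poly ?N = (\<Prod>x\<leftarrow>t. [:- (x\<^sup>2), 1:])"
    then have "(\<Prod>x\<leftarrow>map (\<lambda>x. x\<^sup>2) t. [:- x, 1:]) = (\<Prod>x\<leftarrow>map (\<lambda>x. x\<^sup>2) s. [:- x, 1:])"
      using scp by (simp add: o_def)
    then have "mset (map (\<lambda>x. x\<^sup>2) t) = mset (map (\<lambda>x. x\<^sup>2) s)"
      by (simp only: prod_list_linear_factors_eq_iff)
    then have "image_mset sqrt (mset (map (\<lambda>x. x\<^sup>2) t)) = image_mset sqrt (mset (map (\<lambda>x. x\<^sup>2) s))"
      by (rule arg_cong)
    then have "mset (map sqrt (map (\<lambda>x. x\<^sup>2) t)) = mset (map sqrt (map (\<lambda>x. x\<^sup>2) s))"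
      by (simp only: mset_map)
    moreover have "map sqrt (map (\<lambda>x. x\<^sup>2) t) = t" "map sqrt (map (\<lambda>x. x\<^sup>2) s) = s"
      using t s(3) by (auto intro!: map_idI)
    ultimately have "mset t = mset s" by (simp only:)
    then show "t = s" using properties_for_sort[of t s] sorted_sort_id[OF s(2)] t by simp
  qed (use s scp in auto)
  show "length (sing_vals_asc M) = n" using S s M by simp
  show "0 \<le> sing_vals_asc M ! i" using S s M i by simp
  \<comment> \<open>Otherwise at most \<open>i\<close> eigenvalues are at most
    \<open>c\<^sup>2\<close>, and a unit vector \<open>y\<close> of the subspace is orthogonal to
    their eigenvectors; its quadratic form would exceed \<open>c\<^sup>2\<close>.\<close>
  have "i < length (filter (\<lambda>x. x \<le> c) s)"
  proof (rule ccontr)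
    assume "\<not> i < length (filter (\<lambda>x. x \<le> c) s)"
    define F where "F = {a. a < n \<and> l a \<le> c\<^sup>2}"
    have "length (filter (\<lambda>x. x \<le> c) s) = length (filter (\<lambda>x. x \<le> c) (map (\<lambda>a. sqrt (l a)) [0..<n]))"
      by (simp only: s_def size_mset[symmetric] mset_filter mset_sort)
    also have "\<dots> = card {a. a < n \<and> sqrt (l a) \<le> c}"
      by (simp add: length_filter_conv_card) (rule arg_cong[of _ _ card], auto)
    also have "{a. a < n \<and> sqrt (l a) \<le> c} = F"
    proof -
      have "sqrt x \<le> c \<longleftrightarrow> x \<le> c\<^sup>2" for x
        using c by (metis abs_of_nonneg real_sqrt_abs real_sqrt_le_iff)
      then show ?thesis by (simp add: F_def)
    qed
    finally have cF: "card F < Suc i" using \<open>\<not> i < _\<close> by simp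
    have "card (v ` F) < Suc i"
      using card_image_le[of F v] cF by (simp add: F_def)
    then obtain w where w: "sq_sum {..<Suc i} w = 1" "\<forall>f\<in>v ` F. (dot {..<Suc i} f w) = 0"
      using ex_orthogonal_unit[of "v ` F" "Suc i"] by (auto simp: F_def)
    define y where "y j = (if j < Suc i then w j else 0)" for j
    have ext: "dot {..<n} f y = dot {..<Suc i} f w" for f :: "nat \<Rightarrow> real"
    proof -
      have "dot {..<n} f y = dot {..<Suc i} f y"
        using i by (intro sum.mono_neutral_right) (auto simp: y_def)
      also have "\<dots> = dot {..<Suc i} f w"
        by (intro sum.cong) (auto simp: y_def)
      finally show ?thesis .
    qed
    have y1: "sq_sum {..<n} y = 1"
      using ext[of y] w(1) by (simp add: power2_eq_square y_def)
    define h where "h a = dot {..<n} (v a) y" for a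
    have h0: "h a = 0" if "a \<in> F" for a
      using w(2) that ext[of "v a"] by (auto simp: h_def)
    have yh: "y i = (\<Sum>a<n. h a * v a i)" if "i < n" for i
      using orthonormal_expansion[of n v i y, OF v that] by (simp add: h_def)
    have h1: "sq_sum {..<n} h = 1"
    proof -
      have "(\<Sum>i<n. (\<Sum>a<n. h a * v a i)\<^sup>2) = sq_sum {..<n} h"
        using v by (intro sum_square_orthonormal) auto
      then show ?thesis using y1 yh by simp
    qed
    have "(\<Sum>t<r. (\<Sum>j<n. M $$ (t, j) * y j)\<^sup>2) = (\<Sum>a<n. l a * (h a)\<^sup>2)"
    proof -
      have "dot {..<n} (N i) y = (\<Sum>a<n. (l a * h a) * v a i)" if "i < n" for i
      proof -
        have "dot {..<n} (N i) y = (\<Sum>b<n. N i b * (\<Sum>a<n. h a * v a b))" using yh by simp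
        also have "\<dots> = (\<Sum>a<n. h a * dot {..<n} (N i) (v a))"
          unfolding sum_distrib_left by (subst sum.swap) (simp add: mult_ac)
        finally show ?thesis using l that by (simp add: mult_ac)
      qed
      then have "(\<Sum>i<n. y i * dot {..<n} (N i) y) = (\<Sum>i<n. y i * (\<Sum>a<n. (l a * h a) * v a i))"
        by simp
      also have "\<dots> = (\<Sum>a<n. l a * h a * h a)"
        unfolding sum_distrib_left h_def by (subst sum.swap) (simp add: mult_ac sum_distrib_left)
      finally show ?thesis
        unfolding quad by (simp add: power2_eq_square mult.assoc)
    qed
    moreover have "(\<Sum>t<r. (\<Sum>j<n. M $$ (t, j) * y j)\<^sup>2) \<le> c\<^sup>2"
    proof -
      have "(\<Sum>t<r. ((M *\<^sub>v vec n y) $ t)\<^sup>2) \<le> c\<^sup>2 * (\<Sum>j<n. (vec n y $ j)\<^sup>2)"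
        by (rule le) (auto simp: y_def)
      then show ?thesis using y1 by (simp add: My)
    qed
    moreover have "(\<Sum>a<n. c\<^sup>2 * (h a)\<^sup>2) < (\<Sum>a<n. l a * (h a)\<^sup>2)"
    proof (rule sum_strict_mono_ex1)
      have F: "a \<in> F \<or> c\<^sup>2 < l a" if "a < n" for a using that by (auto simp: F_def)
      show "\<forall>a\<in>{..<n}. c\<^sup>2 * (h a)\<^sup>2 \<le> l a * (h a)\<^sup>2"
      proof
        fix a assume "a \<in> {..<n}"
        then show "c\<^sup>2 * (h a)\<^sup>2 \<le> l a * (h a)\<^sup>2"
          using F[of a] h0[of a] by (cases "a \<in> F") (simp, auto intro!: mult_right_mono)
      qed
      obtain a where a: "a < n" "h a \<noteq> 0"
        using h1 by (metis (mono_tags, lifting) lessThan_iff power_zero_numeral sum.neutral zero_neq_one)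
      then have "c\<^sup>2 * (h a)\<^sup>2 < l a * (h a)\<^sup>2"
        using F[of a] h0[of a] by auto
      then show "\<exists>a\<in>{..<n}. c\<^sup>2 * (h a)\<^sup>2 < l a * (h a)\<^sup>2" using a(1) by (intro bexI[of _ a]) simp_all
    qed simp
    ultimately show False
      using h1 by (simp add: sum_distrib_left[symmetric])
  qed
  then show "sing_vals_asc M ! i \<le> c"
    unfolding S using s(2) by (intro sorted_nth_le)
qed

section \<open>Principal angles\<close>

lemma index_mult_mat_vec_sum:
  assumes "M \<in> carrier_mat r c" "v \<in> carrier_vec c" "i < r"
  shows "(M *\<^sub>v v) $ i = (\<Sum>j<c. M $$ (i, j) * v $ j)"
  using assms by (auto simp: scalar_prod_def lessThan_atLeast0 intro!: sum.cong)

lemma orthonormal_columns: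
  fixes X :: "real mat"
  assumes X: "X \<in> carrier_mat r c" "transpose_mat X * X = 1\<^sub>m c" and ab: "a < c" "b < c"
  shows "(\<Sum>i<r. X $$ (i, a) * X $$ (i, b)) = (if a = b then 1 else 0)"
proof -
  have "(transpose_mat X * X) $$ (a, b) = (\<Sum>i<r. X $$ (i, a) * X $$ (i, b))"
    using X(1) ab by (auto simp: scalar_prod_def lessThan_atLeast0 intro!: sum.cong)
  then show ?thesis using X(2) ab by simp
qed

text \<open>The error at coefficients \<open>f\<close> differs from a constant by the squared
  distance of \<open>f\<close> to the inner products of \<open>w\<close> with the orthonormal
  vectors.\<close>

lemma best_approximation:
  fixes x :: "'a \<Rightarrow> 'i \<Rightarrow> real"
  assumes J: "finite J"
    and orth: "\<And>a b. a \<in> J \<Longrightarrow> b \<in> J \<Longrightarrow> dot I (x a) (x b) = (if a = b then 1 else 0)"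
  shows "(\<Sum>i\<in>I. (w i - (\<Sum>a\<in>J. (dot I (x a) w) * x a i))\<^sup>2) \<le> (\<Sum>i\<in>I. (w i - (\<Sum>a\<in>J. c a * x a i))\<^sup>2)"
proof -
  let ?h = "\<lambda>a. \<Sum>j\<in>I. x a j * w j"
  have eq: "(\<Sum>i\<in>I. (w i - (\<Sum>a\<in>J. f a * x a i))\<^sup>2) = sq_sum I w + sq_sum J f - 2 * dot J f ?h" for f
  proof -
    have "(\<Sum>i\<in>I. (w i - (\<Sum>a\<in>J. f a * x a i))\<^sup>2) = sq_sum I w + (\<Sum>i\<in>I. (\<Sum>a\<in>J. f a * x a i)\<^sup>2)
      - 2 * (\<Sum>i\<in>I. \<Sum>a\<in>J. f a * (x a i * w i))"
      by (simp add: power2_diff sum.distrib sum_subtractf sum_distrib_left sum_distrib_right mult_ac)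
    also have "(\<Sum>i\<in>I. \<Sum>a\<in>J. f a * (x a i * w i)) = dot J f ?h"
      by (subst sum.swap) (simp add: sum_distrib_left)
    finally show ?thesis by (simp add: sum_square_orthonormal[OF J orth])
  qed
  have "0 \<le> (\<Sum>a\<in>J. (c a - ?h a)\<^sup>2)" by (simp add: sum_nonneg)
  also have "\<dots> = sq_sum J c + sq_sum J ?h - 2 * dot J c ?h"
    by (simp add: power2_diff sum.distrib sum_subtractf sum_distrib_left mult.assoc)
  finally show ?thesis
    unfolding eq by (simp add: power2_eq_square)
qed

text \<open>The range of \<open>X\<close> contains \<open>B y + h\<close> with \<open>h\<close> in
  the span of the remaining columns. Projecting onto that range is at least as good as approximating
  \<open>B y\<close> by a multiple of this one vector, and the min-max bound converts the resulting
  error into a bound on the sine.\<close>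

lemma sin_principal_angle_le:
  fixes X B :: "real mat"
  assumes X: "X \<in> carrier_mat N d" "transpose_mat X * X = 1\<^sub>m d"
    and B: "B \<in> carrier_mat N N" "transpose_mat B * B = 1\<^sub>m N"
    and k: "k \<le> N" and i: "i < k" and \<rho>: "\<rho> \<ge> 0"
    and ex: "\<And>y. (\<And>j. j < k \<Longrightarrow> i < j \<Longrightarrow> y j = 0) \<Longrightarrow> \<exists>c \<beta>. c \<in> carrier_vec d \<and> X *\<^sub>v c = B *\<^sub>v vec N \<beta> \<and>
       (\<forall>a<k. \<beta> a = y a) \<and> (\<Sum>a\<in>{k..<N}. (\<beta> a)\<^sup>2) \<le> \<rho>\<^sup>2 * sq_sum {..<k} y"
  shows "sin (principal_angles X (first_cols k B) ! i) \<le> \<rho> / sqrt (1 + \<rho>\<^sup>2)"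
proof -
  let ?Y = "first_cols k B"
  let ?M = "(1\<^sub>m (dim_row X) - X * transpose_mat X) * ?Y"
  let ?c = "\<rho> / sqrt (1 + \<rho>\<^sup>2)"
  have Y: "?Y \<in> carrier_mat N k" using B(1) by (simp add: first_cols_def)
  have M: "?M \<in> carrier_mat N k" using X Y by auto
  have c: "0 \<le> ?c" "?c \<le> 1"
  proof -
    have "\<rho> \<le> sqrt (1 + \<rho>\<^sup>2)" by (rule real_le_rsqrt) simp
    then show "?c \<le> 1" by (simp add: divide_le_eq_1 add_pos_nonneg)
  qed (use \<rho> in simp)
  have c2: "?c\<^sup>2 = \<rho>\<^sup>2 / (1 + \<rho>\<^sup>2)"
    by (simp add: power_divide add_nonneg_nonneg)
  have "(\<Sum>a<N. ((?M *\<^sub>v y) $ a)\<^sup>2) \<le> ?c\<^sup>2 * (\<Sum>j<k. (y $ j)\<^sup>2)"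
    if y: "y \<in> carrier_vec k" and y0: "\<And>j. j < k \<Longrightarrow> i < j \<Longrightarrow> y $ j = 0" for y
  proof -
    define w where "w t = (\<Sum>j<k. B $$ (t, j) * y $ j)" for t
    have w: "(?Y *\<^sub>v y) = vec N w"
    proof (rule eq_vecI)
      fix t assume "t < dim_vec (vec N w)"
      then have t: "t < N" by simp
      have "(?Y *\<^sub>v y) $ t = (\<Sum>j<k. ?Y $$ (t, j) * y $ j)"
        by (rule index_mult_mat_vec_sum[OF Y y t])
      also have "\<dots> = w t"
        unfolding w_def using t B(1) by (intro sum.cong) (auto simp: first_cols_def)
      finally show "(?Y *\<^sub>v y) $ t = vec N w $ t" using t by simp
    qed (use Y in simp)
    let ?g = "\<lambda>a. \<Sum>j<N. X $$ (j, a) * w j"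
    have My: "(?M *\<^sub>v y) $ t = w t - (\<Sum>a<d. ?g a * X $$ (t, a))" if t: "t < N" for t
    proof -
      have XX: "X * transpose_mat X \<in> carrier_mat N N" using X by auto
      have "?M *\<^sub>v y = (1\<^sub>m N - X * transpose_mat X) *\<^sub>v vec N w"
        using X(1) Y y w by (subst assoc_mult_mat_vec[of _ N N _ k]) auto
      also have "\<dots> = 1\<^sub>m N *\<^sub>v vec N w - (X * transpose_mat X) *\<^sub>v vec N w"
        using XX by (intro minus_mult_distrib_mat_vec) auto
      also have "(X * transpose_mat X) *\<^sub>v vec N w = X *\<^sub>v (transpose_mat X *\<^sub>v vec N w)"
        using X(1) by (intro assoc_mult_mat_vec[of _ N d _ N]) auto
      also have "transpose_mat X *\<^sub>v vec N w = vec d ?g"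
        using X(1) by (intro eq_vecI)
          (auto simp: index_mult_mat_vec_sum[of "transpose_mat X" d N] simp del: index_mult_mat_vec)
      finally have "?M *\<^sub>v y = 1\<^sub>m N *\<^sub>v vec N w - X *\<^sub>v vec d ?g" .
      then show ?thesis
        using t X(1) by (simp add: index_mult_mat_vec_sum[OF X(1)] mult.commute del: index_mult_mat_vec)
    qed
    obtain c \<beta> where cb: "c \<in> carrier_vec d" "X *\<^sub>v c = B *\<^sub>v vec N \<beta>"
      "\<And>a. a < k \<Longrightarrow> \<beta> a = y $ a" "(\<Sum>a\<in>{k..<N}. (\<beta> a)\<^sup>2) \<le> \<rho>\<^sup>2 * (\<Sum>a<k. (y $ a)\<^sup>2)"
      using ex[of "\<lambda>j. y $ j"] y0 by blast
    \<comment> \<open>The minimiser of \<open>(1 - t)^2 + t^2 * \<rho>^2\<close>, with minimum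
      \<open>\<rho>^2 / (1 + \<rho>^2)\<close>.\<close>
    define t where "t = 1 / (1 + \<rho>\<^sup>2)"
    have pos: "1 + \<rho>\<^sup>2 > 0" by (simp add: add_pos_nonneg)
    have Xc: "(\<Sum>a<d. c $ a * X $$ (s, a)) = (\<Sum>a<N. \<beta> a * B $$ (s, a))" if "s < N" for s
    proof -
      have "(X *\<^sub>v c) $ s = (B *\<^sub>v vec N \<beta>) $ s" using cb(2) by simp
      then show ?thesis
        using that cb(1) by (simp add: index_mult_mat_vec_sum[OF X(1)] index_mult_mat_vec_sum[OF B(1)] mult.commute del: index_mult_mat_vec)
    qed
    define f where "f a = (if a < k then (1 - t) * y $ a else - t * \<beta> a)" for a
    have split: "(\<Sum>a<N. F a) = (\<Sum>a<k. F a) + (\<Sum>a\<in>{k..<N}. F a)" for F :: "nat \<Rightarrow> real"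
      using k by (simp add: lessThan_atLeast0 sum.atLeastLessThan_concat)
    have "(\<Sum>a<N. ((?M *\<^sub>v y) $ a)\<^sup>2) = (\<Sum>s<N. (w s - (\<Sum>a<d. ?g a * X $$ (s, a)))\<^sup>2)"
      using My by simp
    also have "\<dots> \<le> (\<Sum>s<N. (w s - (\<Sum>a<d. (t * c $ a) * X $$ (s, a)))\<^sup>2)"
      using orthonormal_columns[OF X] by (intro best_approximation) auto
    also have "\<dots> = (\<Sum>s<N. (\<Sum>a<N. f a * B $$ (s, a))\<^sup>2)"
    proof (intro sum.cong refl arg_cong[where f = "\<lambda>x. x\<^sup>2"])
      fix s assume "s \<in> {..<N}"
      then have s: "s < N" by simp
      have "w s - (\<Sum>a<d. (t * c $ a) * X $$ (s, a)) = w s - t * (\<Sum>a<d. c $ a * X $$ (s, a))"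
        by (simp add: sum_distrib_left mult.assoc)
      also have "\<dots> = w s - t * ((\<Sum>a<k. y $ a * B $$ (s, a)) + (\<Sum>a\<in>{k..<N}. \<beta> a * B $$ (s, a)))"
        unfolding Xc[OF s] split using cb(3) by simp
      also have "\<dots> = (\<Sum>a<k. f a * B $$ (s, a)) + (\<Sum>a\<in>{k..<N}. f a * B $$ (s, a))"
      proof -
        have "(\<Sum>a<k. f a * B $$ (s, a)) = (1 - t) * w s"
          unfolding w_def sum_distrib_left by (intro sum.cong) (auto simp: f_def mult_ac)
        moreover have "(\<Sum>a\<in>{k..<N}. f a * B $$ (s, a)) = - t * (\<Sum>a\<in>{k..<N}. \<beta> a * B $$ (s, a))"
          unfolding sum_distrib_left by (intro sum.cong) (auto simp: f_def mult_ac)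
        moreover have "(\<Sum>a<k. y $ a * B $$ (s, a)) = w s"
          unfolding w_def by (simp add: mult.commute)
        ultimately show ?thesis by (simp add: algebra_simps)
      qed
      finally show "w s - (\<Sum>a<d. (t * c $ a) * X $$ (s, a)) = (\<Sum>a<N. f a * B $$ (s, a))"
        unfolding split .
    qed
    also have "\<dots> = sq_sum {..<N} f"
      using orthonormal_columns[OF B] by (intro sum_square_orthonormal) auto
    also have "\<dots> = (1 - t)\<^sup>2 * (\<Sum>a<k. (y $ a)\<^sup>2) + t\<^sup>2 * (\<Sum>a\<in>{k..<N}. (\<beta> a)\<^sup>2)"
      unfolding split sum_distrib_left by (intro arg_cong2[where f = "(+)"] sum.cong) (auto simp: f_def power_mult_distrib)
    also have "\<dots> \<le> (1 - t)\<^sup>2 * (\<Sum>a<k. (y $ a)\<^sup>2) + t\<^sup>2 * (\<rho>\<^sup>2 * (\<Sum>a<k. (y $ a)\<^sup>2))"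
      using cb(4) by (intro add_left_mono mult_left_mono) auto
    also have "\<dots> = ((1 - t)\<^sup>2 + t\<^sup>2 * \<rho>\<^sup>2) * (\<Sum>a<k. (y $ a)\<^sup>2)"
      by (simp add: algebra_simps)
    also have "(1 - t)\<^sup>2 + t\<^sup>2 * \<rho>\<^sup>2 = \<rho>\<^sup>2 / (1 + \<rho>\<^sup>2)"
    proof -
      define q where "q = 1 + \<rho>\<^sup>2"
      have q: "q \<noteq> 0" "\<rho>\<^sup>2 = q - 1" using pos by (auto simp: q_def)
      show ?thesis
        unfolding t_def q_def[symmetric] q(2) using q(1) by (simp add: field_simps power2_eq_square)
    qed
    finally show ?thesis by (simp add: c2)
  qed
  note sv = sing_vals_asc_bounds[OF M i c(1) this]
  \<comment> \<open>The singular value lies between 0 and \<open>?c\<close>, which is at most 1, so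
    \<open>sin\<close> undoes \<open>arcsin\<close>.\<close>
  have "principal_angles X ?Y ! i = arcsin (sing_vals_asc ?M ! i)"
    using sv(1) i by (simp add: principal_angles_def)
  then show ?thesis
    using sv c(2) by simp
qed

section \<open>Preimages under the sketch with controlled tail\<close>

text \<open>The solution is B^T (B B^T)^{-1} z; the lower bound makes the Gram matrix
  \<open>M\<close> injective, hence invertible.\<close>

lemma ex_right_inverse_bounded:
  fixes B :: "nat \<Rightarrow> nat \<Rightarrow> real"
  assumes low: "\<And>z. sq_sum {..<k} z \<le> Y * (\<Sum>j<d. (\<Sum>a<k. z a * B a j)\<^sup>2)" and Y: "Y \<ge> 0"
  shows "\<exists>x. (\<forall>a<k. dot {..<d} (B a) x = z a) \<and> sq_sum {..<d} x \<le> Y * sq_sum {..<k} z"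
proof -
  let ?L = "\<lambda>z j. \<Sum>a<k. z a * B a j"
  define M where "M = mat k k (\<lambda>(a, b). \<Sum>j<d. B a j * B b j)"
  have M: "M \<in> carrier_mat k k" by (simp add: M_def)
  have Mz: "(M *\<^sub>v z) $ a = (\<Sum>j<d. B a j * ?L (\<lambda>b. z $ b) j)" if "z \<in> carrier_vec k" "a < k" for z a
  proof -
    have "(M *\<^sub>v z) $ a = (\<Sum>b<k. \<Sum>j<d. B a j * (z $ b * B b j))"
      using that by (simp add: index_mult_mat_vec_sum[OF M] del: index_mult_mat_vec)
        (simp add: M_def sum_distrib_left sum_distrib_right mult_ac)
    also have "\<dots> = (\<Sum>j<d. \<Sum>b<k. B a j * (z $ b * B b j))" by (rule sum.swap)
    finally show ?thesis by (simp add: sum_distrib_left)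
  qed
  have quad: "(\<Sum>j<d. (?L z j)\<^sup>2) = (\<Sum>a<k. z a * (dot {..<d} (B a) (?L z)))" for z
  proof -
    have "(\<Sum>a<k. z a * (dot {..<d} (B a) (?L z))) = (\<Sum>j<d. \<Sum>a<k. z a * B a j * ?L z j)"
      unfolding sum_distrib_left[of "z _"] by (subst sum.swap) (simp add: mult.assoc)
    then show ?thesis by (simp add: power2_eq_square sum_distrib_right[symmetric])
  qed
  have "det M \<noteq> 0"
  proof
    assume "det M = 0"
    then obtain v where v: "v \<in> carrier_vec k" "v \<noteq> 0\<^sub>v k" "M *\<^sub>v v = 0\<^sub>v k"
      using det_0_iff_vec_prod_zero[OF M] by auto
    have "(\<Sum>j<d. B a j * ?L (\<lambda>b. v $ b) j) = 0" if "a < k" for a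
      using Mz[OF v(1) that] v(3) that by simp
    then have "(\<Sum>j<d. (?L (\<lambda>b. v $ b) j)\<^sup>2) = 0"
      unfolding quad by simp
    then have "(\<Sum>a<k. (v $ a)\<^sup>2) \<le> 0" using low[of "\<lambda>b. v $ b"] by simp
    then have "(\<Sum>a<k. (v $ a)\<^sup>2) = 0" by (intro antisym) (auto simp: sum_nonneg)
    then have "v $ a = 0" if "a < k" for a using that by (simp add: sum_nonneg_eq_0_iff)
    then have "v = 0\<^sub>v k" using v(1) by (intro eq_vecI) auto
    with v(2) show False by simp
  qed
  then obtain Mi where Mi: "Mi \<in> carrier_mat k k" "M * Mi = 1\<^sub>m k"
    using det_non_zero_imp_unit[OF M, of undefined] by (auto simp: Units_def ring_mat_simps)
  define z1 where "z1 = Mi *\<^sub>v vec k z"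
  have z1: "z1 \<in> carrier_vec k" using Mi by (simp add: z1_def)
  have "M *\<^sub>v z1 = (M * Mi) *\<^sub>v vec k z"
    unfolding z1_def using M Mi by (intro assoc_mult_mat_vec[symmetric]) auto
  then have Mz1: "M *\<^sub>v z1 = vec k z" using Mi(2) by simp
  define x where "x = ?L (\<lambda>b. z1 $ b)"
  have bx: "dot {..<d} (B a) x = z a" if "a < k" for a
    using Mz[OF z1 that] Mz1 that by (simp add: x_def)
  let ?S = "\<Sum>j<d. (x j)\<^sup>2" and ?A0 = "\<Sum>a<k. (z a)\<^sup>2" and ?A1 = "\<Sum>a<k. (z1 $ a)\<^sup>2"
  have S: "?S = (\<Sum>a<k. z1 $ a * z a)"
    using quad[of "\<lambda>b. z1 $ b"] bx by (simp add: x_def)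
  have S0: "?S \<ge> 0" and A0: "?A0 \<ge> 0" by (simp_all add: sum_nonneg)
  \<comment> \<open>The squared norm \<open>?S\<close> of \<open>x\<close> is the inner product of
    \<open>z1\<close> and \<open>z\<close>. Cauchy--Schwarz together with
    \<open>?A1 \<le> Y * ?S\<close> gives a quadratic inequality, from which one factor
    \<open>?S\<close> is divided out.\<close>
  have "?S\<^sup>2 \<le> ?A1 * ?A0"
    unfolding S by (rule Cauchy_Schwarz_ineq_sum)
  also have "\<dots> \<le> (Y * ?S) * ?A0"
    using low[of "\<lambda>b. z1 $ b"] A0 by (intro mult_right_mono) (auto simp: x_def)
  finally have "?S * ?S \<le> ?S * (Y * ?A0)"
    by (simp add: power2_eq_square mult_ac)
  then have "?S \<le> Y * ?A0"
    using S0 A0 Y by (cases "?S = 0") (auto simp: mult_le_cancel_left)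
  with bx show ?thesis by blast
qed

text \<open>Here \<open>b x\<close> stands for the coordinates of the sketch applied to
  \<open>x\<close> in the rotated basis, and \<open>\<tau>\<close> for powers of singular values.
  The leading coordinates are prescribed by dividing by \<open>\<tau>\<close>; the tail is damped by
  \<open>\<tau>k\<close>, an independent constant bounding the later weights.\<close>

lemma ex_preimage_weighted:
  fixes W :: "nat \<Rightarrow> nat \<Rightarrow> real" and \<Phi> :: "nat \<times> nat \<Rightarrow> real" and \<tau> :: "nat \<Rightarrow> real"
    and m d k r :: nat
  defines "b \<equiv> \<lambda>x a. \<Sum>i<m. W a i * (\<Sum>j<d. \<Phi> (i, j) * x j)"
  assumes low: "\<And>z. sq_sum {..<k} z \<le> Y * (\<Sum>j<d. (lin_comb {..<m} k W \<Phi> z j)\<^sup>2)"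
    and up: "\<And>v. (\<Sum>a\<in>{k..<m}. (b v a)\<^sup>2) \<le> N * sq_sum {..<d} v"
    and NY: "N \<ge> 0" "Y \<ge> 0"
    and \<tau>: "\<And>a. a < k \<Longrightarrow> \<tau> a > 0" "\<And>a. a \<le> i \<Longrightarrow> \<tau> i \<le> \<tau> a" "\<And>a. k \<le> a \<Longrightarrow> a < r \<Longrightarrow> 0 \<le> \<tau> a \<and> \<tau> a \<le> \<tau>k"
    and i: "i < k" and r: "r \<le> m"
    and y: "\<And>j. j < k \<Longrightarrow> i < j \<Longrightarrow> y j = 0"
  shows "\<exists>x. (\<forall>a<k. \<tau> a * b x a = y a) \<and>
    (\<Sum>a\<in>{k..<r}. (\<tau> a * b x a)\<^sup>2) \<le> (\<tau>k / \<tau> i * sqrt (N * Y))\<^sup>2 * sq_sum {..<k} y"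
proof -
  define B where "B a j = (\<Sum>i<m. W a i * \<Phi> (i, j))" for a j
  have bB: "b x a = dot {..<d} (B a) x" for x a
    unfolding b_def B_def sum_distrib_left sum_distrib_right by (subst sum.swap) (simp add: mult_ac)
  define z where "z a = y a / \<tau> a" for a
  have "\<exists>x. (\<forall>a<k. dot {..<d} (B a) x = z a) \<and> sq_sum {..<d} x \<le> Y * sq_sum {..<k} z"
    using low NY by (intro ex_right_inverse_bounded) (simp_all add: lin_comb_alt B_def)
  then obtain x where x: "\<And>a. a < k \<Longrightarrow> b x a = z a" "sq_sum {..<d} x \<le> Y * sq_sum {..<k} z"
    unfolding bB by blast
  have "\<tau> a * b x a = y a" if "a < k" for a
    using x(1)[OF that] \<tau>(1)[OF that] by (simp add: z_def)
  moreover have "(\<Sum>a\<in>{k..<r}. (\<tau> a * b x a)\<^sup>2) \<le> (\<tau>k / \<tau> i * sqrt (N * Y))\<^sup>2 * sq_sum {..<k} y"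
  proof -
    have ti: "\<tau> i > 0" using \<tau>(1) i by simp
    have "(\<Sum>a\<in>{k..<r}. (\<tau> a * b x a)\<^sup>2) \<le> (\<Sum>a\<in>{k..<r}. \<tau>k\<^sup>2 * (b x a)\<^sup>2)"
      using \<tau>(3) by (intro sum_mono) (auto simp: power_mult_distrib intro!: mult_right_mono power_mono)
    also have "\<dots> \<le> (\<Sum>a\<in>{k..<m}. \<tau>k\<^sup>2 * (b x a)\<^sup>2)"
      using r by (intro sum_mono2) auto
    also have "\<dots> \<le> \<tau>k\<^sup>2 * (N * sq_sum {..<d} x)"
      unfolding sum_distrib_left[symmetric] using up by (intro mult_left_mono) auto
    also have "\<dots> \<le> \<tau>k\<^sup>2 * (N * (Y * sq_sum {..<k} z))"
      using x(2) NY by (intro mult_left_mono) auto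
    \<comment> \<open>Entries of \<open>y\<close> beyond \<open>i\<close> vanish and the earlier
      weights are at least \<open>\<tau> i\<close>. This yields the individual ratio for angle
      \<open>i\<close> rather than the worst one.\<close>
    also have "sq_sum {..<k} z \<le> (\<Sum>a<k. (y a)\<^sup>2 / (\<tau> i)\<^sup>2)"
    proof (intro sum_mono)
      fix a assume "a \<in> {..<k}"
      then show "(z a)\<^sup>2 \<le> (y a)\<^sup>2 / (\<tau> i)\<^sup>2"
        using \<tau>(1)[of a] \<tau>(2)[of a] ti y[of a]
        by (cases "a \<le> i") (auto simp: z_def power_divide intro!: divide_left_mono power_mono)
    qed
    then have "\<tau>k\<^sup>2 * (N * (Y * sq_sum {..<k} z)) \<le> \<tau>k\<^sup>2 * (N * (Y * (\<Sum>a<k. (y a)\<^sup>2 / (\<tau> i)\<^sup>2)))"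
      using NY by (intro mult_left_mono) auto
    also have "\<dots> = (\<tau>k / \<tau> i * sqrt (N * Y))\<^sup>2 * sq_sum {..<k} y"
      using NY by (simp add: power_mult_distrib power_divide sum_divide_distrib[symmetric])
    finally show ?thesis by simp
  qed
  ultimately show ?thesis by blast
qed

section \<open>The randomized range finder\<close>

text \<open>Tangent line at \<open>w\<close> of the function
  \<open>x / sqrt (1 + x\<^sup>2)\<close>, which is concave on the nonnegative reals and has slope
  \<open>1 / sqrt (1 + w\<^sup>2) ^ 3\<close> there.\<close>

lemma div_sqrt_le_tangent:
  fixes x w :: real
  assumes x: "x \<ge> 0" and w: "w \<ge> 0"
  shows "x / sqrt (1 + x\<^sup>2) \<le> w / sqrt (1 + w\<^sup>2) + (x - w) / (sqrt (1 + w\<^sup>2)) ^ 3"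
proof -
  define A where "A = sqrt (1 + x\<^sup>2)"
  define B where "B = sqrt (1 + w\<^sup>2)"
  have A: "A > 0" "A\<^sup>2 = 1 + x\<^sup>2" and B: "B > 0" "B\<^sup>2 = 1 + w\<^sup>2"
    by (simp_all add: A_def B_def add_pos_nonneg)
  \<comment> \<open>After clearing denominators and squaring, tangency shows as the double root at
    \<open>x = w\<close>; the cofactor has nonnegative coefficients.\<close>
  have "(w ^ 3 + x)\<^sup>2 * (1 + x\<^sup>2) - x\<^sup>2 * (1 + w\<^sup>2) ^ 3 = (x - w)\<^sup>2 * (x\<^sup>2 + (2 * w + 2 * w ^ 3) * x + w ^ 4)"
    by (simp add: power2_eq_square power3_eq_cube power4_eq_xxxx algebra_simps)
  moreover have "\<dots> \<ge> 0"
    using x w by (intro mult_nonneg_nonneg add_nonneg_nonneg) auto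
  ultimately have "x\<^sup>2 * (1 + w\<^sup>2) ^ 3 \<le> (w ^ 3 + x)\<^sup>2 * (1 + x\<^sup>2)"
    by linarith
  also have "x\<^sup>2 * (1 + w\<^sup>2) ^ 3 = (x * B ^ 3)\<^sup>2"
    unfolding B(2)[symmetric] by (simp add: power_mult_distrib power_mult[symmetric])
  also have "(w ^ 3 + x)\<^sup>2 * (1 + x\<^sup>2) = ((w ^ 3 + x) * A)\<^sup>2"
    unfolding A(2)[symmetric] by (simp add: power_mult_distrib)
  finally have "x * B ^ 3 \<le> (w ^ 3 + x) * A"
    by (rule power2_le_imp_le) (use x w A in auto)
  moreover have B3: "B ^ 3 > 0" using B(1) by simp
  ultimately have "x / A \<le> (w ^ 3 + x) / B ^ 3"
    by (simp only: pos_divide_le_eq[OF A(1)] times_divide_eq_left pos_le_divide_eq[OF B3])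
  also have "w ^ 3 + x = w * B\<^sup>2 + (x - w)"
    unfolding B(2) by (simp add: power2_eq_square power3_eq_cube algebra_simps)
  also have "\<dots> / B ^ 3 = w / B + (x - w) / B ^ 3"
    using B(1) by (simp add: add_divide_distrib power2_eq_square power3_eq_cube)
  finally show ?thesis unfolding A_def B_def .
qed

lemma div_sqrt_mono:
  fixes x y :: real
  assumes "0 \<le> x" "x \<le> y"
  shows "x / sqrt (1 + x\<^sup>2) \<le> y / sqrt (1 + y\<^sup>2)"
proof -
  have "(x * sqrt (1 + y\<^sup>2))\<^sup>2 \<le> (y * sqrt (1 + x\<^sup>2))\<^sup>2"
    using assms power_mono[of x y 2] by (simp add: power_mult_distrib algebra_simps)
  then have "x * sqrt (1 + y\<^sup>2) \<le> y * sqrt (1 + x\<^sup>2)"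
    by (rule power2_le_imp_le) (use assms in auto)
  moreover have "sqrt (1 + x\<^sup>2) > 0" "sqrt (1 + y\<^sup>2) > 0"
    by (simp_all add: add_pos_nonneg)
  ultimately show ?thesis
    by (simp only: pos_divide_le_eq times_divide_eq_left pos_le_divide_eq)
qed

text \<open>No integrability of \<open>F\<close> is assumed: a non-integrable \<open>F\<close> has Bochner integral \<open>0\<close>.\<close>
lemma (in prob_space) integral_le_div_sqrt:
  fixes F H :: "'a \<Rightarrow> real"
  assumes H: "integrable M H" "(\<integral>x. H x \<partial>M) \<le> w" and \<delta>: "\<delta> \<ge> 0" and w: "w \<ge> 0"
    and F: "AE x in M. H x \<ge> 0 \<and> F x \<le> \<delta> * H x / sqrt (1 + (\<delta> * H x)\<^sup>2)"
  shows "(\<integral>x. F x \<partial>M) \<le> \<delta> * w / sqrt (1 + (\<delta> * w)\<^sup>2)"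
proof (cases "integrable M F")
  case False
  then show ?thesis using \<delta> w by (simp add: not_integrable_integral_eq)
next
  case True
  let ?B = "sqrt (1 + (\<delta> * w)\<^sup>2)"
  let ?T = "\<lambda>x. \<delta> * w / ?B + (\<delta> * H x - \<delta> * w) / ?B ^ 3"
  have iT: "integrable M ?T" using H(1) by auto
  have "(\<integral>x. F x \<partial>M) \<le> (\<integral>x. ?T x \<partial>M)"
  proof (rule integral_mono_AE[OF True iT])
    show "AE x in M. F x \<le> ?T x"
      using F
    proof eventually_elim
      case (elim x)
      then have "F x \<le> \<delta> * H x / sqrt (1 + (\<delta> * H x)\<^sup>2)" by simp
      also have "\<dots> \<le> ?T x"
        using elim \<delta> w by (intro div_sqrt_le_tangent) auto
      finally show ?case .
    qed
  qed
  also have "\<dots> = \<delta> * w / ?B + (\<delta> * (\<integral>x. H x \<partial>M) - \<delta> * w) / ?B ^ 3"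
    using H(1) by (simp add: prob_space)
  also have "\<dots> \<le> \<delta> * w / ?B"
    using H(2) \<delta> by (simp add: divide_nonpos_nonneg mult_left_mono)
  finally show ?thesis .
qed

section \<open>Power iteration in singular coordinates and the final estimate\<close>

locale svd =
  fixes m n :: nat and A U V :: "real mat" and \<sigma> :: "nat \<Rightarrow> real"
  assumes nm: "n \<le> m"
    and A_dim: "A \<in> carrier_mat m n"
    and U_dim: "U \<in> carrier_mat m m" and U_orth: "transpose_mat U * U = 1\<^sub>m m"
    and V_dim: "V \<in> carrier_mat n n" and V_orth: "transpose_mat V * V = 1\<^sub>m n"
    and svd: "A = U * diag_rect m n \<sigma> * transpose_mat V"
begin

lemma diag_rect_dim: "diag_rect m n \<sigma> \<in> carrier_mat m n"
  by (simp add: diag_rect_def)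

lemma mult_right_singular:
  assumes a: "a \<in> carrier_vec n"
  shows "A *\<^sub>v (V *\<^sub>v a) = U *\<^sub>v vec m (\<lambda>i. if i < n then \<sigma> i * a $ i else 0)"
proof -
  have "A *\<^sub>v (V *\<^sub>v a) = (U * diag_rect m n \<sigma>) *\<^sub>v (transpose_mat V *\<^sub>v (V *\<^sub>v a))"
    unfolding svd using U_dim V_dim diag_rect_dim a by (intro assoc_mult_mat_vec[of _ m n]) auto
  also have "transpose_mat V *\<^sub>v (V *\<^sub>v a) = a"
    using V_dim V_orth a by (subst assoc_mult_mat_vec[symmetric]) auto
  also have "(U * diag_rect m n \<sigma>) *\<^sub>v a = U *\<^sub>v (diag_rect m n \<sigma> *\<^sub>v a)"
    using U_dim diag_rect_dim a by (intro assoc_mult_mat_vec) auto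
  also have "diag_rect m n \<sigma> *\<^sub>v a = vec m (\<lambda>i. if i < n then \<sigma> i * a $ i else 0)"
  proof (rule eq_vecI)
    fix i assume "i < dim_vec (vec m (\<lambda>i. if i < n then \<sigma> i * a $ i else 0))"
    then have i: "i < m" by simp
    have "(diag_rect m n \<sigma> *\<^sub>v a) $ i = (\<Sum>j<n. diag_rect m n \<sigma> $$ (i, j) * a $ j)"
      by (rule index_mult_mat_vec_sum[OF diag_rect_dim a i])
    also have "\<dots> = (\<Sum>j<n. if i = j then \<sigma> i * a $ i else 0)"
      using i by (intro sum.cong) (auto simp: diag_rect_def)
    finally show "(diag_rect m n \<sigma> *\<^sub>v a) $ i = vec m (\<lambda>i. if i < n then \<sigma> i * a $ i else 0) $ i"
      using i by simp
  qed (use diag_rect_dim in simp)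
  finally show ?thesis .
qed

lemma mult_left_singular:
  assumes b: "b \<in> carrier_vec m"
  shows "transpose_mat A *\<^sub>v (U *\<^sub>v b) = V *\<^sub>v vec n (\<lambda>i. \<sigma> i * b $ i)"
proof -
  let ?D = "transpose_mat (diag_rect m n \<sigma>)"
  have D: "?D \<in> carrier_mat n m" using diag_rect_dim by simp
  have At: "transpose_mat A = V * (?D * transpose_mat U)"
    unfolding svd using U_dim V_dim diag_rect_dim
    by (simp add: transpose_mult[of _ m n _ n] transpose_mult[of _ m m _ n])
  have "transpose_mat A *\<^sub>v (U *\<^sub>v b) = V *\<^sub>v ((?D * transpose_mat U) *\<^sub>v (U *\<^sub>v b))"
    unfolding At using U_dim V_dim D b by (intro assoc_mult_mat_vec[of _ n n _ m]) auto
  also have "(?D * transpose_mat U) *\<^sub>v (U *\<^sub>v b) = ?D *\<^sub>v (transpose_mat U *\<^sub>v (U *\<^sub>v b))"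
    using U_dim D b by (intro assoc_mult_mat_vec[of _ n m _ m]) auto
  also have "transpose_mat U *\<^sub>v (U *\<^sub>v b) = b"
    using U_dim U_orth b by (subst assoc_mult_mat_vec[symmetric]) auto
  also have "?D *\<^sub>v b = vec n (\<lambda>i. \<sigma> i * b $ i)"
  proof (rule eq_vecI)
    fix i assume "i < dim_vec (vec n (\<lambda>i. \<sigma> i * b $ i))"
    then have i: "i < n" by simp
    have "(?D *\<^sub>v b) $ i = (\<Sum>j<m. ?D $$ (i, j) * b $ j)"
      by (rule index_mult_mat_vec_sum[OF D b i])
    also have "\<dots> = (\<Sum>j<m. if j = i then \<sigma> i * b $ i else 0)"
      using i diag_rect_dim by (intro sum.cong) (auto simp: diag_rect_def)
    finally show "(?D *\<^sub>v b) $ i = vec n (\<lambda>i. \<sigma> i * b $ i) $ i"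
      using i nm by simp
  qed (use D in simp)
  finally show ?thesis .
qed

lemma gram_power_singular:
  assumes "a \<in> carrier_vec n"
  shows "(transpose_mat A * A) ^\<^sub>m q *\<^sub>v (V *\<^sub>v a) = V *\<^sub>v vec n (\<lambda>i. \<sigma> i ^ (2 * q) * a $ i)"
  using assms
proof (induction q arbitrary: a)
  case 0
  then have "vec n (\<lambda>i. \<sigma> i ^ (2 * 0) * a $ i) = a" by auto
  then show ?case using A_dim V_dim 0 by simp
next
  case (Suc q)
  let ?N = "transpose_mat A * A"
  have N: "?N \<in> carrier_mat n n" using A_dim by simp
  have Va: "V *\<^sub>v a \<in> carrier_vec n" using V_dim Suc.prems by simp
  have step: "?N *\<^sub>v (V *\<^sub>v a) = V *\<^sub>v vec n (\<lambda>i. (\<sigma> i)\<^sup>2 * a $ i)"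
  proof -
    have "?N *\<^sub>v (V *\<^sub>v a) = transpose_mat A *\<^sub>v (A *\<^sub>v (V *\<^sub>v a))"
      using A_dim Va by (intro assoc_mult_mat_vec[of _ n m _ n]) auto
    also have "\<dots> = V *\<^sub>v vec n (\<lambda>i. \<sigma> i * vec m (\<lambda>i. if i < n then \<sigma> i * a $ i else 0) $ i)"
      unfolding mult_right_singular[OF Suc.prems] by (rule mult_left_singular) simp
    also have "vec n (\<lambda>i. \<sigma> i * vec m (\<lambda>i. if i < n then \<sigma> i * a $ i else 0) $ i) = vec n (\<lambda>i. (\<sigma> i)\<^sup>2 * a $ i)"
      using nm by (intro eq_vecI) (auto simp: power2_eq_square)
    finally show ?thesis .
  qed
  have "?N ^\<^sub>m Suc q *\<^sub>v (V *\<^sub>v a) = ?N ^\<^sub>m q *\<^sub>v (?N *\<^sub>v (V *\<^sub>v a))"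
    using N Va by (simp add: assoc_mult_mat_vec[of _ n n _ n])
  also have "\<dots> = V *\<^sub>v vec n (\<lambda>i. \<sigma> i ^ (2 * q) * vec n (\<lambda>i. (\<sigma> i)\<^sup>2 * a $ i) $ i)"
    unfolding step by (rule Suc.IH) simp
  also have "vec n (\<lambda>i. \<sigma> i ^ (2 * q) * vec n (\<lambda>i. (\<sigma> i)\<^sup>2 * a $ i) $ i) = vec n (\<lambda>i. \<sigma> i ^ (2 * Suc q) * a $ i)"
    by (intro eq_vecI) (auto simp: power_add power2_eq_square)
  finally show ?case .
qed

text \<open>In singular coordinates the iteration is diagonal. The extra multiplication by
  \<open>A\<close> raises the exponent from \<open>2 * q + 1\<close> to \<open>2 * q + 2\<close>,
  which is why the two families of angles have different exponents.\<close>

lemma power_iteration_singular: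
  fixes x :: "nat \<Rightarrow> real" and \<Phi> :: "nat \<times> nat \<Rightarrow> real" and d q :: nat
  defines "b \<equiv> \<lambda>a. \<Sum>i<m. U $$ (i, a) * (\<Sum>j<d. \<Phi> (i, j) * x j)"
  defines "R \<equiv> (transpose_mat A * A) ^\<^sub>m q * transpose_mat A * to_mat m d \<Phi>"
  shows "R *\<^sub>v vec d x =
      V *\<^sub>v vec n (\<lambda>i. \<sigma> i ^ (2 * q + 1) * b i)"
    and "A *\<^sub>v (R *\<^sub>v vec d x) = U *\<^sub>v vec m (\<lambda>i. (if i < n then \<sigma> i ^ (2 * q + 2) else 0) * b i)"
proof -
  let ?N = "(transpose_mat A * A) ^\<^sub>m q" and ?F = "to_mat m d \<Phi>"
  have N: "?N \<in> carrier_mat n n" using A_dim by simp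
  have F: "?F \<in> carrier_mat m d" by (simp add: to_mat_def)
  have Fx: "?F *\<^sub>v vec d x \<in> carrier_vec m" using F by simp
  have Ub: "?F *\<^sub>v vec d x = U *\<^sub>v vec m b"
  proof -
    have "U * transpose_mat U = 1\<^sub>m m"
      using U_dim U_orth by (intro mat_mult_left_right_inverse[of "transpose_mat U"]) auto
    then have "?F *\<^sub>v vec d x = U *\<^sub>v (transpose_mat U *\<^sub>v (?F *\<^sub>v vec d x))"
      using U_dim Fx by (subst assoc_mult_mat_vec[symmetric]) auto
    also have "transpose_mat U *\<^sub>v (?F *\<^sub>v vec d x) = vec m b"
    proof (rule eq_vecI)
      fix a assume "a < dim_vec (vec m b)"
      then have a: "a < m" by simp
      have Fi: "(?F *\<^sub>v vec d x) $ i = (\<Sum>j<d. \<Phi> (i, j) * x j)" if "i < m" for i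
        using index_mult_mat_vec_sum[OF F _ that, of "vec d x"] that by (simp add: to_mat_def)
      have "(transpose_mat U *\<^sub>v (?F *\<^sub>v vec d x)) $ a = (\<Sum>i<m. transpose_mat U $$ (a, i) * (?F *\<^sub>v vec d x) $ i)"
        using U_dim by (intro index_mult_mat_vec_sum[OF _ Fx a]) simp
      also have "\<dots> = b a"
        unfolding b_def using a U_dim Fi by (intro sum.cong) auto
      finally show "(transpose_mat U *\<^sub>v (?F *\<^sub>v vec d x)) $ a = vec m b $ a" using a by simp
    qed (use U_dim in simp)
    finally show ?thesis .
  qed
  have "R *\<^sub>v vec d x = (?N * transpose_mat A) *\<^sub>v (?F *\<^sub>v vec d x)"
    unfolding R_def using N A_dim F by (intro assoc_mult_mat_vec[of _ n m _ d]) auto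
  also have "\<dots> = ?N *\<^sub>v (transpose_mat A *\<^sub>v (?F *\<^sub>v vec d x))"
    using N A_dim Fx by (intro assoc_mult_mat_vec[of _ n n _ m]) auto
  also have "\<dots> = ?N *\<^sub>v (V *\<^sub>v vec n (\<lambda>i. \<sigma> i * vec m b $ i))"
    unfolding Ub by (subst mult_left_singular) auto
  also have "\<dots> = V *\<^sub>v vec n (\<lambda>i. \<sigma> i ^ (2 * q) * vec n (\<lambda>i. \<sigma> i * vec m b $ i) $ i)"
    by (rule gram_power_singular) simp
  also have "vec n (\<lambda>i. \<sigma> i ^ (2 * q) * vec n (\<lambda>i. \<sigma> i * vec m b $ i) $ i) = vec n (\<lambda>i. \<sigma> i ^ (2 * q + 1) * b i)"
    using nm by (intro eq_vecI) auto
  finally show 1: "R *\<^sub>v vec d x = V *\<^sub>v vec n (\<lambda>i. \<sigma> i ^ (2 * q + 1) * b i)" .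
  have "A *\<^sub>v (R *\<^sub>v vec d x) =
      U *\<^sub>v vec m (\<lambda>i. if i < n then \<sigma> i * vec n (\<lambda>i. \<sigma> i ^ (2 * q + 1) * b i) $ i else 0)"
    unfolding 1 by (rule mult_right_singular) simp
  also have "vec m (\<lambda>i. if i < n then \<sigma> i * vec n (\<lambda>i. \<sigma> i ^ (2 * q + 1) * b i) $ i else 0) =
      vec m (\<lambda>i. (if i < n then \<sigma> i ^ (2 * q + 2) else 0) * b i)"
    by (intro eq_vecI) auto
  finally show "A *\<^sub>v (R *\<^sub>v vec d x) = U *\<^sub>v vec m (\<lambda>i. (if i < n then \<sigma> i ^ (2 * q + 2) else 0) * b i)" .
qed

end

theorem theorem7:
  fixes m n k p q :: nat
    and A U V :: "real mat" and \<sigma> :: "nat \<Rightarrow> real"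
    and Pbar Q R Ptil Rtil :: "(nat \<times> nat \<Rightarrow> real) \<Rightarrow> real mat"
  defines "d \<equiv> k + p"
    and "\<Phi>M \<equiv> to_mat m (k + p)"
    and "G \<equiv> gaussian_matrix_measure m (k + p)"
    and "\<omega> \<equiv> (sqrt (real m - real k) + sqrt (real (k + p)) + 7)
              * (4 * exp 1 * sqrt (real (k + p)) / (real p + 1))"
  assumes mn: "n \<le> m" and k1: "1 \<le> k" and p2: "2 \<le> p" and dn: "k + p < n"
    and A_dim: "A \<in> carrier_mat m n"
    and U_dim: "U \<in> carrier_mat m m" and U_orth: "transpose_mat U * U = 1\<^sub>m m"
    and V_dim: "V \<in> carrier_mat n n" and V_orth: "transpose_mat V * V = 1\<^sub>m n"
    and svd: "A = U * diag_rect m n \<sigma> * transpose_mat V"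
    and \<sigma>_nonneg: "\<forall>i<n. 0 \<le> \<sigma> i"
    and \<sigma>_sorted: "\<forall>i j. i \<le> j \<longrightarrow> j < n \<longrightarrow> \<sigma> j \<le> \<sigma> i"
    and \<sigma>k_pos: "\<sigma> (k - 1) > 0"
    and alg: "AE \<Phi> in G.
        Pbar \<Phi> \<in> carrier_mat n d \<and> transpose_mat (Pbar \<Phi>) * Pbar \<Phi> = 1\<^sub>m d \<and>
        col_space (Pbar \<Phi>) =
          col_space ((transpose_mat A * A) ^\<^sub>m q * transpose_mat A * \<Phi>M \<Phi>) \<and>
        Q \<Phi> \<in> carrier_mat m d \<and> transpose_mat (Q \<Phi>) * Q \<Phi> = 1\<^sub>m d \<and>
        R \<Phi> \<in> carrier_mat d d \<and> upper_triangular (R \<Phi>) \<and>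
        A * Pbar \<Phi> = Q \<Phi> * R \<Phi> \<and>
        Ptil \<Phi> \<in> carrier_mat d d \<and> transpose_mat (Ptil \<Phi>) * Ptil \<Phi> = 1\<^sub>m d \<and>
        Rtil \<Phi> \<in> carrier_mat d d \<and> upper_triangular (Rtil \<Phi>) \<and>
        transpose_mat (R \<Phi>) = Ptil \<Phi> * Rtil \<Phi>"
  shows "\<forall>i<k.
     (LINT \<Phi>|G. sin (principal_angles (Q \<Phi>) (first_cols k U) ! i))
        \<le> (\<sigma> k / \<sigma> i) ^ (2*q+2) * \<omega> / sqrt (1 + (\<sigma> k / \<sigma> i) ^ (4*q+4) * \<omega>^2)
   \<and> (LINT \<Phi>|G. sin (principal_angles (Pbar \<Phi> * Ptil \<Phi>) (first_cols k V) ! i))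
        \<le> (\<sigma> k / \<sigma> i) ^ (2*q+1) * \<omega> / sqrt (1 + (\<sigma> k / \<sigma> i) ^ (4*q+2) * \<omega>^2)"
proof (intro allI impI)
  fix i assume i: "i < k"
  interpret svd m n A U V \<sigma>
    by unfold_locales (fact mn A_dim U_dim U_orth V_dim V_orth svd)+
  define W where "W a j = U $$ (j, a)" for a j
  have kpm: "k + p < m" using dn mn by simp
  have Worth: "dot {..<m} (W a) (W b) = (if a = b then 1 else 0)" if "a < m" "b < m" for a b
    unfolding W_def using orthonormal_columns[OF U_dim U_orth that] .
  have G: "G = gauss ({..<m} \<times> {..<k + p})"
    by (simp add: G_def gaussian_matrix_measure_def std_gauss_def)
  interpret prob_space G unfolding G by (rule prob_space_gauss)
  define \<omega>0 where "\<omega>0 = (sqrt (real (m - k)) + sqrt (real (k + p))) * (4 * exp 1 * sqrt (real (k + p)) / (real p + 1))"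
  obtain H where H: "integrable G H" "(\<integral>X. H X \<partial>G) \<le> \<omega>0"
    and HAE: "AE X in G. \<exists>N Y. sqrt (N * Y) \<le> H X \<and> sketch_bounds m k (k + p) W X N Y"
    using gaussian_majorant[OF k1 p2 kpm Worth] unfolding \<omega>0_def G by blast
  have "\<omega>0 \<le> \<omega>"
    unfolding \<omega>0_def \<omega>_def using kpm by (intro mult_right_mono) (auto simp: of_nat_diff)
  with H(2) have H2: "(\<integral>X. H X \<partial>G) \<le> \<omega>" by simp
  have \<omega>: "\<omega> \<ge> 0"
    unfolding \<omega>_def using kpm by (intro mult_nonneg_nonneg add_nonneg_nonneg) auto
  have kn: "k < n" "i < n" using dn i by auto
  have \<sigma>pos: "\<sigma> a > 0" if "a < k" for a
  proof -
    have "\<sigma> (k - 1) \<le> \<sigma> a" using \<sigma>_sorted that kn by auto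
    then show ?thesis using \<sigma>k_pos by simp
  qed
  have \<sigma>k: "\<sigma> k \<ge> 0" using \<sigma>_nonneg kn by simp
  \<comment> \<open>Indices start at 0, so \<open>\<sigma> k\<close> is the singular value number
    k+1. Padding the weights with 0 from index \<open>n\<close> on lets the \<open>m\<close> left
    and the \<open>n\<close> right coordinates be treated alike.\<close>
  let ?\<delta> = "\<sigma> k / \<sigma> i" and ?\<tau> = "\<lambda>s a. if a < n then \<sigma> a ^ s else 0"
  have \<delta>: "?\<delta> \<ge> 0" using \<sigma>k \<sigma>pos[OF i] by simp
  let ?R = "\<lambda>\<Phi>. (transpose_mat A * A) ^\<^sub>m q * transpose_mat A * \<Phi>M \<Phi>"
  have key: "AE \<Phi> in G. H \<Phi> \<ge> 0 \<and>
    sin (principal_angles (Q \<Phi>) (first_cols k U) ! i) \<le>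
      ?\<delta> ^ (2 * q + 2) * H \<Phi> / sqrt (1 + (?\<delta> ^ (2 * q + 2) * H \<Phi>)\<^sup>2) \<and>
    sin (principal_angles (Pbar \<Phi> * Ptil \<Phi>) (first_cols k V) ! i) \<le>
      ?\<delta> ^ (2 * q + 1) * H \<Phi> / sqrt (1 + (?\<delta> ^ (2 * q + 1) * H \<Phi>)\<^sup>2)"
    using alg HAE
  proof eventually_elim
    case (elim \<Phi>)
    have Pb: "Pbar \<Phi> \<in> carrier_mat n d" "transpose_mat (Pbar \<Phi>) * Pbar \<Phi> = 1\<^sub>m d"
      and cs: "col_space (Pbar \<Phi>) = col_space (?R \<Phi>)"
      and Q: "Q \<Phi> \<in> carrier_mat m d" "transpose_mat (Q \<Phi>) * Q \<Phi> = 1\<^sub>m d"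
      and R: "R \<Phi> \<in> carrier_mat d d" and AP: "A * Pbar \<Phi> = Q \<Phi> * R \<Phi>"
      and Pt: "Ptil \<Phi> \<in> carrier_mat d d" "transpose_mat (Ptil \<Phi>) * Ptil \<Phi> = 1\<^sub>m d"
      using elim(1) by auto
    obtain N Y where NY: "N \<ge> 0" "Y \<ge> 0" "sqrt (N * Y) \<le> H \<Phi>"
      and low: "\<And>z. sq_sum {..<k} z \<le> Y * (\<Sum>j<d. (lin_comb {..<m} k W \<Phi> z j)\<^sup>2)"
      and up: "\<And>v. (\<Sum>a\<in>{k..<m}. (\<Sum>i<m. W a i * (\<Sum>j<d. \<Phi> (i, j) * v j))\<^sup>2) \<le> N * sq_sum {..<d} v"
      using elim(2) unfolding d_def sketch_bounds_def by blast
    have H0: "H \<Phi> \<ge> 0" using NY order_trans[OF real_sqrt_ge_zero NY(3)] by simp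
    let ?b = "\<lambda>x a. \<Sum>i<m. W a i * (\<Sum>j<d. \<Phi> (i, j) * x j)"
    \<comment> \<open>Serves both families of angles: exponent \<open>2 * q + 2\<close> with
      \<open>r = m\<close> for \<open>Q\<close>, exponent \<open>2 * q + 1\<close> with
      \<open>r = n\<close> for \<open>Pbar * Ptil\<close>.\<close>
    have pre: "\<exists>x. (\<forall>a<k. ?\<tau> s a * ?b x a = y a) \<and>
        (\<Sum>a\<in>{k..<r}. (?\<tau> s a * ?b x a)\<^sup>2) \<le>
        (?\<delta> ^ s * sqrt (N * Y))\<^sup>2 * sq_sum {..<k} y"
      if "r \<le> m" and y: "\<And>j. j < k \<Longrightarrow> i < j \<Longrightarrow> y j = 0" for r s y
    proof -
      have "\<exists>x. (\<forall>a<k. ?\<tau> s a * ?b x a = y a) \<and>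
        (\<Sum>a\<in>{k..<r}. (?\<tau> s a * ?b x a)\<^sup>2) \<le> (\<sigma> k ^ s / ?\<tau> s i * sqrt (N * Y))\<^sup>2 * sq_sum {..<k} y"
      proof (rule ex_preimage_weighted[OF low up NY(1,2) _ _ _ i that(1) y])
        show "0 < ?\<tau> s a" if "a < k" for a using that kn \<sigma>pos by simp
        show "?\<tau> s i \<le> ?\<tau> s a" if "a \<le> i" for a
          using that kn \<sigma>_sorted \<sigma>pos[OF i] by (auto intro!: power_mono)
        show "0 \<le> ?\<tau> s a \<and> ?\<tau> s a \<le> \<sigma> k ^ s" if "k \<le> a" "a < r" for a
          using that \<sigma>_sorted \<sigma>_nonneg \<sigma>k by (auto intro!: power_mono)
      qed
      then show ?thesis using kn by (simp add: power_divide)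
    qed
    have ran: "\<exists>c. c \<in> carrier_vec d \<and> ?R \<Phi> *\<^sub>v vec d x = Pbar \<Phi> *\<^sub>v c" for x
    proof -
      have "vec d x \<in> carrier_vec (dim_col (?R \<Phi>))" by (simp add: \<Phi>M_def d_def to_mat_def)
      then have "?R \<Phi> *\<^sub>v vec d x \<in> col_space (?R \<Phi>)"
        unfolding col_space_def by blast
      then have "?R \<Phi> *\<^sub>v vec d x \<in> col_space (Pbar \<Phi>)"
        by (simp only: cs)
      then obtain c where "c \<in> carrier_vec (dim_col (Pbar \<Phi>))" "?R \<Phi> *\<^sub>v vec d x = Pbar \<Phi> *\<^sub>v c"
        unfolding col_space_def by blast
      then show ?thesis using Pb(1) by (intro exI[of _ c]) simp
    qed
    have \<Phi>M': "\<Phi>M \<Phi> = to_mat m d \<Phi>" by (simp add: \<Phi>M_def d_def)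
    have nn: "0 \<le> ?\<delta> ^ s * sqrt (N * Y)" for s
      using \<delta> NY by (intro mult_nonneg_nonneg zero_le_power) auto
    \<comment> \<open>Trades the factors \<open>N\<close> and \<open>Y\<close>, chosen separately
      for each \<open>\<Phi>\<close>, for the single integrable function \<open>H\<close>.\<close>
    have fin: "\<rho> / sqrt (1 + \<rho>\<^sup>2) \<le> ?\<delta> ^ s * H \<Phi> / sqrt (1 + (?\<delta> ^ s * H \<Phi>)\<^sup>2)"
      if "\<rho> = ?\<delta> ^ s * sqrt (N * Y)" for \<rho> s
      unfolding that using \<delta> NY by (intro div_sqrt_mono mult_left_mono mult_nonneg_nonneg) auto
    have "sin (principal_angles (Q \<Phi>) (first_cols k U) ! i) \<le>
      (?\<delta> ^ (2 * q + 2) * sqrt (N * Y)) / sqrt (1 + (?\<delta> ^ (2 * q + 2) * sqrt (N * Y))\<^sup>2)"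
    proof (rule sin_principal_angle_le[OF Q U_dim U_orth _ i])
      fix y :: "nat \<Rightarrow> real"
      assume y: "\<And>j. j < k \<Longrightarrow> i < j \<Longrightarrow> y j = 0"
      obtain x where x: "\<forall>a<k. ?\<tau> (2 * q + 2) a * ?b x a = y a"
        "(\<Sum>a\<in>{k..<m}. (?\<tau> (2 * q + 2) a * ?b x a)\<^sup>2) \<le>
        (?\<delta> ^ (2 * q + 2) * sqrt (N * Y))\<^sup>2 * sq_sum {..<k} y"
        using pre[of m y "2 * q + 2"] y by blast
      obtain c where c: "c \<in> carrier_vec d" "?R \<Phi> *\<^sub>v vec d x = Pbar \<Phi> *\<^sub>v c" using ran by blast
      \<comment> \<open>Since \<open>A * Pbar \<Phi> = Q \<Phi> * R \<Phi>\<close>, the image under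
        \<open>A\<close> of a vector in the range of \<open>Pbar \<Phi>\<close> lies in the range of
        \<open>Q \<Phi>\<close>, with coefficients \<open>R \<Phi> *\<^sub>v c\<close>.\<close>
      have "Q \<Phi> *\<^sub>v (R \<Phi> *\<^sub>v c) = (A * Pbar \<Phi>) *\<^sub>v c"
        unfolding AP using Q R c by (intro assoc_mult_mat_vec[symmetric]) auto
      also have "\<dots> = A *\<^sub>v (Pbar \<Phi> *\<^sub>v c)"
        using A_dim Pb c by (intro assoc_mult_mat_vec) auto
      also have "\<dots> = U *\<^sub>v vec m (\<lambda>a. ?\<tau> (2 * q + 2) a * ?b x a)"
        unfolding c(2)[symmetric] \<Phi>M' W_def by (rule power_iteration_singular(2))
      finally have eq: "Q \<Phi> *\<^sub>v (R \<Phi> *\<^sub>v c) = U *\<^sub>v vec m (\<lambda>a. ?\<tau> (2 * q + 2) a * ?b x a)" .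
      show "\<exists>c \<beta>. c \<in> carrier_vec d \<and> Q \<Phi> *\<^sub>v c = U *\<^sub>v vec m \<beta> \<and>
         (\<forall>a<k. \<beta> a = y a) \<and> (\<Sum>a\<in>{k..<m}. (\<beta> a)\<^sup>2) \<le> (?\<delta> ^ (2 * q + 2) * sqrt (N * Y))\<^sup>2 * sq_sum {..<k} y"
      proof (intro exI conjI)
        show "R \<Phi> *\<^sub>v c \<in> carrier_vec d" using R c by auto
      qed (fact eq x)+
    qed (use kpm in simp, rule nn)
    moreover have "sin (principal_angles (Pbar \<Phi> * Ptil \<Phi>) (first_cols k V) ! i) \<le>
      (?\<delta> ^ (2 * q + 1) * sqrt (N * Y)) / sqrt (1 + (?\<delta> ^ (2 * q + 1) * sqrt (N * Y))\<^sup>2)"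
    proof (rule sin_principal_angle_le[OF _ _ V_dim V_orth _ i])
      show "Pbar \<Phi> * Ptil \<Phi> \<in> carrier_mat n d" using Pb Pt by auto
      have "transpose_mat (Pbar \<Phi> * Ptil \<Phi>) * (Pbar \<Phi> * Ptil \<Phi>) =
        transpose_mat (Ptil \<Phi>) * (transpose_mat (Pbar \<Phi>) * (Pbar \<Phi> * Ptil \<Phi>))"
        using Pb Pt by (subst transpose_mult[OF Pb(1) Pt(1)]) (intro assoc_mult_mat, auto)
      also have "transpose_mat (Pbar \<Phi>) * (Pbar \<Phi> * Ptil \<Phi>) = transpose_mat (Pbar \<Phi>) * Pbar \<Phi> * Ptil \<Phi>"
        using Pb Pt by (intro assoc_mult_mat[symmetric]) auto
      also have "\<dots> = Ptil \<Phi>" using Pb Pt by simp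
      finally show "transpose_mat (Pbar \<Phi> * Ptil \<Phi>) * (Pbar \<Phi> * Ptil \<Phi>) = 1\<^sub>m d"
        using Pt by simp
      fix y :: "nat \<Rightarrow> real"
      assume y: "\<And>j. j < k \<Longrightarrow> i < j \<Longrightarrow> y j = 0"
      obtain x where x: "\<forall>a<k. ?\<tau> (2 * q + 1) a * ?b x a = y a"
        "(\<Sum>a\<in>{k..<n}. (?\<tau> (2 * q + 1) a * ?b x a)\<^sup>2) \<le>
        (?\<delta> ^ (2 * q + 1) * sqrt (N * Y))\<^sup>2 * sq_sum {..<k} y"
        using pre[of n y "2 * q + 1"] y mn by blast
      obtain c where c: "c \<in> carrier_vec d" "?R \<Phi> *\<^sub>v vec d x = Pbar \<Phi> *\<^sub>v c" using ran by blast
      \<comment> \<open>The square matrix \<open>Ptil \<Phi>\<close> is orthogonal, so the product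
        with it has the same range as \<open>Pbar \<Phi>\<close> and only the coefficients are
        rotated.\<close>
      let ?c = "transpose_mat (Ptil \<Phi>) *\<^sub>v c"
      have PP: "Ptil \<Phi> * transpose_mat (Ptil \<Phi>) = 1\<^sub>m d"
        using Pt by (intro mat_mult_left_right_inverse[of "transpose_mat (Ptil \<Phi>)"]) auto
      have "(Pbar \<Phi> * Ptil \<Phi>) *\<^sub>v ?c = Pbar \<Phi> *\<^sub>v (Ptil \<Phi> *\<^sub>v ?c)"
        using Pb Pt c by (intro assoc_mult_mat_vec) auto
      also have "Ptil \<Phi> *\<^sub>v ?c = c"
        using Pt c PP by (subst assoc_mult_mat_vec[symmetric]) auto
      also have "Pbar \<Phi> *\<^sub>v c = V *\<^sub>v vec n (\<lambda>a. \<sigma> a ^ (2 * q + 1) * ?b x a)"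
        unfolding c(2)[symmetric] \<Phi>M' W_def by (rule power_iteration_singular(1))
      also have "vec n (\<lambda>a. \<sigma> a ^ (2 * q + 1) * ?b x a) = vec n (\<lambda>a. ?\<tau> (2 * q + 1) a * ?b x a)"
        by (intro eq_vecI) auto
      finally have eq: "(Pbar \<Phi> * Ptil \<Phi>) *\<^sub>v (transpose_mat (Ptil \<Phi>) *\<^sub>v c) = V *\<^sub>v vec n (\<lambda>a. ?\<tau> (2 * q + 1) a * ?b x a)" .
      show "\<exists>c \<beta>. c \<in> carrier_vec d \<and> (Pbar \<Phi> * Ptil \<Phi>) *\<^sub>v c = V *\<^sub>v vec n \<beta> \<and>
         (\<forall>a<k. \<beta> a = y a) \<and> (\<Sum>a\<in>{k..<n}. (\<beta> a)\<^sup>2) \<le> (?\<delta> ^ (2 * q + 1) * sqrt (N * Y))\<^sup>2 * sq_sum {..<k} y"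
      proof (intro exI conjI)
        show "transpose_mat (Ptil \<Phi>) *\<^sub>v c \<in> carrier_vec d" using Pt c by auto
      qed (fact eq x)+
    qed (use kn in simp, rule nn)
    ultimately show ?case
      using H0 order_trans[OF _ fin[OF refl]] by blast
  qed
  have sq: "(?\<delta> ^ s * \<omega>)\<^sup>2 = ?\<delta> ^ (2 * s) * \<omega>\<^sup>2" for s
    by (simp only: power_mult_distrib power_mult[symmetric] mult.commute[of s])
  have ps: "2 * (2 * q + 2) = 4 * q + 4" "2 * (2 * q + 1) = 4 * q + 2" by simp_all
  have "(LINT \<Phi>|G. sin (principal_angles (Q \<Phi>) (first_cols k U) ! i)) \<le>
      ?\<delta> ^ (2 * q + 2) * \<omega> / sqrt (1 + (?\<delta> ^ (2 * q + 2) * \<omega>)\<^sup>2)"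
    by (rule integral_le_div_sqrt[OF H(1) H2 zero_le_power[OF \<delta>] \<omega>]) (use key in eventually_elim, simp)
  moreover have "(LINT \<Phi>|G. sin (principal_angles (Pbar \<Phi> * Ptil \<Phi>) (first_cols k V) ! i)) \<le>
      ?\<delta> ^ (2 * q + 1) * \<omega> / sqrt (1 + (?\<delta> ^ (2 * q + 1) * \<omega>)\<^sup>2)"
    by (rule integral_le_div_sqrt[OF H(1) H2 zero_le_power[OF \<delta>] \<omega>]) (use key in eventually_elim, simp)
  ultimately show "(LINT \<Phi>|G. sin (principal_angles (Q \<Phi>) (first_cols k U) ! i))
        \<le> (\<sigma> k / \<sigma> i) ^ (2*q+2) * \<omega> / sqrt (1 + (\<sigma> k / \<sigma> i) ^ (4*q+4) * \<omega>^2)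
   \<and> (LINT \<Phi>|G. sin (principal_angles (Pbar \<Phi> * Ptil \<Phi>) (first_cols k V) ! i))
        \<le> (\<sigma> k / \<sigma> i) ^ (2*q+1) * \<omega> / sqrt (1 + (\<sigma> k / \<sigma> i) ^ (4*q+2) * \<omega>^2)"
    unfolding sq ps by blast
qed

end
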